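(* Let $n\ge 1$ and $k\ge 0$ be integers. For any symmetric function $f\in\Lambda^{(k)}$ (homogeneous of degree $k$), $$\Delta_f e_n\big|_{t=1/q}=\frac{f\big[[n]_q\big]\; e_n\big[X[k+1]_q\big]}{q^{k(n-1)}\,[k+1]_q}.$$
   Context: $\Lambda$ is the ring of symmetric functions in $x_1,x_2,\ldots$ over $\mathbb{Q}(q,t)$, $\Lambda^{(k)}$ its degree $k$ homogeneous part, $X=x_1+x_2+\cdots$, and $[m]_q=1+q+\cdots+q^{m-1}$. Square brackets after a symmetric function denote plethysm: $p_r[E]$ is obtained from the expression $E$ (a sum of monomials in $q,t,x_1,x_2,\ldots$) by raising every monomial to its $r$th power, and $f[E]$ is obtained by expanding $f$ in power sums $p_\lambda$ and replacing $p_\lambda$ by $\prod_i p_{\lambda_i}[E]$. The specialization $t=1/q$ is applied to everything, including any coefficients of $f$. $\tilde H_\mu$ are the modified Macdonald polynomials (a basis of $\Lambda$), characterized by: $\tilde H_\mu[X(1-q)]$ is in the span of $\{s_\lambda:\lambda\ge\mu\}$, $\tilde H_\mu[X(1-t)]$ is in the span of $\{s_\lambda:\lambda\ge\mu'\}$ (dominance order), and $\langle\tilde H_\mu,s_{(n)}\rangle=1$ for $\mu\vdash n$. For a cell $c$ of the Young diagram of $\mu$ (French notation), $a'(c)$ and $\ell'(c)$ are the numbers of cells of $\mu$ strictly to the left of $c$ and strictly below $c$, and $B_\mu(q,t)=\sum_{c\in\mu}q^{a'(c)}t^{\ell'(c)}$. The linear operator $\Delta_f$ on $\Lambda$ is defined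 by $\Delta_f\tilde H_\mu=f[B_\mu(q,t)]\tilde H_\mu$. *)

theory Defs
  imports
    "HOL-Library.Multiset"
    "HOL-Computational_Algebra.Computational_Algebra"
    "HOL-Computational_Algebra.Field_as_Ring"
    "Jordan_Normal_Form.Determinant"
begin

section \<open>The ring of symmetric functions\<close>

text \<open>
  A monomial in the variables $x_0, x_1, x_2, \ldots$ is a multiset of indices (the multiplicity of
  \<open>i\<close> is the exponent of $x_i$). A symmetric function is a formal power series, given by its
  coefficient function, that is invariant under permutations of the variables and has bounded degree.
\<close>

typedef (overloaded) 'a sym =
  "{f :: nat multiset \<Rightarrow> 'a :: zero.
      (\<forall>\<sigma> M. bij \<sigma> \<longrightarrow> f (image_mset \<sigma> M) = f M) \<and> (\<exists>d. \<forall>M. f M \<noteq> 0 \<longrightarrow> size M \<le> d)}"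
  morphisms coeff_sym Abs_sym
  by (rule exI[of _ "\<lambda>_. 0"]) simp

setup_lifting type_definition_sym

lemma sym_eqI: "(\<And>M. coeff_sym f M = coeff_sym g M) \<Longrightarrow> f = g"
  by (metis coeff_sym_inject ext)

definition splits :: "nat multiset \<Rightarrow> (nat multiset \<times> nat multiset) set" where
  "splits M = {(A, B). A + B = M}"

lemma finite_splits: "finite (splits M)"
proof -
  let ?S = "mset ` {xs. set xs \<subseteq> set_mset M \<and> length xs \<le> size M}"
  have *: "A \<in> ?S" if "A \<subseteq># M" for A
  proof -
    obtain xs where xs: "mset xs = A" using ex_mset by blast
    then have "set xs \<subseteq> set_mset M" "length xs \<le> size M"
      using set_mset_mono[OF that] size_mset_mono[OF that] by auto
    then show ?thesis using xs by blast
  qed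
  have "splits M \<subseteq> ?S \<times> ?S"
    proof
    fix x assume x: "x \<in> splits M"
    then have "fst x \<subseteq># M" "snd x \<subseteq># M" by (auto simp: splits_def)
    then have "fst x \<in> ?S" "snd x \<in> ?S" using * by blast+
    then show "x \<in> ?S \<times> ?S" by (simp only: mem_Times_iff)
  qed
  moreover have "finite ?S"
    by (intro finite_imageI finite_lists_length_le) simp
  ultimately show ?thesis by (meson finite_SigmaI finite_subset)
qed

lemma splits_image_mset:
  assumes "bij \<sigma>"
  shows "splits (image_mset \<sigma> M) = map_prod (image_mset \<sigma>) (image_mset \<sigma>) ` splits M"
proof -
  have inv_im: "image_mset \<sigma> (image_mset (inv_into UNIV \<sigma>) A) = A" "image_mset (inv_into UNIV \<sigma>) (image_mset \<sigma> A) = A" for A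
    using assms by (simp_all add: multiset.map_comp bij_is_surj bij_is_inj surj_iff[THEN iffD1] inj_iff[THEN iffD1])
  show ?thesis
  proof (intro equalityI subsetI)
    fix x assume "x \<in> splits (image_mset \<sigma> M)"
    then obtain A B where x: "x = (A, B)" and AB: "A + B = image_mset \<sigma> M"
      by (auto simp: splits_def)
    have "image_mset (inv_into UNIV \<sigma>) A + image_mset (inv_into UNIV \<sigma>) B = M"
      using inv_im(2)[of M] by (simp only: AB[symmetric] image_mset_union)
    then have "(image_mset (inv_into UNIV \<sigma>) A, image_mset (inv_into UNIV \<sigma>) B) \<in> splits M"
      by (simp add: splits_def)
    then show "x \<in> map_prod (image_mset \<sigma>) (image_mset \<sigma>) ` splits M"
      by (rule rev_image_eqI) (simp only: x map_prod_simp inv_im)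
  qed (auto simp: splits_def)
qed

lemma inj_image_mset_bij: "bij \<sigma> \<Longrightarrow> inj (image_mset \<sigma>)"
  by (metis bij_is_inj inj_on_def multiset.inj_map)

lemma all_bij_iff: "bij \<sigma> \<Longrightarrow> (\<forall>i. P (\<sigma> i)) \<longleftrightarrow> (\<forall>i. P i)"
  using surjD[OF bij_is_surj] by metis

lemma ex_bij_iff: "bij \<sigma> \<Longrightarrow> (\<exists>i. P (\<sigma> i)) \<longleftrightarrow> (\<exists>i. P i)"
  using surjD[OF bij_is_surj] by metis

instantiation sym :: (comm_ring_1) comm_ring_1
begin

lift_definition zero_sym :: "'a sym" is "\<lambda>_. 0" by simp

lift_definition one_sym :: "'a sym" is "\<lambda>M. if M = {#} then 1 else 0" by auto

lift_definition plus_sym :: "'a sym \<Rightarrow> 'a sym \<Rightarrow> 'a sym" is "\<lambda>f g M. f M + g M"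
proof (intro conjI allI impI, goal_cases)
  case (2 f g)
  then obtain d e where "\<forall>M. f M \<noteq> 0 \<longrightarrow> size M \<le> d" "\<forall>M. g M \<noteq> 0 \<longrightarrow> size M \<le> e" by blast
  then show ?case
    by (intro exI[of _ "max d e"]) (metis add.right_neutral le_max_iff_disj)
qed auto

lift_definition uminus_sym :: "'a sym \<Rightarrow> 'a sym" is "\<lambda>f M. - f M" by auto

lift_definition minus_sym :: "'a sym \<Rightarrow> 'a sym \<Rightarrow> 'a sym" is "\<lambda>f g M. f M - g M"
proof (intro conjI allI impI, goal_cases)
  case (2 f g)
  then obtain d e where "\<forall>M. f M \<noteq> 0 \<longrightarrow> size M \<le> d" "\<forall>M. g M \<noteq> 0 \<longrightarrow> size M \<le> e" by blast
  then show ?case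
    by (intro exI[of _ "max d e"]) (metis diff_zero le_max_iff_disj)
qed auto

lift_definition times_sym :: "'a sym \<Rightarrow> 'a sym \<Rightarrow> 'a sym" is
  "\<lambda>f g M. \<Sum>(A, B)\<in>splits M. f A * g B"
proof (intro conjI allI impI, goal_cases)
  case (1 f g \<sigma> M)
  have "inj_on (map_prod (image_mset \<sigma>) (image_mset \<sigma>)) (splits M)"
    using inj_image_mset_bij[OF 1(3)] by (meson inj_on_subset prod.inj_map subset_UNIV)
  then show ?case
    using 1 by (subst splits_image_mset) (auto simp: sum.reindex intro!: sum.cong)
next
  case (2 f g)
  then obtain d e where de: "\<forall>M. f M \<noteq> 0 \<longrightarrow> size M \<le> d" "\<forall>M. g M \<noteq> 0 \<longrightarrow> size M \<le> e" by blast
  have "size M \<le> d + e" if nz: "(\<Sum>(A, B)\<in>splits M. f A * g B) \<noteq> 0" for M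
  proof -
    from nz obtain A B where AB: "(A, B) \<in> splits M" "f A * g B \<noteq> 0"
      by (auto elim!: sum.not_neutral_contains_not_neutral)
    then have "f A \<noteq> 0" "g B \<noteq> 0" by auto
    then have "size A \<le> d" "size B \<le> e" using de by auto
    with AB(1) show ?thesis by (auto simp: splits_def)
  qed
  then show ?case by blast
qed

instance
proof
  fix a b c :: "'a sym"
  show "a * b * c = a * (b * c)"
  proof (rule sym_eqI)
    fix M
    let ?f = "coeff_sym a" and ?g = "coeff_sym b" and ?h = "coeff_sym c"
    have "coeff_sym (a * b * c) M =
        (\<Sum>(D, C)\<in>splits M. \<Sum>(A, B)\<in>splits D. ?f A * ?g B * ?h C)"
      by (simp add: times_sym.rep_eq sum_distrib_right case_prod_unfold)
    also have "\<dots> = (\<Sum>(X, Y)\<in>Sigma (splits M) (\<lambda>X. splits (fst X)). ?f (fst Y) * ?g (snd Y) * ?h (snd X))"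
      by (subst sum.Sigma[symmetric]) (auto simp: finite_splits case_prod_unfold)
    also have "\<dots> = (\<Sum>(X, Y)\<in>Sigma (splits M) (\<lambda>X. splits (snd X)). ?f (fst X) * ?g (fst Y) * ?h (snd Y))"
      by (rule sum.reindex_bij_witness[of _
            "\<lambda>((A, E), (B, C)). ((A + B, C), (A, B))" "\<lambda>((D, C), (A, B)). ((A, B + C), (B, C))"])
         (auto simp: splits_def add.assoc)
    also have "\<dots> = (\<Sum>(A, E)\<in>splits M. \<Sum>(B, C)\<in>splits E. ?f A * ?g B * ?h C)"
      by (subst sum.Sigma[symmetric]) (auto simp: finite_splits case_prod_unfold)
    also have "\<dots> = coeff_sym (a * (b * c)) M"
      by (simp add: times_sym.rep_eq sum_distrib_left case_prod_unfold mult.assoc)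
    finally show "coeff_sym (a * b * c) M = coeff_sym (a * (b * c)) M" .
  qed
  show "a * b = b * a"
  proof (rule sym_eqI)
    fix M
    show "coeff_sym (a * b) M = coeff_sym (b * a) M"
      unfolding times_sym.rep_eq
      by (rule sum.reindex_bij_witness[of _ prod.swap prod.swap])
         (auto simp: splits_def add.commute mult.commute)
  qed
  show "1 * a = a"
  proof (rule sym_eqI)
    fix M
    have "coeff_sym (1 * a) M = (\<Sum>x\<in>splits M. if x = ({#}, M) then coeff_sym a M else 0)"
      unfolding times_sym.rep_eq one_sym.rep_eq case_prod_unfold
      by (rule sum.cong) (simp_all add: splits_def prod_eq_iff split: prod.splits, (metis add_0)?)
    also have "\<dots> = coeff_sym a M"
      by (simp add: finite_splits) (simp add: splits_def)
    finally show "coeff_sym (1 * a) M = coeff_sym a M" .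
  qed
  show "(a + b) * c = a * c + b * c"
    by (rule sym_eqI)
       (simp add: times_sym.rep_eq plus_sym.rep_eq distrib_right sum.distrib case_prod_unfold)
  show "(0 :: 'a sym) \<noteq> 1"
    by transfer (auto dest!: fun_cong[of _ _ "{#}"])
qed (rule sym_eqI, simp add: plus_sym.rep_eq minus_sym.rep_eq uminus_sym.rep_eq zero_sym.rep_eq add_ac)+

end

lift_definition const_sym :: "'a :: comm_ring_1 \<Rightarrow> 'a sym" is
  "\<lambda>c M. if M = {#} then c else 0" by auto

lift_definition scale_sym :: "'a :: comm_ring_1 \<Rightarrow> 'a sym \<Rightarrow> 'a sym" is "\<lambda>c f M. c * f M"
proof (intro conjI allI impI, goal_cases)
  case (2 c f)
  then show ?case by (metis mult_zero_right)
qed auto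

global_interpretation sym: vector_space "scale_sym :: 'a :: field \<Rightarrow> 'a sym \<Rightarrow> 'a sym"
  by unfold_locales (rule sym_eqI, simp add: scale_sym.rep_eq plus_sym.rep_eq algebra_simps)+

definition homogeneous_sym :: "nat \<Rightarrow> 'a :: zero sym \<Rightarrow> bool" where
  "homogeneous_sym k f \<longleftrightarrow> (\<forall>M. coeff_sym f M \<noteq> 0 \<longrightarrow> size M = k)"

lift_definition elem_sym :: "nat \<Rightarrow> 'a :: comm_ring_1 sym" is
  "\<lambda>n M. if size M = n \<and> (\<forall>i. count M i \<le> 1) then 1 else 0"
proof (intro conjI allI impI, goal_cases)
  case (1 n \<sigma> M)
  have cnt: "count (image_mset \<sigma> M) (\<sigma> i) = count M i" for i
    using bij_is_inj[OF 1] by (induction M) (auto simp: inj_eq)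
  have "(\<forall>i. count (image_mset \<sigma> M) i \<le> 1) \<longleftrightarrow> (\<forall>i. count (image_mset \<sigma> M) (\<sigma> i) \<le> 1)"
    by (rule all_bij_iff[OF 1, symmetric])
  also have "\<dots> \<longleftrightarrow> (\<forall>i. count M i \<le> 1)"
    by (simp add: cnt)
  finally show ?case by simp
qed auto

lift_definition complete_sym :: "nat \<Rightarrow> 'a :: comm_ring_1 sym" is
  "\<lambda>n M. if size M = n then 1 else 0" by auto

text \<open>Only used for \<open>r \<ge> 1\<close>.\<close>

lift_definition power_sum :: "nat \<Rightarrow> 'a :: comm_ring_1 sym" is
  "\<lambda>r M. if \<exists>i. M = replicate_mset r i then 1 else 0"
proof (intro conjI allI impI, goal_cases)
  case (1 r \<sigma> M)
  have "(\<exists>i. image_mset \<sigma> M = replicate_mset r i) \<longleftrightarrow> (\<exists>i. image_mset \<sigma> M = replicate_mset r (\<sigma> i))"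
    by (rule ex_bij_iff[OF 1, symmetric])
  also have "\<dots> \<longleftrightarrow> (\<exists>i. M = replicate_mset r i)"
    by (simp only: image_replicate_mset[symmetric] inj_eq[OF inj_image_mset_bij[OF 1]])
  finally show ?case by simp
next
  case (2 r)
  show ?case by (rule exI[of _ r]) auto
qed

text \<open>$X = x_0 + x_1 + x_2 + \cdots$, as a plethystic alphabet\<close>

abbreviation X_sym :: "'a :: comm_ring_1 sym" where
  "X_sym \<equiv> power_sum 1"


section \<open>Partitions\<close>

definition is_partition :: "nat list \<Rightarrow> bool" where
  "is_partition \<mu> \<longleftrightarrow> sorted_wrt (\<ge>) \<mu> \<and> 0 \<notin> set \<mu>"

definition conj_part :: "nat list \<Rightarrow> nat list" where
  "conj_part \<mu> = map (\<lambda>j. length (filter (\<lambda>r. j < r) \<mu>)) [0..<foldr max \<mu> 0]"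

definition dominates :: "nat list \<Rightarrow> nat list \<Rightarrow> bool" where
  "dominates \<nu> \<mu> \<longleftrightarrow> sum_list \<nu> = sum_list \<mu> \<and> (\<forall>i. sum_list (take i \<nu>) \<ge> sum_list (take i \<mu>))"

text \<open>Cells are pairs (row, column); in French notation row 0 is the bottom row.\<close>

definition cells :: "nat list \<Rightarrow> (nat \<times> nat) set" where
  "cells \<mu> = {(i, j). i < length \<mu> \<and> j < \<mu> ! i}"

definition coarm :: "nat list \<Rightarrow> nat \<times> nat \<Rightarrow> nat" where
  "coarm \<mu> c = card {d \<in> cells \<mu>. fst d = fst c \<and> snd d < snd c}"

definition coleg :: "nat list \<Rightarrow> nat \<times> nat \<Rightarrow> nat" where
  "coleg \<mu> c = card {d \<in> cells \<mu>. snd d = snd c \<and> fst d < fst c}"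

definition power_sum_part :: "nat list \<Rightarrow> 'a :: comm_ring_1 sym" where
  "power_sum_part \<nu> = (\<Prod>r\<leftarrow>\<nu>. power_sum r)"

text \<open>Schur functions by the Jacobi--Trudi determinant $\det(h_{\lambda_i - i + j})$\<close>

definition schur :: "nat list \<Rightarrow> 'a :: comm_ring_1 sym" where
  "schur \<nu> = det (mat (length \<nu>) (length \<nu>)
     (\<lambda>(i, j). if i \<le> \<nu> ! i + j then complete_sym (\<nu> ! i + j - i) else 0))"

text \<open>The Hall scalar product: the bilinear form for which the Schur functions are orthonormal\<close>

definition hall :: "'a :: field sym \<Rightarrow> 'a sym \<Rightarrow> 'a" where
  "hall = (THE \<beta>.
     (\<forall>g. Vector_Spaces.linear scale_sym (*) (\<lambda>f. \<beta> f g)) \<and>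
     (\<forall>f. Vector_Spaces.linear scale_sym (*) (\<beta> f)) \<and>
     (\<forall>\<nu> \<mu>. is_partition \<nu> \<longrightarrow> is_partition \<mu> \<longrightarrow>
        \<beta> (schur \<nu>) (schur \<mu>) = (if \<nu> = \<mu> then 1 else 0)))"


section \<open>The field of rational functions in $q$ and $t$\<close>

text \<open>In \<open>rat poly poly\<close>, the inner variable is $q$ and the outer one is $t$.\<close>

type_synonym qt = "rat poly poly fract"

definition q :: qt where "q = to_fract [:[:0, 1:]:]"

definition t :: qt where "t = to_fract [:0, 1:]"

definition eval_qt :: "qt \<Rightarrow> qt \<Rightarrow> rat poly poly \<Rightarrow> qt" where
  "eval_qt a b P = poly (map_poly (\<lambda>p. poly (map_poly (\<lambda>c. to_fract [:[:c:]:]) p) a) P) b"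

text \<open>
  The substitution $q := a$, $t := b$ in a rational function, written in lowest terms; it makes sense
  when the denominator does not vanish. With \<open>a = q\<close>, \<open>b = 1 / q\<close> this is the specialization
  $t = 1/q$, with values in $\mathbb{Q}(q) \subseteq \mathbb{Q}(q,t)$.
\<close>

definition subst_qt_defined :: "qt \<Rightarrow> qt \<Rightarrow> qt \<Rightarrow> bool" where
  "subst_qt_defined a b x \<longleftrightarrow> eval_qt a b (snd (quot_of_fract x)) \<noteq> 0"

definition subst_qt :: "qt \<Rightarrow> qt \<Rightarrow> qt \<Rightarrow> qt" where
  "subst_qt a b x = eval_qt a b (fst (quot_of_fract x)) / eval_qt a b (snd (quot_of_fract x))"

lemma subst_qt_0 [simp]: "subst_qt a b 0 = 0"
  by (simp add: subst_qt_def eval_qt_def)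

definition spec_defined :: "qt sym \<Rightarrow> bool" where
  "spec_defined f \<longleftrightarrow> (\<forall>M. subst_qt_defined q (1 / q) (coeff_sym f M))"

lift_definition spec :: "qt sym \<Rightarrow> qt sym" is "\<lambda>f M. subst_qt q (1 / q) (f M)"
proof (intro conjI allI impI, goal_cases)
  case (2 f)
  then show ?case by (metis subst_qt_0)
qed auto

definition q_int :: "nat \<Rightarrow> qt" where
  "q_int m = (\<Sum>i<m. q ^ i)"


section \<open>Plethysm\<close>

text \<open>
  $p_r[E]$ for \<open>r \<ge> 1\<close>: every monomial of \<open>E\<close> in $q, t, x_0, x_1, \ldots$ is raised to its
  \<open>r\<close>-th power. The sum below has at most one term, since $x^M$ is the \<open>r\<close>-th power of at most
  one monomial.
\<close>

lift_definition power_sum_pleth :: "nat \<Rightarrow> qt sym \<Rightarrow> qt sym" is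
  "\<lambda>r E M. \<Sum>N | repeat_mset r N = M. subst_qt (q ^ r) (t ^ r) (E N)"
proof (intro conjI allI impI, goal_cases)
  case (1 r E \<sigma> M)
  have inv_im: "image_mset \<sigma> (image_mset (inv_into UNIV \<sigma>) A) = A" "image_mset (inv_into UNIV \<sigma>) (image_mset \<sigma> A) = A" for A
    using 1 by (simp_all add: multiset.map_comp bij_is_surj bij_is_inj surj_iff[THEN iffD1] inj_iff[THEN iffD1])
  have rep: "repeat_mset r (image_mset f A) = image_mset f (repeat_mset r A)" for f :: "nat \<Rightarrow> nat" and A
    by (induction r) simp_all
  show ?case
  proof (rule sum.reindex_bij_witness[of _ "image_mset \<sigma>" "image_mset (inv_into UNIV \<sigma>)"])
    fix N assume "N \<in> {N. repeat_mset r N = image_mset \<sigma> M}"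
    then have N: "repeat_mset r N = image_mset \<sigma> M" by simp
    show "image_mset (inv_into UNIV \<sigma>) N \<in> {N. repeat_mset r N = M}" by (simp add: rep N inv_im)
    show "subst_qt (q ^ r) (t ^ r) (E (image_mset (inv_into UNIV \<sigma>) N)) = subst_qt (q ^ r) (t ^ r) (E N)"
      using 1 by (metis inv_im(1))
  qed (auto simp: inv_im rep)
next
  case (2 r E)
  then obtain d where d: "\<forall>M. E M \<noteq> 0 \<longrightarrow> size M \<le> d" by blast
  have "size M \<le> r * d" if "(\<Sum>N | repeat_mset r N = M. subst_qt (q ^ r) (t ^ r) (E N)) \<noteq> 0" for M
  proof -
    from that obtain N where "repeat_mset r N = M" "subst_qt (q ^ r) (t ^ r) (E N) \<noteq> 0"
      by (auto elim!: sum.not_neutral_contains_not_neutral)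
    then show ?thesis using d by (metis mult_le_mono2 size_repeat_mset subst_qt_0)
  qed
  then show ?case by blast
qed

text \<open>
  $f[E]$: the linear extension of $p_\lambda \mapsto \prod_i p_{\lambda_i}[E]$. In particular the
  coefficients of $f$ are left alone.
\<close>

definition pleth :: "qt sym \<Rightarrow> qt sym \<Rightarrow> qt sym" where
  "pleth f E = (THE \<phi>. Vector_Spaces.linear scale_sym scale_sym \<phi> \<and>
     (\<forall>\<nu>. is_partition \<nu> \<longrightarrow> \<phi> (power_sum_part \<nu>) = (\<Prod>r\<leftarrow>\<nu>. power_sum_pleth r E))) f"


section \<open>Modified Macdonald polynomials and Delta operators\<close>

definition is_modified_macdonald :: "nat list \<Rightarrow> qt sym \<Rightarrow> bool" where
  "is_modified_macdonald \<mu> H \<longleftrightarrow>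
     pleth H (X_sym * const_sym (1 - q))
       \<in> sym.span {schur \<nu> | \<nu>. is_partition \<nu> \<and> dominates \<nu> \<mu>} \<and>
     pleth H (X_sym * const_sym (1 - t))
       \<in> sym.span {schur \<nu> | \<nu>. is_partition \<nu> \<and> dominates \<nu> (conj_part \<mu>)} \<and>
     hall H (schur (if \<mu> = [] then [] else [sum_list \<mu>])) = 1"

definition B_part :: "nat list \<Rightarrow> qt" where
  "B_part \<mu> = (\<Sum>c\<in>cells \<mu>. q ^ coarm \<mu> c * t ^ coleg \<mu> c)"

text \<open>\<open>Ht\<close> is the family of modified Macdonald polynomials.\<close>

definition Delta :: "(nat list \<Rightarrow> qt sym) \<Rightarrow> qt sym \<Rightarrow> qt sym \<Rightarrow> qt sym" where
  "Delta Ht f = (THE D. Vector_Spaces.linear scale_sym scale_sym D \<and>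
     (\<forall>\<mu>. is_partition \<mu> \<longrightarrow> D (Ht \<mu>) = pleth f (const_sym (B_part \<mu>)) * Ht \<mu>))"

end

theory Submission
  imports Defs "HOL-Combinatorics.Permutations" "Jordan_Normal_Form.Char_Poly"
begin

text \<open>
  Rational functions that can be specialized at $t = 1/q$ form a valuation ring, so each
  $\tilde H_\mu$ has a multiple whose specialization $g_\mu$ exists and is nonzero. Both triangularity
  conditions survive the specialization. Since $X(1-1/q) = -q^{-1}X(1-q)$, they say that
  $F_\mu = g_\mu[X(1-q)]$ lies in the span of the $h_\lambda$ with $\lambda \ge \mu$ and in the span of
  the $e_\lambda$ with $\lambda \ge \mu'$. This intersection is a line: the $e_\lambda$ only involve
  monomials $x^\nu$ with $\nu \le \mu$, so an element of it without $h_\mu$-component is orthogonal to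
  all the $h_\lambda$ from which it is built, and the Hall form is positive definite because
  $\mathbb{Q}(q,t)$ is an ordered field. Hence the $F_\mu$ (multiples of Schur functions) are a
  basis, and the expansion of $e_n$ in the multiples of $\tilde H_\mu$ has specializable coefficients.

  In $e_n[X(1-u)] = (1-u) \sum_b u^b T_b$ the alternating partial sums $T_b$ of $\sum_r (-1)^r e_{n-r} h_r$
  lie in the line that belongs to the hook $(b+1, 1^{n-1-b})$. So only hooks contribute to $e_n$ (take $u = q$).
  On a hook $B_\mu(q,1/q) = q^{-(n-1-b)} [n]_q$, and $\Delta_f$ multiplies the term by
  $q^{-k(n-1-b)} f[[n]_q]$. The result is $e_n[X(1-u)]$ at $u = q^{k+1}$, up to a scalar.
\<close>

section \<open>Coefficients of symmetric functions\<close>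

text \<open>\<open>hall\<close>, \<open>pleth\<close> and \<open>Delta\<close> are definite
  descriptions, so every use of them rests on a basis: Schur functions, power sums and the
  \<open>Ht \<mu>\<close> themselves. That Macdonald polynomials have polynomial coefficients is a
  deep theorem; nothing about their poles at t = 1/q is assumed here, which is why each of them is
  first multiplied by a scalar. Eigenvector equations do not notice such a scalar. The normalization
  against s_(n) serves to exclude H = 0. Generating series are avoided: a series A(z) with A(0) = 1
  is represented by the scalars c_s for which z A'(z) / A(z) is the sum of the c_s p_s z^s, that is,
  by a Newton recursion. Products add these scalars, z -> uz multiplies c_s by u^s, and the plethysm
  X -> Xc multiplies c_s by the value of c at (q^s, t^s). So E(z) H(-z) = 1, h_n[-qX] and
  e_n[X(1-q^k)] all reduce to identities between scalars.\<close>

lemma coeff_sym_simps [simp]: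
  "coeff_sym 0 M = 0"
  "coeff_sym (f + g) M = coeff_sym f M + coeff_sym g M"
  "coeff_sym (f - g) M = coeff_sym f M - coeff_sym g M"
  "coeff_sym (- f) M = - coeff_sym f M"
  "coeff_sym (scale_sym c f) M = c * coeff_sym f M"
  for f g :: "'a::comm_ring_1 sym"
  by (simp_all add: zero_sym.rep_eq plus_sym.rep_eq minus_sym.rep_eq uminus_sym.rep_eq scale_sym.rep_eq)

lemma coeff_sym_sum [simp]: "coeff_sym (\<Sum>i\<in>A. f i) M = (\<Sum>i\<in>A. coeff_sym (f i) M)"
  for f :: "'i \<Rightarrow> 'a::comm_ring_1 sym"
  by (induction A rule: infinite_finite_induct) simp_all

lemma scale_sym_mult_left [simp]: "scale_sym c f * g = scale_sym c (f * g)"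
  for f g :: "'a::comm_ring_1 sym"
  by (rule sym_eqI) (simp add: times_sym.rep_eq sum_distrib_left case_prod_unfold mult.assoc)

lemma scale_sym_mult_right [simp]: "f * scale_sym c g = scale_sym c (f * g)"
  for f g :: "'a::comm_ring_1 sym"
  by (metis mult.commute scale_sym_mult_left)

lemma const_sym_eq: "const_sym c = scale_sym c 1"
  by (rule sym_eqI) (simp add: const_sym.rep_eq one_sym.rep_eq)

lemma scale_sym_scale_sym: "scale_sym c (scale_sym d f) = scale_sym (c * d) f"
  for f :: "'a::comm_ring_1 sym"
  by (rule sym_eqI) (simp add: mult.assoc)

lemma scale_sym_one [simp]: "scale_sym 1 f = f"
  by (rule sym_eqI) simp

lemma scale_sym_zero [simp]: "scale_sym 0 f = 0" "scale_sym c 0 = 0"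
  by (rule sym_eqI, simp)+

lemma scale_sym_add: "scale_sym c (f + g) = scale_sym c f + scale_sym c g"
  "scale_sym (c + d) f = scale_sym c f + scale_sym d f"
  by (rule sym_eqI, simp add: algebra_simps)+

lemma scale_sym_diff: "scale_sym c (f - g) = scale_sym c f - scale_sym c g"
  "scale_sym (c - d) f = scale_sym c f - scale_sym d f"
  by (rule sym_eqI, simp add: algebra_simps)+

lemma scale_sym_minus: "scale_sym (- c) f = - scale_sym c f" "scale_sym c (- f) = - scale_sym c f"
  by (rule sym_eqI, simp)+

lemma scale_sym_sum: "scale_sym c (\<Sum>i\<in>A. f i) = (\<Sum>i\<in>A. scale_sym c (f i))"
  by (rule sym_eqI) (simp add: sum_distrib_left)

lemma scale_sum_sym: "scale_sym (\<Sum>i\<in>A. c i) f = (\<Sum>i\<in>A. scale_sym (c i) f)"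
  by (rule sym_eqI) (simp add: sum_distrib_right)

lemma scale_sym_cancel:
  fixes f g :: "'a::field sym"
  assumes "c \<noteq> 0" "scale_sym c f = scale_sym c g"
  shows "f = g"
proof -
  have "scale_sym (1 / c) (scale_sym c f) = scale_sym (1 / c) (scale_sym c g)"
    by (simp only: assms)
  then show ?thesis using assms(1) by (simp add: scale_sym_scale_sym)
qed

lemma replicate_mset_inj: "r \<ge> 1 \<Longrightarrow> replicate_mset r i = replicate_mset r j \<longleftrightarrow> i = (j :: nat)"
  by (auto simp: replicate_mset_eq_iff)

text \<open>The only monomials of p_r are the x_i^r, and for \<open>r \<ge> 1\<close> they determine
  i. So the splits of \<open>M\<close> that contribute are indexed by the variables with exponent at
  least r.\<close>

lemma coeff_power_sum_mult:
  fixes G :: "'a::comm_ring_1 sym"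
  assumes "r \<ge> 1"
  shows "coeff_sym (power_sum r * G) M =
    (\<Sum>i | i \<in> set_mset M \<and> r \<le> count M i. coeff_sym G (M - replicate_mset r i))"
proof -
  let ?I = "{i. i \<in> set_mset M \<and> r \<le> count M i}"
  let ?h = "\<lambda>i. (replicate_mset r i, M - replicate_mset r i)"
  have inj: "inj_on ?h ?I"
    using replicate_mset_inj[OF assms] by (intro inj_onI) (metis prod.inject)
  have sub: "?h ` ?I \<subseteq> splits M"
    by (auto simp: splits_def) (metis count_le_replicate_mset_subset_eq subset_mset.add_diff_inverse)
  have "coeff_sym (power_sum r * G) M =
      (\<Sum>(A, B)\<in>splits M. coeff_sym (power_sum r) A * coeff_sym G B)"
    by (simp add: times_sym.rep_eq)
  also have "\<dots> = (\<Sum>(A, B)\<in>?h ` ?I. coeff_sym (power_sum r) A * coeff_sym G B)"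
  proof (rule sum.mono_neutral_right[OF finite_splits sub], safe)
    fix A B assume AB: "(A, B) \<in> splits M" "(A, B) \<notin> ?h ` ?I"
    have "A \<noteq> replicate_mset r i" for i
    proof
      assume A: "A = replicate_mset r i"
      have M: "A + B = M" using AB(1) by (simp add: splits_def)
      have "i \<in> ?I" using assms A M by (auto simp flip: M)
      moreover have "B = M - A" using M by auto
      ultimately show False using AB(2) A by blast
    qed
    then show "coeff_sym (power_sum r) A * coeff_sym G B = 0"
      by (simp add: power_sum.rep_eq)
  qed
  also have "\<dots> = (\<Sum>i\<in>?I. coeff_sym G (M - replicate_mset r i))"
    by (subst sum.reindex[OF inj]) (auto simp: power_sum.rep_eq intro!: sum.cong)
  finally show ?thesis .
qed

section \<open>Newton's identities\<close>

text \<open>For the generating series A(z) of \<open>a\<close> this is the equation z A'(z) = A(z)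
  L(z) with A(0) = 1, where L(z) is the sum of the c_s p_s z^s. In characteristic 0 it means that
  A(z) is the exponential of the sum of the c_s p_s z^s / s.\<close>

definition newton_seq :: "(nat \<Rightarrow> 'a::comm_ring_1) \<Rightarrow> (nat \<Rightarrow> 'a sym) \<Rightarrow> bool" where
  "newton_seq c a \<longleftrightarrow> a 0 = 1 \<and>
    (\<forall>n. scale_sym (of_nat n) (a n) = (\<Sum>s=1..n. scale_sym (c s) (power_sum s * a (n - s))))"

lemma complete_sym_0 [simp]: "complete_sym 0 = 1"
  by (rule sym_eqI) (simp add: complete_sym.rep_eq one_sym.rep_eq)

lemma elem_sym_0 [simp]: "elem_sym 0 = 1"
  by (rule sym_eqI) (auto simp: elem_sym.rep_eq one_sym.rep_eq)

lemma size_diff_replicate: "r \<le> count M i \<Longrightarrow> size (M - replicate_mset r i) = size M - r"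
  by (simp add: size_Diff_submset count_le_replicate_mset_subset_eq)

lemma count_le_size: "count M i \<le> size M"
  by (metis count_le_replicate_mset_subset_eq size_mset_mono size_replicate_mset order_refl)

text \<open>The coefficient of x^M on the right counts the pairs of a variable i and an s between 1
  and the exponent of i; there are \<open>size M\<close> of them.\<close>

lemma newton_complete: "newton_seq (\<lambda>_. 1) (complete_sym :: nat \<Rightarrow> 'a::comm_ring_1 sym)"
  unfolding newton_seq_def
proof (intro conjI allI sym_eqI)
  fix n and M :: "nat multiset"
  have "coeff_sym (\<Sum>s=1..n. scale_sym 1 (power_sum s * complete_sym (n - s))) M =
      (\<Sum>s=1..n. \<Sum>i | i \<in> set_mset M \<and> s \<le> count M i. if size M = n then 1 else 0 :: 'a)"
  proof (unfold coeff_sym_sum, intro sum.cong refl)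
    fix s assume s: "s \<in> {1..n}"
    have "size (M - replicate_mset s i) = n - s \<longleftrightarrow> size M = n" if "s \<le> count M i" for i
      using that s count_le_size[of M i] by (auto simp: size_diff_replicate)
    then show "coeff_sym (scale_sym 1 (power_sum s * complete_sym (n - s))) M =
        (\<Sum>i | i \<in> set_mset M \<and> s \<le> count M i. if size M = n then 1 else 0 :: 'a)"
      using s by (auto simp: coeff_power_sum_mult complete_sym.rep_eq intro!: sum.cong)
  qed
  also have "\<dots> = (if size M = n then of_nat n else 0)"
  proof (cases "size M = n")
    case True
    have "(\<Sum>s=1..n. \<Sum>i | i \<in> set_mset M \<and> s \<le> count M i. if size M = n then 1 else 0 :: 'a) =
        (\<Sum>s=1..n. \<Sum>i\<in>set_mset M. if s \<le> count M i then 1 else 0)"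
      by (rule sum.cong[OF refl]) (simp only: sum.inter_filter[OF finite_set_mset] True refl if_True)
    also have "\<dots> = (\<Sum>i\<in>set_mset M. \<Sum>s=1..n. if s \<le> count M i then 1 else 0)"
      by (rule sum.swap)
    also have "\<dots> = (\<Sum>i\<in>set_mset M. of_nat (count M i))"
    proof (rule sum.cong[OF refl])
      fix i assume "i \<in> set_mset M"
      have "{1..n} \<inter> {s. s \<le> count M i} = {1..count M i}"
        using count_le_size[of M i] True by auto
      then show "(\<Sum>s=1..n. if s \<le> count M i then 1 else 0) = (of_nat (count M i) :: 'a)"
        by (simp add: sum.If_cases)
    qed
    also have "\<dots> = of_nat (size M)"
      by (simp add: size_multiset_overloaded_eq)
    finally show ?thesis using True by simp
  qed simp
  finally show "coeff_sym (scale_sym (of_nat n) (complete_sym n)) M =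
      coeff_sym (\<Sum>s=1..n. scale_sym (1::'a) (power_sum s * complete_sym (n - s))) M"
    by (simp add: complete_sym.rep_eq)
qed simp

text \<open>Removing x_i^s leaves a squarefree monomial only if s is the exponent c of i or c - 1.
  These two terms have opposite signs, and one survives only for c = 1, where s = 0 is outside of
  the sum.\<close>

lemma newton_elem: "newton_seq (\<lambda>s. (-1) ^ (s - 1)) (elem_sym :: nat \<Rightarrow> 'a::comm_ring_1 sym)"
  unfolding newton_seq_def
proof (intro conjI allI sym_eqI)
  fix n and M :: "nat multiset"
  let ?sf = "\<lambda>M. \<forall>i. count M i \<le> 1"
  let ?t = "\<lambda>s i. if size M = n \<and> ?sf (M - replicate_mset s i) then (-1) ^ (s - 1) else 0 :: 'a"
  have "coeff_sym (\<Sum>s=1..n. scale_sym ((-1) ^ (s - 1)) (power_sum s * elem_sym (n - s))) M =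
      (\<Sum>s=1..n. \<Sum>i | i \<in> set_mset M \<and> s \<le> count M i. ?t s i)"
  proof (unfold coeff_sym_sum, intro sum.cong refl)
    fix s assume s: "s \<in> {1..n}"
    have "size (M - replicate_mset s i) = n - s \<longleftrightarrow> size M = n" if "s \<le> count M i" for i
      using that s count_le_size[of M i] by (auto simp: size_diff_replicate)
    then show "coeff_sym (scale_sym ((-1) ^ (s - 1)) (power_sum s * elem_sym (n - s))) M =
        (\<Sum>i | i \<in> set_mset M \<and> s \<le> count M i. ?t s i)"
      using s by (simp add: coeff_power_sum_mult elem_sym.rep_eq sum_distrib_left if_distrib cong: if_cong)
  qed
  also have "\<dots> = (\<Sum>s=1..n. \<Sum>i\<in>set_mset M. if s \<le> count M i then ?t s i else 0)"
    by (intro sum.cong refl sum.mono_neutral_cong_left) auto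
  also have "\<dots> = (\<Sum>i\<in>set_mset M. \<Sum>s=1..n. if s \<le> count M i then ?t s i else 0)"
    by (rule sum.swap)
  also have "\<dots> = (\<Sum>i\<in>set_mset M. if size M = n \<and> ?sf M then 1 else 0)"
  proof (rule sum.cong[OF refl])
    fix i assume i: "i \<in> set_mset M"
    let ?c = "count M i"
    show "(\<Sum>s=1..n. if s \<le> ?c then ?t s i else 0) = (if size M = n \<and> ?sf M then 1 else 0)"
    proof (cases "size M = n \<and> (\<forall>j. j \<noteq> i \<longrightarrow> count M j \<le> 1)")
      case False
      then have "\<not> (size M = n \<and> ?sf (M - replicate_mset s i))" for s
        by auto
      then have "?t s i = 0" for s by (simp only: if_False)
      moreover have "\<not> (size M = n \<and> ?sf M)" using False by blast
      ultimately show ?thesis by (simp only: if_False if_cancel sum.neutral_const)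
    next
      case True
      have sf: "?sf (M - replicate_mset s i) \<longleftrightarrow> ?c \<le> s + 1" for s
        using True by (auto simp: le_diff_conv dest: spec[of _ i])
      have cn: "1 \<le> ?c" "?c \<le> n" using i count_le_size[of M i] True by (auto simp: Suc_le_eq)
      have "(\<Sum>s=1..n. if s \<le> ?c then ?t s i else 0) =
          (\<Sum>s | s = ?c \<or> (s = ?c - 1 \<and> ?c \<ge> 2). (-1) ^ (s - 1))"
        using cn True by (intro sum.mono_neutral_cong_right) (auto simp: sf)
      also have "\<dots> = (if ?c = 1 then 1 else 0)"
      proof (cases "?c = 1")
        case True
        then have "{s. s = ?c \<or> (s = ?c - 1 \<and> ?c \<ge> 2)} = {1}" by auto
        then show ?thesis using True by simp
      next
        case False
        then have "{s. s = ?c \<or> (s = ?c - 1 \<and> ?c \<ge> 2)} = {?c, ?c - 1}" using cn by auto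
        moreover obtain m where "?c = Suc (Suc m)" using False cn by (metis One_nat_def Suc_le_D le_SucE le_zero_eq nat.exhaust)
        ultimately show ?thesis by simp
      qed
      also have "?c = 1 \<longleftrightarrow> size M = n \<and> ?sf M"
        using True cn by (metis le_antisym order_refl)
      finally show ?thesis .
    qed
  qed
  also have "\<dots> = (if size M = n \<and> ?sf M then of_nat (card (set_mset M)) else 0)"
    by simp
  also have "\<dots> = (if size M = n \<and> ?sf M then of_nat n else 0)"
  proof -
    have "card (set_mset M) = size M" if "?sf M"
    proof -
      have "count M i = 1" if "i \<in> set_mset M" for i
        using \<open>?sf M\<close> that by (metis Suc_le_eq One_nat_def le_antisym count_greater_zero_iff)
      then show ?thesis by (simp add: size_multiset_overloaded_eq)
    qed
    then show ?thesis by (simp del: One_nat_def)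
  qed
  finally show "coeff_sym (scale_sym (of_nat n) (elem_sym n)) M =
      coeff_sym (\<Sum>s=1..n. scale_sym ((-1 :: 'a) ^ (s - 1)) (power_sum s * elem_sym (n - s))) M"
    by (simp add: elem_sym.rep_eq)
qed simp

text \<open>Takes the place of comparing generating series; the division by n is where
  characteristic 0 enters.\<close>

lemma newton_seq_unique:
  fixes a b :: "nat \<Rightarrow> 'a::field_char_0 sym"
  assumes "newton_seq c a" "newton_seq c b"
  shows "a n = b n"
proof (induction n rule: less_induct)
  case (less n)
  show ?case
  proof (cases "n = 0")
    case True
    then show ?thesis using assms by (simp add: newton_seq_def)
  next
    case False
    have "scale_sym (of_nat n) (a n) = (\<Sum>s=1..n. scale_sym (c s) (power_sum s * a (n - s)))"
      using assms(1) by (simp add: newton_seq_def)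
    also have "\<dots> = (\<Sum>s=1..n. scale_sym (c s) (power_sum s * b (n - s)))"
      by (intro sum.cong refl) (simp add: less)
    also have "\<dots> = scale_sym (of_nat n) (b n)"
      using assms(2) by (simp add: newton_seq_def)
    finally show ?thesis using False scale_sym_cancel[of "of_nat n"] by simp
  qed
qed

lemma newton_seq_cong:
  assumes "newton_seq c a" "\<And>s. s \<ge> 1 \<Longrightarrow> c s = d s"
  shows "newton_seq d a"
  using assms by (simp add: newton_seq_def)

text \<open>In terms of generating series: A(uz) in place of A(z).\<close>

lemma newton_seq_twist:
  fixes a :: "nat \<Rightarrow> 'a::comm_ring_1 sym"
  assumes "newton_seq c a"
  shows "newton_seq (\<lambda>s. u ^ s * c s) (\<lambda>n. scale_sym (u ^ n) (a n))"
  unfolding newton_seq_def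
proof (intro conjI allI)
  show "scale_sym (u ^ 0) (a 0) = 1" using assms by (simp add: newton_seq_def)
  fix n
  have "scale_sym (of_nat n) (scale_sym (u ^ n) (a n)) = scale_sym (u ^ n) (scale_sym (of_nat n) (a n))"
    by (simp add: scale_sym_scale_sym mult.commute)
  also have "scale_sym (of_nat n) (a n) = (\<Sum>s=1..n. scale_sym (c s) (power_sum s * a (n - s)))"
    using assms by (simp add: newton_seq_def)
  also have "scale_sym (u ^ n) \<dots> =
      (\<Sum>s=1..n. scale_sym (u ^ s * c s) (power_sum s * scale_sym (u ^ (n - s)) (a (n - s))))"
    unfolding scale_sym_sum
    by (rule sum.cong) (auto simp: scale_sym_scale_sym mult_ac power_add[symmetric])
  finally show "scale_sym (of_nat n) (scale_sym (u ^ n) (a n)) =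
      (\<Sum>s=1..n. scale_sym (u ^ s * c s) (power_sum s * scale_sym (u ^ (n - s)) (a (n - s))))" .
qed

text \<open>The logarithmic derivative of a product of series is the sum of the logarithmic
  derivatives.\<close>

lemma newton_seq_mult:
  fixes a b :: "nat \<Rightarrow> 'a::comm_ring_1 sym"
  assumes "newton_seq c a" "newton_seq d b"
  shows "newton_seq (\<lambda>s. c s + d s) (\<lambda>n. \<Sum>r\<le>n. a (n - r) * b r)"
  unfolding newton_seq_def
proof (intro conjI allI)
  show "(\<Sum>r\<le>0. a (0 - r) * b r) = 1" using assms by (simp add: newton_seq_def)
  fix n
  \<comment> \<open>Leibniz rule: n = (n - r) + r in each term.\<close>
  have conv: "scale_sym (of_nat n) (\<Sum>r\<le>n. a (n - r) * b r) =
      (\<Sum>r\<le>n. scale_sym (of_nat (n - r)) (a (n - r)) * b r) +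
      (\<Sum>r\<le>n. a (n - r) * scale_sym (of_nat r) (b r))"
    unfolding scale_sym_sum sum.distrib[symmetric]
    by (rule sum.cong) (auto simp: scale_sym_add(2)[symmetric] of_nat_diff)
  have tri: "(\<Sum>r\<le>n. \<Sum>s=1..n-r. F r s) = (\<Sum>s=1..n. \<Sum>r\<le>n-s. F r s)" for F :: "nat \<Rightarrow> nat \<Rightarrow> 'a sym"
    by (subst (1 2) sum.Sigma) (auto intro!: sum.reindex_bij_witness[of _ "\<lambda>(x, y). (y, x)" "\<lambda>(x, y). (y, x)"])
  have 1: "(\<Sum>r\<le>n. scale_sym (of_nat (n - r)) (a (n - r)) * b r) =
      (\<Sum>s=1..n. scale_sym (c s) (power_sum s * (\<Sum>r\<le>n-s. a (n - s - r) * b r)))"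
  proof -
    have "(\<Sum>r\<le>n. scale_sym (of_nat (n - r)) (a (n - r)) * b r) =
        (\<Sum>r\<le>n. \<Sum>s=1..n-r. scale_sym (c s) (power_sum s * (a (n - s - r) * b r)))"
      using assms(1) by (simp add: newton_seq_def sum_distrib_right mult.assoc add.commute del: of_nat_diff)
    also have "\<dots> = (\<Sum>s=1..n. \<Sum>r\<le>n-s. scale_sym (c s) (power_sum s * (a (n - s - r) * b r)))"
      by (rule tri)
    finally show ?thesis by (simp add: scale_sym_sum sum_distrib_left)
  qed
  have 2: "(\<Sum>r\<le>n. a (n - r) * scale_sym (of_nat r) (b r)) =
      (\<Sum>s=1..n. scale_sym (d s) (power_sum s * (\<Sum>r\<le>n-s. a (n - s - r) * b r)))"
  proof -
    have "(\<Sum>r\<le>n. a (n - r) * scale_sym (of_nat r) (b r)) =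
        (\<Sum>r\<le>n. a r * scale_sym (of_nat (n - r)) (b (n - r)))"
      by (rule sum.reindex_bij_witness[of _ "\<lambda>r. n - r" "\<lambda>r. n - r"]) auto
    also have "\<dots> = (\<Sum>r\<le>n. \<Sum>s=1..n-r. scale_sym (d s) (power_sum s * (a r * b (n - s - r))))"
      using assms(2)
      by (simp add: newton_seq_def sum_distrib_left mult.left_commute add.commute del: of_nat_diff)
    also have "\<dots> = (\<Sum>s=1..n. \<Sum>r\<le>n-s. scale_sym (d s) (power_sum s * (a r * b (n - s - r))))"
      by (rule tri)
    also have "\<dots> = (\<Sum>s=1..n. \<Sum>r\<le>n-s. scale_sym (d s) (power_sum s * (a (n - s - r) * b r)))"
    proof (rule sum.cong[OF refl])
      fix s
      have "(\<Sum>r\<le>m. scale_sym (d s) (power_sum s * (a r * b (m - r)))) =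
          (\<Sum>r\<le>m. scale_sym (d s) (power_sum s * (a (m - r) * b r)))" for m
        by (rule sum.reindex_bij_witness[of _ "\<lambda>r. m - r" "\<lambda>r. m - r"]) auto
      from this[of "n - s"]
      show "(\<Sum>r\<le>n-s. scale_sym (d s) (power_sum s * (a r * b (n - s - r)))) =
          (\<Sum>r\<le>n-s. scale_sym (d s) (power_sum s * (a (n - s - r) * b r)))" .
    qed
    finally show ?thesis by (simp add: scale_sym_sum sum_distrib_left)
  qed
  show "scale_sym (of_nat n) (\<Sum>r\<le>n. a (n - r) * b r) =
      (\<Sum>s=1..n. scale_sym (c s + d s) (power_sum s * (\<Sum>r\<le>n-s. a (n - s - r) * b r)))"
    unfolding conv 1 2 by (simp add: scale_sym_add(2) sum.distrib)
qed

lemma newton_seq_0: "newton_seq (\<lambda>_. 0) (\<lambda>n. if n = 0 then 1 else 0)"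
  by (simp add: newton_seq_def)

text \<open>This is E(z) H(-z) = 1: the Newton scalars of h, twisted by -1, cancel those of e, and
  the constant series 1 is the one with all scalars 0.\<close>

lemma elem_complete_alternating:
  fixes n :: nat
  assumes "n \<ge> 1"
  shows "(\<Sum>r\<le>n. scale_sym ((-1) ^ r) (elem_sym (n - r) * complete_sym r)) = (0 :: 'a::field_char_0 sym)"
proof -
  have "newton_seq (\<lambda>s. (-1) ^ (s - 1) + (-1) ^ s * 1 :: 'a)
      (\<lambda>n. \<Sum>r\<le>n. elem_sym (n - r) * scale_sym ((-1) ^ r) (complete_sym r))"
    by (intro newton_seq_mult newton_elem newton_seq_twist newton_complete)
  then have "newton_seq (\<lambda>s. 0 :: 'a)
      (\<lambda>n. \<Sum>r\<le>n. elem_sym (n - r) * scale_sym ((-1) ^ r) (complete_sym r))"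
  proof (rule newton_seq_cong)
    fix s :: nat assume "s \<ge> 1"
    then show "(-1) ^ (s - 1) + (-1) ^ s * 1 = (0 :: 'a)" by (cases s) auto
  qed
  from newton_seq_unique[OF this newton_seq_0, of n] show ?thesis
    using assms by simp
qed

abbreviation partitions :: "nat list set" where
  "partitions \<equiv> {\<mu>. is_partition \<mu>}"

section \<open>Families of symmetric functions\<close>

text \<open>Coefficients are attached to indices, so repeated values count as dependent and a
  triangularity argument can address a coefficient by its partition.\<close>

definition indep_family :: "'i set \<Rightarrow> ('i \<Rightarrow> 'a::field sym) \<Rightarrow> bool" where
  "indep_family I v \<longleftrightarrow> (\<forall>A a. finite A \<longrightarrow> A \<subseteq> I \<longrightarrow>
     (\<Sum>i\<in>A. scale_sym (a i) (v i)) = 0 \<longrightarrow> (\<forall>i\<in>A. a i = 0))"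

lemma indep_familyD:
  "indep_family I v \<Longrightarrow> finite A \<Longrightarrow> A \<subseteq> I \<Longrightarrow> (\<Sum>i\<in>A. scale_sym (a i) (v i)) = 0 \<Longrightarrow> i \<in> A \<Longrightarrow> a i = 0"
  by (auto simp: indep_family_def)

lemma indep_family_subset:
  assumes "indep_family I v" "J \<subseteq> I"
  shows "indep_family J v"
  unfolding indep_family_def
proof (intro allI impI ballI)
  fix A a i
  assume "finite A" "A \<subseteq> J" "(\<Sum>i\<in>A. scale_sym (a i) (v i)) = 0" "i \<in> A"
  moreover from this have "A \<subseteq> I" using assms(2) by (rule_tac order_trans)
  ultimately show "a i = 0" using indep_familyD[OF assms(1), of A a i] by simp
qed

lemma span_image_iff:
  "x \<in> sym.span (v ` I) \<longleftrightarrow> (\<exists>A a. finite A \<and> A \<subseteq> I \<and> x = (\<Sum>i\<in>A. scale_sym (a i) (v i)))"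
proof
  assume "x \<in> sym.span (v ` I)"
  then obtain T r where T: "finite T" "T \<subseteq> v ` I" "x = (\<Sum>y\<in>T. scale_sym (r y) y)"
    unfolding sym.span_explicit by blast
  from T(2) obtain A where A: "A \<subseteq> I" "inj_on v A" "T = v ` A"
    unfolding subset_image_inj by blast
  have "finite A" using A T(1) by (simp add: finite_image_iff)
  moreover have "x = (\<Sum>i\<in>A. scale_sym (r (v i)) (v i))"
    using T(3) A by (simp add: sum.reindex)
  ultimately show "\<exists>A a. finite A \<and> A \<subseteq> I \<and> x = (\<Sum>i\<in>A. scale_sym (a i) (v i))"
    using A(1) by (intro exI[of _ A] exI[of _ "\<lambda>i. r (v i)"]) simp
next
  assume "\<exists>A a. finite A \<and> A \<subseteq> I \<and> x = (\<Sum>i\<in>A. scale_sym (a i) (v i))"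
  then obtain A a where A: "A \<subseteq> I" "x = (\<Sum>i\<in>A. scale_sym (a i) (v i))" by blast
  have "scale_sym (a i) (v i) \<in> sym.span (v ` I)" if "i \<in> A" for i
    using that A(1) by (intro sym.span_scale sym.span_base) blast
  then show "x \<in> sym.span (v ` I)"
    unfolding A(2) by (rule sym.span_sum)
qed

lemma indep_family_imp_independent:
  fixes v :: "'i \<Rightarrow> 'a::field sym"
  assumes "indep_family I v"
  shows "inj_on v I" "sym.independent (v ` I)"
proof -
  show inj: "inj_on v I"
  proof (rule inj_onI, rule ccontr)
    fix i j assume ij: "i \<in> I" "j \<in> I" "v i = v j" "i \<noteq> j"
    have "(\<Sum>k\<in>{i, j}. scale_sym (if k = i then 1 else - 1) (v k)) = 0"
      using ij by (simp add: scale_sym_minus)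
    from indep_familyD[OF assms _ _ this, of i] ij show False by simp
  qed
  show "sym.independent (v ` I)"
    unfolding sym.independent_explicit_finite_subsets
  proof (intro allI impI ballI)
    fix S u x assume S: "S \<subseteq> v ` I" "finite S" "(\<Sum>x\<in>S. scale_sym (u x) x) = 0" "x \<in> S"
    then obtain A where A: "A \<subseteq> I" "inj_on v A" "S = v ` A"
      unfolding subset_image_inj by blast
    have "finite A" using A S(2) by (simp add: finite_image_iff)
    moreover have "(\<Sum>i\<in>A. scale_sym (u (v i)) (v i)) = 0"
      using S(3) A by (simp add: sum.reindex)
    ultimately have "u (v i) = 0" if "i \<in> A" for i
      using indep_familyD[OF assms, of A "\<lambda>i. u (v i)"] A(1) that by simp
    then show "u x = 0" using S(4) A(3) by auto
  qed
qed

text \<open>Resolves the descriptions in \<open>pleth\<close> and \<open>Delta\<close> and supplies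
  coordinate functionals; the arbitrary target space covers functionals as well as
  operators.\<close>

lemma ex1_linear_on_basis:
  fixes v :: "'i \<Rightarrow> 'a::field sym" and s2 :: "'a \<Rightarrow> 'b::ab_group_add \<Rightarrow> 'b"
  assumes "vector_space s2" and ind: "indep_family I v" and span: "sym.span (v ` I) = UNIV"
  shows "\<exists>!\<phi>. Vector_Spaces.linear scale_sym s2 \<phi> \<and> (\<forall>i\<in>I. \<phi> (v i) = w i)"
proof -
  interpret vs2: vector_space s2 by fact
  interpret vp: vector_space_pair "scale_sym :: 'a \<Rightarrow> 'a sym \<Rightarrow> 'a sym" s2 ..
  note I = indep_family_imp_independent[OF ind]
  obtain g where g: "Vector_Spaces.linear scale_sym s2 g" "\<forall>x\<in>v ` I. g x = w (inv_into I v x)"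
    using vp.linear_independent_extend[OF I(2), of "\<lambda>x. w (inv_into I v x)"] by blast
  show ?thesis
  proof (rule ex1I[of _ g])
    show "Vector_Spaces.linear scale_sym s2 g \<and> (\<forall>i\<in>I. g (v i) = w i)"
      using g I(1) by simp
    fix h assume h: "Vector_Spaces.linear scale_sym s2 h \<and> (\<forall>i\<in>I. h (v i) = w i)"
    show "h = g"
    proof
      fix x
      have "x \<in> sym.span (v ` I)" using span by simp
      then show "h x = g x"
        using h g I(1) by (intro vp.linear_eq_on[of h g x "v ` I"]) auto
    qed
  qed
qed

abbreviation linear_sym :: "('a::field sym \<Rightarrow> 'a sym) \<Rightarrow> bool" where
  "linear_sym \<equiv> Vector_Spaces.linear scale_sym scale_sym"

abbreviation functional_sym :: "('a::field sym \<Rightarrow> 'a) \<Rightarrow> bool" where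
  "functional_sym \<equiv> Vector_Spaces.linear scale_sym (*)"

lemma linear_sym_simps:
  assumes "Vector_Spaces.linear (scale_sym :: 'a::field \<Rightarrow> _) s2 \<phi>"
  shows "\<phi> 0 = 0" "\<phi> (f + g) = \<phi> f + \<phi> g" "\<phi> (scale_sym c f) = s2 c (\<phi> f)"
    "\<phi> (\<Sum>i\<in>A. h i) = (\<Sum>i\<in>A. \<phi> (h i))"
proof -
  interpret Vector_Spaces.linear scale_sym s2 \<phi> by fact
  show "\<phi> 0 = 0" "\<phi> (f + g) = \<phi> f + \<phi> g" "\<phi> (scale_sym c f) = s2 c (\<phi> f)"
    "\<phi> (\<Sum>i\<in>A. h i) = (\<Sum>i\<in>A. \<phi> (h i))"
    by (simp_all add: zero add scale sum)
qed

section \<open>Partitions and exponents\<close>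

text \<open>Zeros are dropped because the lists that arise from Jacobi-Trudi determinants may
  contain parts 0, which stand for h_0 = 1.\<close>

definition part_of :: "nat multiset \<Rightarrow> nat list" where
  "part_of A = rev (sorted_list_of_multiset (filter_mset (\<lambda>x. x \<noteq> 0) A))"

lemma mset_part_of: "mset (part_of A) = filter_mset (\<lambda>x. x \<noteq> 0) A"
  by (simp add: part_of_def)

lemma set_part_of: "set (part_of A) = set_mset A - {0}"
  using arg_cong[OF mset_part_of[of A], of set_mset] by auto

lemma is_partition_part_of: "is_partition (part_of A)"
proof -
  have "sorted_wrt (\<ge>) (part_of A)"
    unfolding part_of_def sorted_wrt_rev using sorted_sorted_list_of_multiset by auto
  then show ?thesis by (simp add: is_partition_def set_part_of)
qed

lemma part_of_mset:
  assumes "is_partition \<nu>"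
  shows "part_of (mset \<nu>) = \<nu>"
proof -
  have "filter_mset (\<lambda>x. x \<noteq> 0) (mset \<nu>) = mset (rev \<nu>)"
    using assms by (auto simp: is_partition_def filter_mset_eq_conv intro: gr0I)
  moreover have "sort \<nu> = rev \<nu>"
    using assms by (intro properties_for_sort) (simp_all add: is_partition_def sorted_wrt_rev)
  ultimately show ?thesis by (simp add: part_of_def)
qed

lemma partition_eqI: "is_partition \<mu> \<Longrightarrow> is_partition \<nu> \<Longrightarrow> mset \<mu> = mset \<nu> \<Longrightarrow> \<mu> = \<nu>"
  by (metis part_of_mset)

lemma is_partitionD: "is_partition \<mu> \<Longrightarrow> 0 \<notin> set \<mu>"
  by (simp add: is_partition_def)

lemma sum_list_part_of: "sum_list (part_of A) = \<Sum>\<^sub># A"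
proof -
  have "\<Sum>\<^sub># A = \<Sum>\<^sub># (filter_mset (\<lambda>x. x \<noteq> 0) A)"
    by (induction A) auto
  also have "\<dots> = sum_list (part_of A)"
    by (simp only: mset_part_of[symmetric] sum_mset_sum_list)
  finally show ?thesis ..
qed

lemma finite_positive_lists: "finite {\<rho> :: nat list. 0 \<notin> set \<rho> \<and> sum_list \<rho> \<le> n}"
proof (rule finite_subset)
  show "{\<rho> :: nat list. 0 \<notin> set \<rho> \<and> sum_list \<rho> \<le> n} \<subseteq> {\<rho>. set \<rho> \<subseteq> {..n} \<and> length \<rho> \<le> n}"
  proof safe
    fix \<rho> :: "nat list" and x assume *: "0 \<notin> set \<rho>" "sum_list \<rho> \<le> n"
    { assume "x \<in> set \<rho>"
      then show "x \<le> n" using member_le_sum_list[of x \<rho>] * by simp }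
    have "length \<rho> \<le> sum_list \<rho>"
      using *(1) by (induction \<rho>) auto
    then show "length \<rho> \<le> n" using * by simp
  qed
qed (rule finite_lists_length_le, simp)

lemma finite_partitions: "finite {\<rho>. is_partition \<rho> \<and> sum_list \<rho> \<le> n}" "finite {\<rho>. is_partition \<rho> \<and> sum_list \<rho> = n}"
  by (rule finite_subset[OF _ finite_positive_lists[of n]], auto simp: is_partition_def)+

text \<open>The nonzero exponents of the monomial x^M; they classify monomials up to renaming of
  variables.\<close>

definition shape :: "nat multiset \<Rightarrow> nat multiset" where
  "shape M = image_mset (count M) (mset_set (set_mset M))"

definition exponent :: "nat list \<Rightarrow> nat multiset" where
  "exponent l = (\<Sum>i<length l. replicate_mset (l ! i) i)"

lemma count_exponent: "count (exponent l) i = (if i < length l then l ! i else 0)"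
  by (simp add: exponent_def count_sum)

lemma shape_exponent:
  assumes "0 \<notin> set l"
  shows "shape (exponent l) = mset l"
proof -
  have "i \<in># exponent l \<longleftrightarrow> i < length l" for i
  proof -
    have "i < length l \<Longrightarrow> 0 < l ! i"
      using assms nth_mem[of i l] by (cases "l ! i") auto
    then show ?thesis by (simp add: count_exponent flip: count_greater_zero_iff)
  qed
  then have "set_mset (exponent l) = {..<length l}" by auto
  then have "shape (exponent l) = image_mset (count (exponent l)) (mset_set {..<length l})"
    by (simp only: shape_def)
  also have "\<dots> = image_mset ((!) l) (mset_set {..<length l})"
    by (rule image_mset_cong) (simp add: count_exponent)
  also have "\<dots> = mset (map ((!) l) [0..<length l])"
    by (simp only: mset_map mset_set_upto_eq_mset_upto)
  finally show ?thesis by (simp add: map_nth)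
qed

lemma size_exponent: "size (exponent l) = sum_list l"
  by (simp add: exponent_def size_multiset_sum sum_list_sum_nth atLeast0LessThan)

lemma size_shape: "size (shape M) = card (set_mset M)"
  by (simp add: shape_def)

lemma sum_mset_shape: "\<Sum>\<^sub># (shape M) = size M"
  by (simp add: shape_def size_multiset_overloaded_eq sum_unfold_sum_mset)

lemma count_image_mset_bij: "bij \<sigma> \<Longrightarrow> count (image_mset \<sigma> M) (\<sigma> i) = count M i"
  by (induction M) (auto simp: inj_eq bij_is_inj)

lemma coeff_sym_image: "bij \<sigma> \<Longrightarrow> coeff_sym f (image_mset \<sigma> M) = coeff_sym f M"
  using coeff_sym[of f] by blast

text \<open>Monomials with the same exponents differ by a permutation of the variables, and
  \<open>f\<close> is invariant under these.\<close>

lemma coeff_sym_shape: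
  assumes "shape M = shape N"
  shows "coeff_sym f M = coeff_sym f N"
proof -
  let ?A = "set_mset M \<union> set_mset N"
  \<comment> \<open>Padding with exponents 0 gives both monomials the index set \<open>?A\<close>.
    Matching equal exponents is then a permutation of \<open>?A\<close>, extended by the
    identity.\<close>
  have *: "image_mset (count L) (mset_set ?A) = shape L + replicate_mset (card ?A - size (shape L)) 0"
    if "L = M \<or> L = N" for L
  proof -
    have sub: "set_mset L \<subseteq> ?A" using that by auto
    then have "mset_set ?A = mset_set (set_mset L) + mset_set (?A - set_mset L)"
      using mset_set_Union[of "set_mset L" "?A - set_mset L"] by (simp add: Un_absorb1)
    moreover have "image_mset (count L) (mset_set (?A - set_mset L)) = image_mset (\<lambda>_. 0) (mset_set (?A - set_mset L))"
      by (rule image_mset_cong) (simp add: not_in_iff)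
    moreover have "card (?A - set_mset L) = card ?A - card (set_mset L)"
      using sub by (intro card_Diff_subset) auto
    ultimately show ?thesis
      by (simp add: shape_def image_mset_const_eq)
  qed
  have "image_mset (count M) (mset_set ?A) = image_mset (count N) (mset_set ?A)"
    using *[of M] *[of N] assms by simp
  then obtain p where p: "p permutes ?A" "\<forall>x\<in>?A. count M x = count N (p x)"
    by (rule image_mset_eq_implies_permutes[rotated]) auto
  have bij: "bij p" using p(1) by (rule permutes_bij)
  have "count (image_mset p M) (p i) = count N (p i)" for i
  proof (cases "i \<in> ?A")
    case False
    then have "p i = i" using p(1) by (meson permutes_not_in)
    then show ?thesis using False count_image_mset_bij[OF bij, of M i] by (simp add: not_in_iff)
  qed (use p in \<open>simp add: count_image_mset_bij[OF bij]\<close>)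
  then have "count (image_mset p M) j = count N j" for j
    by (metis bij bij_pointE)
  then have "image_mset p M = N" by (rule multiset_eqI)
  then show ?thesis using coeff_sym_image[OF bij] by metis
qed

lemma shape_remove:
  assumes "i \<in># M"
  shows "shape M = add_mset (count M i) (shape (M - replicate_mset (count M i) i))"
proof -
  let ?N = "M - replicate_mset (count M i) i"
  have set: "set_mset ?N = set_mset M - {i}"
    by (auto simp: count_diff simp flip: count_greater_zero_iff split: if_splits)
  have "shape M = image_mset (count M) (add_mset i (mset_set (set_mset M - {i})))"
    unfolding shape_def using assms by (subst mset_set.remove[of _ i]) auto
  also have "\<dots> = add_mset (count M i) (image_mset (count ?N) (mset_set (set_mset ?N)))"
    unfolding set by (auto intro!: image_mset_cong)
  finally show ?thesis by (simp add: shape_def)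
qed

section \<open>Power sums\<close>

lemma power_sum_part_Nil [simp]: "power_sum_part [] = 1"
  by (simp add: power_sum_part_def)

lemma power_sum_part_Cons [simp]: "power_sum_part (r # \<rho>) = power_sum r * power_sum_part \<rho>"
  by (simp add: power_sum_part_def)

lemma coeff_power_sum_part_size:
  fixes M :: "nat multiset"
  assumes "0 \<notin> set \<rho>" "coeff_sym (power_sum_part \<rho> :: 'a::comm_ring_1 sym) M \<noteq> 0"
  shows "size M = sum_list \<rho>"
  using assms
proof (induction \<rho> arbitrary: M)
  case Nil
  then show ?case by (auto simp: one_sym.rep_eq split: if_splits)
next
  case (Cons r \<rho>)
  then have "(\<Sum>i | i \<in> set_mset M \<and> r \<le> count M i.
      coeff_sym (power_sum_part \<rho> :: 'a sym) (M - replicate_mset r i)) \<noteq> 0"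
    by (simp add: coeff_power_sum_mult)
  then obtain i where i: "r \<le> count M i" "coeff_sym (power_sum_part \<rho> :: 'a sym) (M - replicate_mset r i) \<noteq> 0"
    by (auto elim: sum.not_neutral_contains_not_neutral)
  then have "size (M - replicate_mset r i) = sum_list \<rho>" using Cons by simp
  then show ?case using i(1) count_le_size[of M i] by (simp add: size_diff_replicate)
qed

lemma coeff_power_sum_part_nonneg:
  fixes M :: "nat multiset"
  assumes "0 \<notin> set \<rho>"
  shows "0 \<le> coeff_sym (power_sum_part \<rho> :: 'a::linordered_idom sym) M"
  using assms
proof (induction \<rho> arbitrary: M)
  case Nil
  then show ?case by (simp add: one_sym.rep_eq)
next
  case (Cons r \<rho>)
  then show ?case by (auto simp: coeff_power_sum_mult intro: sum_nonneg)
qed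

text \<open>All coefficients are nonnegative, so nothing cancels and one placement of the parts on
  different variables suffices.\<close>

lemma coeff_power_sum_part_pos:
  fixes M :: "nat multiset"
  assumes "0 \<notin> set \<rho>" "shape M = mset \<rho>"
  shows "0 < coeff_sym (power_sum_part \<rho> :: 'a::linordered_idom sym) M"
  using assms
proof (induction \<rho> arbitrary: M)
  case Nil
  then show ?case by (simp add: one_sym.rep_eq shape_def mset_set_empty_iff)
next
  case (Cons r \<rho>)
  then have "r \<in># shape M" by simp
  then obtain i where i: "i \<in># M" "count M i = r" by (auto simp: shape_def)
  then have "shape (M - replicate_mset r i) = mset \<rho>"
    using shape_remove[OF i(1)] Cons.prems(2) by simp
  then have "0 < coeff_sym (power_sum_part \<rho> :: 'a sym) (M - replicate_mset r i)"
    using Cons by simp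
  then have "0 < (\<Sum>i | i \<in> set_mset M \<and> r \<le> count M i.
      coeff_sym (power_sum_part \<rho> :: 'a sym) (M - replicate_mset r i))"
    using i Cons.prems by (intro sum_pos2[of _ i]) (auto intro!: coeff_power_sum_part_nonneg)
  then show ?case using Cons.prems by (simp add: coeff_power_sum_mult)
qed

text \<open>Each variable of a monomial of p_\<rho> collects at least one part. So there are at most
  as many variables as parts, and in case of equality no two parts have merged.\<close>

lemma coeff_power_sum_part_support:
  fixes M :: "nat multiset"
  assumes "0 \<notin> set \<rho>" "coeff_sym (power_sum_part \<rho> :: 'a::comm_ring_1 sym) M \<noteq> 0"
  shows "card (set_mset M) \<le> length \<rho> \<and> (card (set_mset M) = length \<rho> \<longrightarrow> shape M = mset \<rho>)"
  using assms
proof (induction \<rho> arbitrary: M)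
  case Nil
  then show ?case by (auto simp: one_sym.rep_eq shape_def split: if_splits)
next
  case (Cons r \<rho>)
  then have "(\<Sum>i | i \<in> set_mset M \<and> r \<le> count M i.
      coeff_sym (power_sum_part \<rho> :: 'a sym) (M - replicate_mset r i)) \<noteq> 0"
    by (simp add: coeff_power_sum_mult)
  then obtain i where i: "i \<in># M" "r \<le> count M i"
      "coeff_sym (power_sum_part \<rho> :: 'a sym) (M - replicate_mset r i) \<noteq> 0"
    by (auto elim!: sum.not_neutral_contains_not_neutral)
  let ?N = "M - replicate_mset r i"
  have IH: "card (set_mset ?N) \<le> length \<rho>" "card (set_mset ?N) = length \<rho> \<Longrightarrow> shape ?N = mset \<rho>"
    using Cons i by auto
  show ?case
  proof (cases "count M i = r")
    case True
    have "set_mset ?N = set_mset M - {i}"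
      using True by (auto simp: count_diff simp flip: count_greater_zero_iff split: if_splits)
    then have "card (set_mset M) = Suc (card (set_mset ?N))"
      using i(1) card_Suc_Diff1[of "set_mset M" i] by simp
    then show ?thesis using IH(1) IH(2) shape_remove[OF i(1)] unfolding True by simp
  next
    \<comment> \<open>Another part has landed on the variable i as well, so the factor
      \<open>power_sum r\<close> brings no new variable.\<close>
    case False
    then have "set_mset ?N = set_mset M"
      using i by (auto simp: set_eq_iff count_diff not_le simp flip: count_greater_zero_iff)
    then show ?thesis using IH(1) by simp
  qed
qed

text \<open>Triangularity by length: for a longest \<mu> that occurs in a relation, the monomial
  x^\<mu> appears in no other p_\<rho> that occurs.\<close>

lemma indep_power_sum_part: "indep_family partitions (power_sum_part :: _ \<Rightarrow> 'a::linordered_field sym)"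
  unfolding indep_family_def
proof (intro allI impI, rule ccontr)
  fix A and a :: "nat list \<Rightarrow> 'a"
  assume A: "finite A" "A \<subseteq> partitions" "(\<Sum>\<rho>\<in>A. scale_sym (a \<rho>) (power_sum_part \<rho>)) = 0"
    and "\<not> (\<forall>\<rho>\<in>A. a \<rho> = 0)"
  then have B: "finite {\<rho>\<in>A. a \<rho> \<noteq> 0}" "{\<rho>\<in>A. a \<rho> \<noteq> 0} \<noteq> {}" by auto
  then obtain \<mu> where \<mu>: "\<mu> \<in> {\<rho>\<in>A. a \<rho> \<noteq> 0}" "length \<mu> = Max (length ` {\<rho>\<in>A. a \<rho> \<noteq> 0})"
    using Max_in[of "length ` {\<rho>\<in>A. a \<rho> \<noteq> 0}"] by (metis (no_types, lifting) finite_imageI image_iff image_is_empty)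
  then have \<mu>: "\<mu> \<in> A" "a \<mu> \<noteq> 0" "\<And>\<rho>. \<rho> \<in> A \<Longrightarrow> a \<rho> \<noteq> 0 \<Longrightarrow> length \<rho> \<le> length \<mu>"
    using B(1) by auto
  have part: "is_partition \<rho>" "0 \<notin> set \<rho>" if "\<rho> \<in> A" for \<rho>
    using A(2) that by (auto simp: is_partition_def)
  let ?c = "\<lambda>\<rho>. coeff_sym (power_sum_part \<rho> :: 'a sym) (exponent \<mu>)"
  have sh: "shape (exponent \<mu>) = mset \<mu>" by (simp add: shape_exponent part \<mu>(1))
  have "0 = coeff_sym (\<Sum>\<rho>\<in>A. scale_sym (a \<rho>) (power_sum_part \<rho>)) (exponent \<mu>)"
    by (simp add: A(3))
  also have "\<dots> = (\<Sum>\<rho>\<in>A. a \<rho> * ?c \<rho>)"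
    by simp
  also have "\<dots> = (\<Sum>\<rho>\<in>A. if \<rho> = \<mu> then a \<mu> * ?c \<mu> else 0)"
  proof (rule sum.cong[OF refl])
    fix \<rho> assume \<rho>: "\<rho> \<in> A"
    have "\<rho> = \<mu>" if "a \<rho> * ?c \<rho> \<noteq> 0"
    proof -
      from that have ne: "a \<rho> \<noteq> 0" "?c \<rho> \<noteq> 0" by auto
      have "card (set_mset (exponent \<mu>)) = length \<mu>"
        by (metis sh size_mset size_shape)
      then have "shape (exponent \<mu>) = mset \<rho>"
        using coeff_power_sum_part_support[OF part(2)[OF \<rho>] ne(2)] \<mu>(3)[OF \<rho> ne(1)] by auto
      then show ?thesis using sh partition_eqI part \<rho> \<mu>(1) by metis
    qed
    then show "a \<rho> * ?c \<rho> = (if \<rho> = \<mu> then a \<mu> * ?c \<mu> else 0)" by auto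
  qed
  also have "\<dots> = a \<mu> * ?c \<mu>" using A(1) \<mu>(1) by simp
  finally show False
    using \<mu>(2) coeff_power_sum_part_pos[OF part(2)[OF \<mu>(1)] sh, where ?'a = 'a] by simp
qed

lemma sym_bounded: "\<exists>d. \<forall>M. coeff_sym f M \<noteq> 0 \<longrightarrow> size M \<le> d"
  using coeff_sym[of f] by blast

text \<open>Induction on the number of variables in the monomials of \<open>f\<close>: the terms
  with the most variables are removed by subtracting p_\<rho> with that many parts, whose other
  monomials have fewer variables.\<close>

lemma span_power_sum_part:
  "sym.span (power_sum_part ` partitions) = (UNIV :: 'a::linordered_field sym set)"
proof -
  let ?S = "sym.span (power_sum_part ` partitions) :: 'a sym set"
  have "f \<in> ?S" if "\<forall>M. coeff_sym f M \<noteq> 0 \<longrightarrow> card (set_mset M) < l \<and> size M \<le> d" for f l d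
    using that
  proof (induction l arbitrary: f)
    case 0
    then have "f = 0" by (intro sym_eqI) auto
    then show ?case by (simp add: sym.span_zero)
  next
    case (Suc l)
    let ?P = "{\<rho>. is_partition \<rho> \<and> sum_list \<rho> \<le> d \<and> length \<rho> = l}"
    let ?c = "\<lambda>\<rho> M. coeff_sym (power_sum_part \<rho> :: 'a sym) M"
    \<comment> \<open>Chosen so that \<open>?g\<close> agrees with \<open>f\<close> at x^\<rho> for
      every \<rho> in \<open>?P\<close>.\<close>
    let ?a = "\<lambda>\<rho>. coeff_sym f (exponent \<rho>) / ?c \<rho> (exponent \<rho>)"
    let ?g = "\<Sum>\<rho>\<in>?P. scale_sym (?a \<rho>) (power_sum_part \<rho>)"
    have fin: "finite ?P"
      by (rule finite_subset[OF _ finite_partitions(1)[of d]]) auto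
    have g: "?g \<in> ?S"
      by (intro sym.span_sum sym.span_scale sym.span_base) auto
    have "card (set_mset M) < l \<and> size M \<le> d" if M: "coeff_sym (f - ?g) M \<noteq> 0" for M
    proof -
      have co: "coeff_sym (f - ?g) M = coeff_sym f M - (\<Sum>\<rho>\<in>?P. ?a \<rho> * ?c \<rho> M)"
        by simp
      have nz: "card (set_mset M) \<le> l \<and> size M \<le> d \<and> (card (set_mset M) = l \<longrightarrow> shape M = mset \<rho>)"
        if "\<rho> \<in> ?P" "?c \<rho> M \<noteq> 0" for \<rho>
        using coeff_power_sum_part_size[OF _ that(2)] coeff_power_sum_part_support[OF _ that(2)] that(1)
        by (auto simp: is_partition_def)
      have bound: "card (set_mset M) \<le> l \<and> size M \<le> d"
      proof (rule ccontr)
        assume *: "\<not> ?thesis"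
        then have "coeff_sym f M = 0" using Suc.prems by (metis less_Suc_eq_le)
        moreover have "?c \<rho> M = 0" if "\<rho> \<in> ?P" for \<rho> using nz[OF that] * by blast
        ultimately show False using M co by simp
      qed
      moreover have "card (set_mset M) \<noteq> l"
      proof
        assume l: "card (set_mset M) = l"
        define \<mu> where "\<mu> = part_of (shape M)"
        have ms: "mset \<mu> = shape M"
          by (auto simp: \<mu>_def mset_part_of filter_mset_eq_conv shape_def)
        have p: "is_partition \<mu>" by (simp add: \<mu>_def is_partition_part_of)
        have "\<mu> \<in> ?P"
          using p bound l by (simp flip: size_mset sum_mset_sum_list add: ms sum_mset_shape size_shape)
        have sh: "shape (exponent \<mu>) = shape M"
          using p ms by (simp add: shape_exponent is_partition_def)
        have "(\<Sum>\<rho>\<in>?P. ?a \<rho> * ?c \<rho> M) = (\<Sum>\<rho>\<in>?P. if \<rho> = \<mu> then ?a \<mu> * ?c \<mu> M else 0)"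
        proof (rule sum.cong[OF refl])
          fix \<rho> assume \<rho>: "\<rho> \<in> ?P"
          have "\<rho> = \<mu>" if "?c \<rho> M \<noteq> 0"
            using nz[OF \<rho> that] l ms p \<rho> partition_eqI by auto
          then show "?a \<rho> * ?c \<rho> M = (if \<rho> = \<mu> then ?a \<mu> * ?c \<mu> M else 0)" by auto
        qed
        also have "\<dots> = ?a \<mu> * ?c \<mu> M" using fin \<open>\<mu> \<in> ?P\<close> by simp
        also have "\<dots> = coeff_sym f M"
          using coeff_power_sum_part_pos[of \<mu> M, where ?'a = 'a] p ms
          by (simp add: is_partition_def coeff_sym_shape[OF sh])
        finally show False using M co by simp
      qed
      ultimately show ?thesis by simp
    qed
    then have "f - ?g \<in> ?S" using Suc.IH by blast
    from sym.span_add[OF this g] show ?case by simp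
  qed
  then have *: "f \<in> ?S" if "\<forall>M. coeff_sym f M \<noteq> 0 \<longrightarrow> card (set_mset M) < l \<and> size M \<le> d" for f l d
    using that .
  have "f \<in> ?S" for f :: "'a sym"
  proof -
    obtain d where d: "\<forall>M. coeff_sym f M \<noteq> 0 \<longrightarrow> size M \<le> d" using sym_bounded by blast
    have "card (set_mset M) \<le> size M" for M :: "nat multiset"
    proof -
      have "size M = (\<Sum>i\<in>set_mset M. count M i)" by (rule size_multiset_overloaded_eq)
      moreover have "(\<Sum>i\<in>set_mset M. 1) \<le> (\<Sum>i\<in>set_mset M. count M i)"
        by (rule sum_mono) (simp add: Suc_le_eq)
      ultimately show ?thesis by simp
    qed
    then show ?thesis using *[of f "Suc d" d] d by (meson le_imp_less_Suc le_trans)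
  qed
  then show ?thesis by blast
qed

lemma power_sum_expansionE:
  fixes f :: "'a::linordered_field sym"
  obtains A a where "finite A" "A \<subseteq> partitions" "f = (\<Sum>\<rho>\<in>A. scale_sym (a \<rho>) (power_sum_part \<rho>))"
proof -
  have "f \<in> sym.span (power_sum_part ` partitions)"
    by (simp add: span_power_sum_part)
  then show ?thesis
    unfolding span_image_iff using that by blast
qed

section \<open>Products of complete symmetric functions\<close>

text \<open>Generic in \<open>a\<close> since the same products are formed from h, e, p and their
  images under plethysm.\<close>

definition seq_part :: "(nat \<Rightarrow> 'a::comm_ring_1 sym) \<Rightarrow> nat list \<Rightarrow> 'a sym" where
  "seq_part a \<nu> = (\<Prod>r\<leftarrow>\<nu>. a r)"

abbreviation "h_part \<equiv> seq_part complete_sym"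

abbreviation "e_part \<equiv> seq_part elem_sym"

lemma seq_part_simps [simp]:
  "seq_part a [] = 1" "seq_part a (r # \<nu>) = a r * seq_part a \<nu>"
  "seq_part a (\<nu> @ \<kappa>) = seq_part a \<nu> * seq_part a \<kappa>"
  by (simp_all add: seq_part_def)

lemma seq_part_power_sum: "seq_part power_sum = power_sum_part"
  by (rule ext) (simp add: seq_part_def power_sum_part_def)

lemma seq_part_mset: "seq_part a \<nu> = (\<Prod>x\<in>#mset \<nu>. a x)"
  by (induction \<nu>) auto

lemma seq_part_part_of:
  assumes "a 0 = 1"
  shows "seq_part a (part_of (mset \<nu>)) = seq_part a \<nu>"
proof -
  have "(\<Prod>x\<in>#A. a x) = (\<Prod>x\<in>#filter_mset (\<lambda>x. x \<noteq> 0) A. a x)" for A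
    using assms by (induction A) auto
  then show ?thesis by (simp only: seq_part_mset mset_part_of)
qed

lemma span_mult_closed:
  assumes B: "\<And>u v. u \<in> B \<Longrightarrow> v \<in> B \<Longrightarrow> u * v \<in> sym.span B"
    and "x \<in> sym.span B" "y \<in> sym.span B"
  shows "x * y \<in> sym.span B"
  using assms(2)
proof (induction rule: sym.span_induct_alt)
  case base
  then show ?case by (simp add: sym.span_zero)
next
  case (step c u z)
  have "u * y \<in> sym.span B"
    using assms(3)
  proof (induction rule: sym.span_induct_alt)
    case base
    then show ?case by (simp add: sym.span_zero)
  next
    case (step d v z)
    then show ?case
      using B[OF \<open>u \<in> B\<close> step(1)] by (simp add: distrib_left sym.span_add sym.span_scale)
  qed
  then show ?case
    using step by (simp add: distrib_right sym.span_add sym.span_scale)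
qed

text \<open>Indexed by a monomial rather than a partition: Newton's identity lowers one exponent of
  \<open>M\<close> by r, which is a plain multiset difference.\<close>

definition h_monomial :: "nat multiset \<Rightarrow> 'a::comm_ring_1 sym" where
  "h_monomial M = (\<Prod>i\<in>set_mset M. complete_sym (count M i))"

lemma h_monomial_superset:
  assumes "finite S" "set_mset M \<subseteq> S"
  shows "h_monomial M = (\<Prod>i\<in>S. complete_sym (count M i))"
  unfolding h_monomial_def
  using assms by (intro prod.mono_neutral_left) (auto simp: not_in_iff)

lemma h_monomial_exponent: "h_monomial (exponent l) = h_part l"
proof -
  have "set_mset (exponent l) \<subseteq> {..<length l}"
    by (auto simp: count_exponent simp flip: count_greater_zero_iff split: if_splits)
  then have "h_monomial (exponent l) = (\<Prod>i<length l. complete_sym (count (exponent l) i))"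
    by (intro h_monomial_superset) auto
  also have "\<dots> = (\<Prod>i<length l. complete_sym (l ! i))"
    by (rule prod.cong) (auto simp: count_exponent)
  also have "\<dots> = h_part l"
    by (simp add: seq_part_def prod.list_conv_set_nth atLeast0LessThan)
  finally show ?thesis .
qed

text \<open>\<open>size M\<close> is the sum of the exponents, so Newton's identity can be applied
  to one factor at a time.\<close>

lemma newton_h_monomial:
  "scale_sym (of_nat (size M)) (h_monomial M :: 'a::comm_ring_1 sym) =
    (\<Sum>i\<in>set_mset M. \<Sum>r=1..count M i. power_sum r * h_monomial (M - replicate_mset r i))"
proof -
  have "scale_sym (of_nat (size M)) (h_monomial M :: 'a sym) =
      (\<Sum>i\<in>set_mset M. scale_sym (of_nat (count M i)) (h_monomial M))"
    by (simp add: size_multiset_overloaded_eq scale_sum_sym)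
  also have "\<dots> = (\<Sum>i\<in>set_mset M. \<Sum>r=1..count M i. power_sum r * h_monomial (M - replicate_mset r i))"
  proof (rule sum.cong[OF refl])
    fix i assume i: "i \<in># M"
    let ?P = "\<Prod>j\<in>set_mset M - {i}. complete_sym (count M j) :: 'a sym"
    have N: "h_monomial (M - replicate_mset r i) = complete_sym (count M i - r) * ?P" for r
    proof -
      have "h_monomial (M - replicate_mset r i) =
          (\<Prod>j\<in>set_mset M. complete_sym (count (M - replicate_mset r i) j) :: 'a sym)"
        by (rule h_monomial_superset) (auto dest: in_diffD)
      also have "\<dots> = complete_sym (count (M - replicate_mset r i) i) *
          (\<Prod>j\<in>set_mset M - {i}. complete_sym (count (M - replicate_mset r i) j))"
        using i by (intro prod.remove) auto
      also have "(\<Prod>j\<in>set_mset M - {i}. complete_sym (count (M - replicate_mset r i) j)) = ?P"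
        by (rule prod.cong) auto
      finally show ?thesis by simp
    qed
    have "h_monomial M = complete_sym (count M i) * ?P" using N[of 0] by simp
    then have "scale_sym (of_nat (count M i)) (h_monomial M) =
        scale_sym (of_nat (count M i)) (complete_sym (count M i)) * ?P" by simp
    also have "\<dots> = (\<Sum>r=1..count M i. power_sum r * complete_sym (count M i - r)) * ?P"
      using newton_complete[where 'a = 'a] unfolding newton_seq_def by (simp del: scale_sym_mult_left)
    also have "\<dots> = (\<Sum>r=1..count M i. power_sum r * h_monomial (M - replicate_mset r i))"
      unfolding sum_distrib_right N by (simp add: mult.assoc)
    finally show "scale_sym (of_nat (count M i)) (h_monomial M) =
        (\<Sum>r=1..count M i. power_sum r * (h_monomial (M - replicate_mset r i) :: 'a sym))" .
  qed
  finally show ?thesis .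
qed

section \<open>The Cauchy kernel, expanded over compositions\<close>

definition compositions :: "nat \<Rightarrow> nat list set" where
  "compositions n = {\<rho>. 0 \<notin> set \<rho> \<and> sum_list \<rho> = n}"

lemma finite_compositions: "finite (compositions n)"
  by (rule finite_subset[OF _ finite_positive_lists[of n]]) (auto simp: compositions_def)

lemma compositions_0: "compositions 0 = {[]}"
proof -
  have "\<rho> = []" if "0 \<notin> set \<rho>" "sum_list \<rho> = 0" for \<rho> :: "nat list"
    using that by (cases \<rho>) auto
  then show ?thesis by (auto simp: compositions_def)
qed

lemma sum_compositions:
  assumes "n > 0"
  shows "(\<Sum>\<rho>\<in>compositions n. F \<rho>) = (\<Sum>r=1..n. \<Sum>\<rho>\<in>compositions (n - r). F (r # \<rho>))"
proof -
  have "(\<Sum>r=1..n. \<Sum>\<rho>\<in>compositions (n - r). F (r # \<rho>)) =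
      (\<Sum>x\<in>(SIGMA r:{1..n}. compositions (n - r)). F (fst x # snd x))"
    by (subst sum.Sigma) (auto simp: finite_compositions case_prod_unfold)
  also have "\<dots> = (\<Sum>\<rho>\<in>compositions n. F \<rho>)"
  proof (rule sum.reindex_bij_witness[of _ "\<lambda>\<rho>. (hd \<rho>, tl \<rho>)" "\<lambda>x. fst x # snd x"])
    fix \<rho> assume "\<rho> \<in> compositions n"
    then show "(hd \<rho>, tl \<rho>) \<in> (SIGMA r:{1..n}. compositions (n - r))"
        "fst (hd \<rho>, tl \<rho>) # snd (hd \<rho>, tl \<rho>) = \<rho>"
      using assms by (cases \<rho>; auto simp: compositions_def Suc_le_eq)+
  qed (auto simp: compositions_def)
  finally show ?thesis ..
qed

text \<open>The reciprocal of the product of all suffix sums, with one factor 1/n for each use of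
  Newton's identity in degree n. Summed over the rearrangements of a partition it gives the familiar
  1/z.\<close>

primrec kernel_weight :: "nat list \<Rightarrow> 'a::linordered_field" where
  "kernel_weight [] = 1"
| "kernel_weight (r # \<rho>) = kernel_weight \<rho> / of_nat (r + sum_list \<rho>)"

lemma kernel_weight_pos: "0 \<notin> set \<rho> \<Longrightarrow> kernel_weight \<rho> > (0 :: 'a::linordered_field)"
  by (induction \<rho>) (auto simp flip: of_nat_add)

text \<open>The Cauchy kernel in coefficient form. Recursing with Newton's identities over compositions
  replaces the usual weights $1/z_\rho$ over partitions.\<close>

lemma h_monomial_expansion:
  "h_monomial M = (\<Sum>\<rho>\<in>compositions (size M).
     scale_sym (kernel_weight \<rho> * coeff_sym (power_sum_part \<rho>) M) (power_sum_part \<rho> :: 'a::linordered_field sym))"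
proof (induction "size M" arbitrary: M rule: less_induct)
  case less
  let ?n = "size M"
  show ?case
  proof (cases "?n = 0")
    case True
    then show ?thesis by (simp add: h_monomial_def compositions_0 one_sym.rep_eq)
  next
    case False
    let ?p = "power_sum_part :: _ \<Rightarrow> 'a sym" and ?w = "kernel_weight :: _ \<Rightarrow> 'a"
    let ?L = "\<lambda>r. (\<Sum>\<rho>\<in>compositions (?n - r).
          scale_sym (of_nat ?n * ?w (r # \<rho>) * coeff_sym (?p (r # \<rho>)) M) (?p (r # \<rho>)))"
    let ?R = "\<lambda>r. (\<Sum>i | i \<in> set_mset M \<and> r \<le> count M i.
          power_sum r * h_monomial (M - replicate_mset r i))"
    \<comment> \<open>The first part \<open>r\<close> of a composition of \<open>?n\<close> brings
      the denominator \<open>?n\<close>, which cancels here.\<close>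
    have *: "of_nat ?n * ?w (r # \<rho>) = ?w \<rho>" if "r \<in> {1..?n}" "\<rho> \<in> compositions (?n - r)" for r \<rho>
      using that False by (auto simp: compositions_def simp flip: of_nat_add)
    have "scale_sym (of_nat ?n) (\<Sum>\<rho>\<in>compositions ?n. scale_sym (?w \<rho> * coeff_sym (?p \<rho>) M) (?p \<rho>)) =
        (\<Sum>r=1..?n. \<Sum>\<rho>\<in>compositions (?n - r).
          scale_sym (of_nat ?n * ?w (r # \<rho>) * coeff_sym (?p (r # \<rho>)) M) (?p (r # \<rho>)))"
      using False by (simp only: scale_sym_sum scale_sym_scale_sym sum_compositions mult.assoc)
    also have "\<dots> = (\<Sum>r=1..?n. \<Sum>i | i \<in> set_mset M \<and> r \<le> count M i.
        power_sum r * h_monomial (M - replicate_mset r i))"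
    proof (rule sum.cong[OF refl])
      fix r assume r: "r \<in> {1..?n}"
      have "?L r =
        (\<Sum>\<rho>\<in>compositions (?n - r). \<Sum>i | i \<in> set_mset M \<and> r \<le> count M i.
          scale_sym (?w \<rho> * coeff_sym (?p \<rho>) (M - replicate_mset r i)) (power_sum r * ?p \<rho>))"
      proof (rule sum.cong[OF refl])
        fix \<rho> assume \<rho>: "\<rho> \<in> compositions (?n - r)"
        have "coeff_sym (?p (r # \<rho>)) M = (\<Sum>i | i \<in> set_mset M \<and> r \<le> count M i.
            coeff_sym (?p \<rho>) (M - replicate_mset r i))"
          using r by (simp add: coeff_power_sum_mult)
        then show "scale_sym (of_nat ?n * ?w (r # \<rho>) * coeff_sym (?p (r # \<rho>)) M) (?p (r # \<rho>)) =
          (\<Sum>i | i \<in> set_mset M \<and> r \<le> count M i.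
            scale_sym (?w \<rho> * coeff_sym (?p \<rho>) (M - replicate_mset r i)) (power_sum r * ?p \<rho>))"
          by (simp only: *[OF r \<rho>] sum_distrib_left scale_sum_sym power_sum_part_Cons)
      qed
      also have "\<dots> = (\<Sum>i | i \<in> set_mset M \<and> r \<le> count M i. \<Sum>\<rho>\<in>compositions (?n - r).
          power_sum r * scale_sym (?w \<rho> * coeff_sym (?p \<rho>) (M - replicate_mset r i)) (?p \<rho>))"
        by (subst sum.swap) simp
      also have "\<dots> = ?R r"
      proof (rule sum.cong[OF refl])
        fix i assume "i \<in> {i. i \<in> set_mset M \<and> r \<le> count M i}"
        then have sz: "size (M - replicate_mset r i) = ?n - r" by (simp add: size_diff_replicate)
        have "size (M - replicate_mset r i) < size M" using sz r by auto
        from less[OF this] sz show "(\<Sum>\<rho>\<in>compositions (?n - r).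
          power_sum r * scale_sym (?w \<rho> * coeff_sym (?p \<rho>) (M - replicate_mset r i)) (?p \<rho>)) =
          power_sum r * h_monomial (M - replicate_mset r i)"
          by (simp only: sum_distrib_left)
      qed
      finally show "?L r =
        ?R r" .
    qed
    also have "\<dots> = (\<Sum>r=1..?n. \<Sum>i\<in>set_mset M.
        if r \<le> count M i then power_sum r * h_monomial (M - replicate_mset r i) else 0)"
      by (simp only: sum.inter_filter[OF finite_set_mset])
    also have "\<dots> = (\<Sum>i\<in>set_mset M. \<Sum>r=1..?n.
        if r \<le> count M i then power_sum r * h_monomial (M - replicate_mset r i) else 0)"
      by (rule sum.swap)
    also have "\<dots> = (\<Sum>i\<in>set_mset M. \<Sum>r=1..count M i. power_sum r * h_monomial (M - replicate_mset r i))"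
    proof (rule sum.cong[OF refl])
      fix i
      show "(\<Sum>r=1..?n. if r \<le> count M i then power_sum r * h_monomial (M - replicate_mset r i) else 0) =
          (\<Sum>r=1..count M i. power_sum r * (h_monomial (M - replicate_mset r i) :: 'a sym))"
        using count_le_size[of M i] by (intro sum.mono_neutral_cong_right) auto
    qed
    also have "\<dots> = scale_sym (of_nat ?n) (h_monomial M)"
      by (rule newton_h_monomial[symmetric])
    finally have eq: "scale_sym (of_nat ?n)
        (\<Sum>\<rho>\<in>compositions ?n. scale_sym (?w \<rho> * coeff_sym (?p \<rho>) M) (?p \<rho>)) =
      scale_sym (of_nat ?n) (h_monomial M)" .
    show ?thesis
      by (rule scale_sym_cancel[OF _ eq[symmetric]]) (use False in simp)
  qed
qed

text \<open>Terms of any other degree vanish, so products of different degrees can be expanded over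
  one common index set.\<close>

lemma h_monomial_expansion':
  assumes "finite C" "compositions (size M) \<subseteq> C" "\<And>\<rho>. \<rho> \<in> C \<Longrightarrow> 0 \<notin> set \<rho>"
  shows "h_monomial M = (\<Sum>\<rho>\<in>C.
     scale_sym (kernel_weight \<rho> * coeff_sym (power_sum_part \<rho>) M) (power_sum_part \<rho> :: 'a::linordered_field sym))"
  unfolding h_monomial_expansion
proof (rule sum.mono_neutral_left[OF assms(1,2)], safe)
  fix \<rho> assume "\<rho> \<in> C" "\<rho> \<notin> compositions (size M)"
  then have "coeff_sym (power_sum_part \<rho> :: 'a sym) M = 0"
    using coeff_power_sum_part_size[of \<rho> M, where 'a = 'a] assms(3)[of \<rho>] by (auto simp: compositions_def)
  then show "scale_sym (kernel_weight \<rho> * coeff_sym (power_sum_part \<rho>) M) (power_sum_part \<rho> :: 'a sym) = 0"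
    by simp
qed

text \<open>The Hall form is positive definite over an ordered field, so a linear combination of
  products \<open>h\<^sub>\<lambda>\<close> which is orthogonal to each of the \<open>h\<^sub>\<lambda>\<close> that occur must vanish. Pairing with
  \<open>h\<^sub>\<lambda>\<close> is extraction of the coefficient of $x^\lambda$.\<close>

lemma complete_orthogonal_imp_zero:
  fixes a :: "nat list \<Rightarrow> 'a::linordered_field"
  assumes A: "finite A" "A \<subseteq> partitions"
    and F: "F = (\<Sum>\<tau>\<in>A. scale_sym (a \<tau>) (h_part \<tau>))"
    and orth: "\<And>\<tau>. \<tau> \<in> A \<Longrightarrow> coeff_sym F (exponent \<tau>) = 0"
    and "\<mu> \<in> A"
  shows "a \<mu> = 0"
proof (rule ccontr)
  let ?p = "power_sum_part :: _ \<Rightarrow> 'a sym"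
  have part: "is_partition \<tau>" "0 \<notin> set \<tau>" if "\<tau> \<in> A" for \<tau>
    using A(2) that by (auto simp: is_partition_def)
  \<comment> \<open>\<open>S \<rho>\<close> is the pairing of \<open>F\<close> with p_\<rho>,
    because pairing with h_\<tau> extracts the coefficient of x^\<tau>.\<close>
  define S where "S = (\<lambda>\<rho>. \<Sum>\<tau>\<in>A. a \<tau> * coeff_sym (?p \<rho>) (exponent \<tau>))"
  have S0: "S \<rho> = 0" if \<rho>: "0 \<notin> set \<rho>" for \<rho>
  proof -
    \<comment> \<open>Large enough for all degrees in \<open>F\<close> and for \<rho>
      itself.\<close>
    define C where "C = {\<kappa> :: nat list. 0 \<notin> set \<kappa> \<and> sum_list \<kappa> \<le> Max (insert (sum_list \<rho>) (sum_list ` A))}"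
    have fin: "finite C" unfolding C_def by (rule finite_positive_lists)
    have "F = (\<Sum>\<tau>\<in>A. \<Sum>\<kappa>\<in>C. scale_sym (a \<tau> * (kernel_weight \<kappa> * coeff_sym (?p \<kappa>) (exponent \<tau>))) (?p \<kappa>))"
      unfolding F
    proof (rule sum.cong[OF refl])
      fix \<tau> assume "\<tau> \<in> A"
      then have "compositions (size (exponent \<tau>)) \<subseteq> C"
        using A(1) by (auto simp: C_def compositions_def size_exponent)
      then have "h_monomial (exponent \<tau>) =
          (\<Sum>\<kappa>\<in>C. scale_sym (kernel_weight \<kappa> * coeff_sym (?p \<kappa>) (exponent \<tau>)) (?p \<kappa>))"
        by (rule h_monomial_expansion'[OF fin]) (simp add: C_def)
      then show "scale_sym (a \<tau>) (h_part \<tau>) =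
          (\<Sum>\<kappa>\<in>C. scale_sym (a \<tau> * (kernel_weight \<kappa> * coeff_sym (?p \<kappa>) (exponent \<tau>))) (?p \<kappa>))"
        by (simp only: h_monomial_exponent scale_sym_sum scale_sym_scale_sym)
    qed
    also have "\<dots> = (\<Sum>\<kappa>\<in>C. scale_sym (kernel_weight \<kappa> * S \<kappa>) (?p \<kappa>))"
      by (subst sum.swap) (simp add: S_def sum_distrib_left scale_sum_sym mult_ac)
    finally have F': "F = (\<Sum>\<kappa>\<in>C. scale_sym (kernel_weight \<kappa> * S \<kappa>) (?p \<kappa>))" .
    \<comment> \<open>The right-hand side is the Hall norm of \<open>F\<close>; it turns into a sum
      of squares with positive weights.\<close>
    have "0 = (\<Sum>\<tau>\<in>A. a \<tau> * coeff_sym F (exponent \<tau>))" using orth by simp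
    also have "\<dots> = (\<Sum>\<tau>\<in>A. \<Sum>\<kappa>\<in>C. a \<tau> * (kernel_weight \<kappa> * S \<kappa> * coeff_sym (?p \<kappa>) (exponent \<tau>)))"
      unfolding F' by (simp add: sum_distrib_left)
    also have "\<dots> = (\<Sum>\<kappa>\<in>C. \<Sum>\<tau>\<in>A. kernel_weight \<kappa> * S \<kappa> * (a \<tau> * coeff_sym (?p \<kappa>) (exponent \<tau>)))"
      by (subst sum.swap) (simp only: mult_ac)
    also have "\<dots> = (\<Sum>\<kappa>\<in>C. kernel_weight \<kappa> * (S \<kappa>)\<^sup>2)"
      by (simp add: S_def power2_eq_square mult.assoc flip: sum_distrib_left)
    finally have "(\<Sum>\<kappa>\<in>C. kernel_weight \<kappa> * (S \<kappa>)\<^sup>2) = 0" ..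
    moreover have "kernel_weight \<kappa> * (S \<kappa>)\<^sup>2 \<ge> 0" if "\<kappa> \<in> C" for \<kappa>
      using kernel_weight_pos[of \<kappa>, where 'a = 'a] that by (simp add: C_def less_imp_le)
    moreover have "\<rho> \<in> C" using A(1) \<rho> by (simp add: C_def)
    ultimately have "kernel_weight \<rho> * (S \<rho>)\<^sup>2 = 0"
      using fin by (subst (asm) sum_nonneg_eq_0_iff) auto
    then show "S \<rho> = 0" using kernel_weight_pos[OF \<rho>, where 'a = 'a] by simp
  qed
  assume "a \<mu> \<noteq> 0"
  then have B: "finite {\<tau>\<in>A. a \<tau> \<noteq> 0}" "{\<tau>\<in>A. a \<tau> \<noteq> 0} \<noteq> {}" using A(1) \<open>\<mu> \<in> A\<close> by auto
  \<comment> \<open>For a shortest \<nu> that occurs, p_\<nu> contains x^\<tau> only if \<tau> has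
    at most as many parts, hence, among those that occur, only for \<tau> = \<nu>.\<close>
  then obtain \<nu> where \<nu>: "\<nu> \<in> {\<tau>\<in>A. a \<tau> \<noteq> 0}" "length \<nu> = Min (length ` {\<tau>\<in>A. a \<tau> \<noteq> 0})"
    using Min_in[of "length ` {\<tau>\<in>A. a \<tau> \<noteq> 0}"] by (metis (no_types, lifting) finite_imageI image_iff image_is_empty)
  then have \<nu>: "\<nu> \<in> A" "a \<nu> \<noteq> 0" "\<And>\<tau>. \<tau> \<in> A \<Longrightarrow> a \<tau> \<noteq> 0 \<Longrightarrow> length \<nu> \<le> length \<tau>"
    using B(1) by auto
  let ?c = "\<lambda>\<tau>. coeff_sym (?p \<nu>) (exponent \<tau>)"
  have "S \<nu> = (\<Sum>\<tau>\<in>A. if \<tau> = \<nu> then a \<nu> * ?c \<nu> else 0)"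
    unfolding S_def
  proof (rule sum.cong[OF refl])
    fix \<tau> assume \<tau>: "\<tau> \<in> A"
    have "\<tau> = \<nu>" if "a \<tau> * ?c \<tau> \<noteq> 0"
    proof -
      have ne: "a \<tau> \<noteq> 0" "?c \<tau> \<noteq> 0" using that by auto
      have sh: "shape (exponent \<tau>) = mset \<tau>" by (simp add: shape_exponent part \<tau>)
      then have "card (set_mset (exponent \<tau>)) = length \<tau>" by (metis size_mset size_shape)
      then have "mset \<tau> = mset \<nu>"
        using coeff_power_sum_part_support[OF part(2)[OF \<nu>(1)] ne(2)] \<nu>(3)[OF \<tau> ne(1)] sh by auto
      then show ?thesis using partition_eqI part \<tau> \<nu>(1) by metis
    qed
    then show "a \<tau> * ?c \<tau> = (if \<tau> = \<nu> then a \<nu> * ?c \<nu> else 0)" by auto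
  qed
  then have "S \<nu> = a \<nu> * ?c \<nu>" using A(1) \<nu>(1) by simp
  then show False
    using S0[OF part(2)[OF \<nu>(1)]] \<nu>(2) coeff_power_sum_part_pos[OF part(2)[OF \<nu>(1)], of "exponent \<nu>", where ?'a = 'a]
    by (simp add: shape_exponent part \<nu>(1))
qed

lemma indep_complete: "indep_family partitions (h_part :: _ \<Rightarrow> 'a::linordered_field sym)"
  unfolding indep_family_def
proof (intro allI impI ballI)
  fix A i and a :: "nat list \<Rightarrow> 'a"
  assume A: "finite A" "A \<subseteq> partitions" "(\<Sum>\<rho>\<in>A. scale_sym (a \<rho>) (h_part \<rho>)) = 0"
    and "i \<in> A"
  then show "a i = 0"
    by (intro complete_orthogonal_imp_zero[of A 0 a]) auto
qed

lemma seq_part_in_span: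
  assumes "a 0 = 1"
  shows "seq_part a \<nu> \<in> sym.span (seq_part a ` partitions)"
  using is_partition_part_of by (subst seq_part_part_of[of a, OF assms, symmetric]) (auto intro: sym.span_base)

text \<open>Newton's identity for h, solved for its last term, expresses p_n through the h and
  smaller power sums.\<close>

lemma span_complete:
  "sym.span (h_part ` partitions) = (UNIV :: 'a::linordered_field sym set)"
proof -
  let ?S = "sym.span (h_part ` partitions) :: 'a sym set"
  have mult: "x * y \<in> ?S" if "x \<in> ?S" "y \<in> ?S" for x y
    using that
  proof (rule span_mult_closed[rotated])
    fix u v :: "'a sym"
    assume "u \<in> h_part ` partitions" "v \<in> h_part ` partitions"
    then obtain \<mu> \<nu> where "u = h_part \<mu>" "v = h_part \<nu>" by blast
    then have "u * v = h_part (\<mu> @ \<nu>)" by simp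
    then show "u * v \<in> ?S" using seq_part_in_span[of complete_sym "\<mu> @ \<nu>"] by simp
  qed
  have h: "complete_sym n \<in> ?S" for n
    using seq_part_in_span[of "complete_sym" "[n]"] by simp
  have p: "power_sum n \<in> ?S" if "n \<ge> 1" for n
    using that
  proof (induction n rule: less_induct)
    case (less n)
    have "scale_sym (of_nat n) (complete_sym n) = (\<Sum>s=1..n. power_sum s * complete_sym (n - s) :: 'a sym)"
      using newton_complete[where 'a = 'a] by (simp add: newton_seq_def)
    also have "{1..n} = insert n {1..<n}" using less.prems by auto
    finally have "power_sum n = scale_sym (of_nat n) (complete_sym n) -
        (\<Sum>s\<in>{1..<n}. power_sum s * complete_sym (n - s) :: 'a sym)"
      by simp
    moreover have "\<dots> \<in> ?S"
      using less.IH h by (intro sym.span_diff sym.span_scale sym.span_sum mult) auto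
    ultimately show ?case by simp
  qed
  have "power_sum_part \<rho> \<in> ?S" if "0 \<notin> set \<rho>" for \<rho>
    using that
  proof (induction \<rho>)
    case Nil
    then show ?case using seq_part_in_span[of complete_sym "[]"] by simp
  next
    case (Cons r \<rho>)
    then show ?case using mult p[of r] by (simp add: Suc_le_eq)
  qed
  then have "power_sum_part ` partitions \<subseteq> ?S" by (auto simp: is_partition_def)
  then have "sym.span (power_sum_part ` partitions) \<subseteq> ?S"
    by (rule sym.span_minimal) (rule sym.subspace_span)
  then show ?thesis using span_power_sum_part by blast
qed

section \<open>Dominance order\<close>

lemma dominates_refl [simp]: "dominates \<mu> \<mu>"
  by (simp add: dominates_def)

lemma dominates_trans: "dominates \<kappa> \<nu> \<Longrightarrow> dominates \<nu> \<mu> \<Longrightarrow> dominates \<kappa> \<mu>"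
  unfolding dominates_def by (metis order_trans)

lemma dominates_antisym:
  assumes "is_partition \<mu>" "is_partition \<nu>" "dominates \<mu> \<nu>" "dominates \<nu> \<mu>"
  shows "\<mu> = \<nu>"
proof -
  have "xs = ys" if "0 \<notin> set xs" "0 \<notin> set ys" "\<And>i. sum_list (take i xs) = sum_list (take i ys)"
    for xs ys :: "nat list"
    using that
  proof (induction xs arbitrary: ys)
    case Nil
    then show ?case using Nil(3)[of 1] by (cases ys) auto
  next
    case (Cons x xs)
    obtain y ys' where ys: "ys = y # ys'" using Cons.prems(1) Cons.prems(3)[of 1] by (cases ys) auto
    have "x = y" using Cons.prems(3)[of 1] ys by simp
    moreover have "sum_list (take i xs) = sum_list (take i ys')" for i
      using Cons.prems(3)[of "Suc i"] ys \<open>x = y\<close> by simp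
    ultimately show ?case using Cons ys by simp
  qed
  then show ?thesis
    using assms by (simp add: is_partition_def dominates_def order_antisym)
qed

definition above :: "nat list \<Rightarrow> nat list set" where
  "above \<mu> = {\<nu>. is_partition \<nu> \<and> dominates \<nu> \<mu>}"

definition strictly_above :: "nat list \<Rightarrow> nat list set" where
  "strictly_above \<mu> = above \<mu> - {\<mu>}"

lemma finite_above: "finite (above \<mu>)"
  by (rule finite_subset[OF _ finite_partitions(2)[of "sum_list \<mu>"]]) (auto simp: above_def dominates_def)

lemma above_subset: "\<nu> \<in> above \<mu> \<Longrightarrow> above \<nu> \<subseteq> above \<mu>"
  by (auto simp: above_def intro: dominates_trans)

lemma above_eq: "is_partition \<mu> \<Longrightarrow> above \<mu> = insert \<mu> (strictly_above \<mu>)"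
  by (auto simp: above_def strictly_above_def)

text \<open>The number of partitions strictly above serves as a rank that decreases on the way up in
  the dominance order.\<close>

lemma card_strictly_above_less:
  assumes "is_partition \<mu>" "\<nu> \<in> strictly_above \<mu>"
  shows "card (strictly_above \<nu>) < card (strictly_above \<mu>)"
proof (rule psubset_card_mono)
  show "finite (strictly_above \<mu>)" by (simp add: strictly_above_def finite_above)
  have "strictly_above \<nu> \<subseteq> strictly_above \<mu>"
    using assms dominates_antisym[of \<mu> \<nu>]
    by (auto simp: strictly_above_def above_def intro: dominates_trans)
  moreover have "\<nu> \<notin> strictly_above \<nu>" by (simp add: strictly_above_def)
  ultimately show "strictly_above \<nu> \<subset> strictly_above \<mu>" using assms(2) by blast
qed

lemma vector_space_self: "vector_space ((*) :: 'a::field \<Rightarrow> 'a \<Rightarrow> 'a)"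
  by unfold_locales (simp_all add: algebra_simps)

lemma linear_vanish_on_span:
  assumes "Vector_Spaces.linear (scale_sym :: 'a::field \<Rightarrow> _) s2 \<phi>"
    and "\<And>b. b \<in> B \<Longrightarrow> \<phi> b = 0" and "x \<in> sym.span B"
  shows "\<phi> x = 0"
  using assms(3)
proof (induction rule: sym.span_induct_alt)
  case base
  then show ?case by (rule linear_sym_simps[OF assms(1)])
next
  case (step c x y)
  interpret Vector_Spaces.linear scale_sym s2 \<phi> by fact
  show ?case using step assms(2)[of x] by (simp add: add scale)
qed

text \<open>Transfers a basis along a change of family that is triangular for dominance with nonzero
  diagonal. It serves Schur functions as well as the plethystic images of Macdonald polynomials
  before and after specialization.\<close>

lemma triangular_family:
  fixes u v :: "nat list \<Rightarrow> 'a::field sym" and c :: "nat list \<Rightarrow> 'a"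
  assumes ind: "indep_family partitions u"
    and span: "sym.span (u ` partitions) = UNIV"
    and c: "\<And>\<mu>. is_partition \<mu> \<Longrightarrow> c \<mu> \<noteq> 0"
    and tri: "\<And>\<mu>. is_partition \<mu> \<Longrightarrow> v \<mu> - scale_sym (c \<mu>) (u \<mu>) \<in> sym.span (u ` strictly_above \<mu>)"
  shows "indep_family partitions v" "sym.span (v ` partitions) = UNIV"
proof -
  show "indep_family partitions v"
    unfolding indep_family_def
  proof (intro allI impI, rule ccontr)
    fix A and a :: "nat list \<Rightarrow> 'a"
    assume A: "finite A" "A \<subseteq> partitions" "(\<Sum>\<mu>\<in>A. scale_sym (a \<mu>) (v \<mu>)) = 0"
      and "\<not> (\<forall>\<mu>\<in>A. a \<mu> = 0)"
    let ?B = "{\<mu>\<in>A. a \<mu> \<noteq> 0}" and ?m = "\<lambda>\<mu>. card (strictly_above \<mu>)"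
    have B: "finite ?B" "?B \<noteq> {}" using A(1) \<open>\<not> _\<close> by auto
    \<comment> \<open>A lowest \<mu> with nonzero coefficient: it lies strictly above no other index
      that occurs, so the \<mu>-coordinate of the relation only sees \<open>v \<mu>\<close>.\<close>
    then obtain \<mu> where \<mu>: "\<mu> \<in> ?B" "?m \<mu> = Max (?m ` ?B)"
      using Max_in[of "?m ` ?B"] by (metis (no_types, lifting) finite_imageI image_iff image_is_empty)
    then have \<mu>: "\<mu> \<in> A" "a \<mu> \<noteq> 0" "\<And>\<nu>. \<nu> \<in> A \<Longrightarrow> a \<nu> \<noteq> 0 \<Longrightarrow> ?m \<nu> \<le> ?m \<mu>"
      using B(1) by auto
    obtain \<phi> where \<phi>: "Vector_Spaces.linear scale_sym ((*) :: 'a \<Rightarrow> _) \<phi>"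
        "\<And>\<nu>. is_partition \<nu> \<Longrightarrow> \<phi> (u \<nu>) = (if \<nu> = \<mu> then 1 else 0)"
      using ex1_implies_ex[OF ex1_linear_on_basis[OF vector_space_self ind span, of "\<lambda>\<nu>. if \<nu> = \<mu> then 1 else 0"]]
      by auto
    note lin = linear_sym_simps[OF \<phi>(1)]
    have "\<phi> (scale_sym (a \<nu>) (v \<nu>)) = (if \<nu> = \<mu> then a \<mu> * c \<mu> else 0)" if \<nu>: "\<nu> \<in> A" for \<nu>
    proof (cases "a \<nu> = 0")
      case True
      then show ?thesis using \<mu>(2) by (auto simp: lin)
    next
      case False
      have p: "is_partition \<nu>" using \<nu> A(2) by auto
      have "\<mu> \<notin> strictly_above \<nu>"
        using card_strictly_above_less[OF p] \<mu>(3)[OF \<nu> False] by (meson not_le)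
      then have "\<phi> (v \<nu> - scale_sym (c \<nu>) (u \<nu>)) = 0"
      proof (intro linear_vanish_on_span[OF \<phi>(1) _ tri[OF p]])
        fix b assume "b \<in> u ` strictly_above \<nu>"
        then obtain \<kappa> where "b = u \<kappa>" "\<kappa> \<in> strictly_above \<nu>" by blast
        moreover from this have "\<kappa> \<noteq> \<mu>" "is_partition \<kappa>"
          using \<open>\<mu> \<notin> strictly_above \<nu>\<close> by (auto simp: strictly_above_def above_def)
        ultimately show "\<phi> b = 0" by (simp add: \<phi>(2))
      qed
      then have "\<phi> (v \<nu>) = c \<nu> * \<phi> (u \<nu>)"
        using lin(2)[of "v \<nu> - scale_sym (c \<nu>) (u \<nu>)" "scale_sym (c \<nu>) (u \<nu>)"] by (simp add: lin(3))
      then show ?thesis by (simp add: lin(3) \<phi>(2)[OF p])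
    qed
    then have "\<phi> (\<Sum>\<nu>\<in>A. scale_sym (a \<nu>) (v \<nu>)) = a \<mu> * c \<mu>"
      using A(1) \<mu>(1) by (simp add: lin(4))
    then show False using A(2,3) \<mu>(1,2) c[of \<mu>] by (auto simp: lin(1))
  qed
  let ?S = "sym.span (v ` partitions)"
  have "u \<mu> \<in> ?S" if "is_partition \<mu>" for \<mu>
    using that
  proof (induction "card (strictly_above \<mu>)" arbitrary: \<mu> rule: less_induct)
    case less
    have "u ` strictly_above \<mu> \<subseteq> ?S"
      using less card_strictly_above_less[OF less.prems] by (auto simp: strictly_above_def above_def)
    then have "sym.span (u ` strictly_above \<mu>) \<subseteq> ?S"
      by (rule sym.span_minimal) (rule sym.subspace_span)
    then have "v \<mu> - scale_sym (c \<mu>) (u \<mu>) \<in> ?S" using tri[OF less.prems] by blast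
    moreover have "v \<mu> \<in> ?S" using less.prems by (intro sym.span_base) auto
    ultimately have "v \<mu> - (v \<mu> - scale_sym (c \<mu>) (u \<mu>)) \<in> ?S" by (rule sym.span_diff[rotated])
    then have "scale_sym (c \<mu>) (u \<mu>) \<in> ?S" by simp
    then have "scale_sym (1 / c \<mu>) (scale_sym (c \<mu>) (u \<mu>)) \<in> ?S" by (rule sym.span_scale)
    then show ?case using c[OF less.prems] by (simp add: scale_sym_scale_sym)
  qed
  then have "u ` partitions \<subseteq> ?S" by blast
  then have "sym.span (u ` partitions) \<subseteq> ?S"
    by (rule sym.span_minimal) (rule sym.subspace_span)
  then show "?S = UNIV" using span by blast
qed

section \<open>Schur functions and the Hall scalar product\<close>

text \<open>Each entry x of \<open>xs\<close> is matched with an element of \<open>A\<close>: with x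
  itself if it occurs there, otherwise with any element, which is then at most x.\<close>

lemma sum_mset_le_sum_take:
  assumes "sorted_wrt (\<ge>) xs" "A \<subseteq># mset xs" "size A \<le> k"
  shows "\<Sum>\<^sub># A \<le> sum_list (take k xs :: nat list)"
  using assms
proof (induction xs arbitrary: A k)
  case Nil
  then show ?case by simp
next
  case (Cons x xs)
  show ?case
  proof (cases "A = {#}")
    case False
    then obtain k' where k: "k = Suc k'" using Cons.prems(3) by (cases k) auto
    obtain a where a: "a \<in># A" "x \<in># A \<Longrightarrow> a = x" using False by (metis multiset_nonemptyE)
    have "a \<in># mset (x # xs)" using mset_subset_eqD[OF Cons.prems(2) a(1)] .
    then have "a \<le> x" using Cons.prems(1) by auto
    have "A - {#a#} \<subseteq># mset xs"
    proof (cases "x \<in># A")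
      case True
      then show ?thesis using a Cons.prems(2) by (simp add: subset_eq_diff_conv)
    next
      case False
      then have "A \<subseteq># mset xs"
      proof (intro mset_subset_eqI)
        fix y
        show "count A y \<le> count (mset xs) y"
          using False mset_subset_eq_count[OF Cons.prems(2), of y] by (cases "y = x") (auto simp: not_in_iff)
      qed
      then show ?thesis by (meson diff_subset_eq_self subset_mset.order_trans)
    qed
    then have "\<Sum>\<^sub># (A - {#a#}) \<le> sum_list (take k' xs)"
      using Cons.prems k a(1) by (intro Cons.IH) (auto simp: size_Diff_singleton)
    moreover have "\<Sum>\<^sub># A = a + \<Sum>\<^sub># (A - {#a#})" using a(1) by (metis insert_DiffM sum_mset.add_mset)
    ultimately show ?thesis using \<open>a \<le> x\<close> k by simp
  qed simp
qed

lemma sum_take_le_part_of: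
  "sum_list (take k l) \<le> sum_list (take k (part_of (mset l)))"
proof -
  let ?A = "filter_mset (\<lambda>x. x \<noteq> 0) (mset (take k l))"
  have "\<Sum>\<^sub># ?A = sum_list (part_of (mset (take k l)))"
    by (simp only: mset_part_of[symmetric] sum_mset_sum_list)
  then have "sum_list (take k l) = \<Sum>\<^sub># ?A"
    by (simp only: sum_list_part_of sum_mset_sum_list)
  also have "\<dots> \<le> sum_list (take k (part_of (mset l)))"
  proof (rule sum_mset_le_sum_take)
    show "sorted_wrt (\<ge>) (part_of (mset l))"
      using is_partition_part_of[of "mset l"] by (simp add: is_partition_def)
    have "mset (take k l) \<subseteq># mset l"
      by (metis append_take_drop_id mset_append mset_subset_eq_add_left)
    then show "?A \<subseteq># mset (part_of (mset l))"
      unfolding mset_part_of by (rule multiset_filter_mono)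
    have "size ?A \<le> size (mset (take k l))" by (rule size_filter_mset_lesseq)
    then show "size ?A \<le> k" by simp
  qed
  finally show ?thesis .
qed

text \<open>k distinct naturals have at least the sum 0 + ... + (k - 1).\<close>

lemma permutes_prefix_sum_ge:
  fixes p :: "nat \<Rightarrow> nat"
  assumes "p permutes {0..<n}"
  shows "(\<Sum>i<k. i) \<le> (\<Sum>i<k. p i)"
proof -
  have inj: "inj_on p {..<k}" using permutes_inj[OF assms] by (rule inj_on_subset) simp
  have "\<Sum>{0..<card (p ` {..<k})} \<le> \<Sum>(p ` {..<k})" by (rule card_sum_le_nat_sum)
  then show ?thesis using inj by (simp add: card_image sum.reindex atLeast0LessThan)
qed

lemma permutes_prefix_sum_greater:
  fixes p :: "nat \<Rightarrow> nat"
  assumes p: "p permutes {0..<n}" and "p \<noteq> id"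
  obtains k where "k \<le> n" "(\<Sum>i<k. i) < (\<Sum>i<k. p i)"
proof -
  \<comment> \<open>The first index that is moved must move up, since all smaller values are
    taken.\<close>
  define i where "i = (LEAST i. p i \<noteq> i)"
  have ex: "\<exists>i. p i \<noteq> i" using assms(2) by auto
  then have i: "p i \<noteq> i" unfolding i_def by (rule LeastI_ex)
  have less: "p j = j" if "j < i" for j using not_less_Least that unfolding i_def by blast
  have "p i > i"
  proof (rule ccontr)
    assume "\<not> p i > i"
    then have "p (p i) = p i" using i less[of "p i"] by simp
    then show False using i permutes_inj[OF p] by (simp add: inj_eq)
  qed
  moreover have "i < n" using i permutes_not_in[OF p, of i] by (cases "i < n") auto
  moreover have "(\<Sum>j<i. p j) = (\<Sum>j<i. j)" by (rule sum.cong) (simp_all add: less)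
  ultimately show ?thesis by (intro that[of "Suc i"]) simp_all
qed

text \<open>The term of a permutation p in the determinant is the product of the h with indices
  \<nu>_i + p(i) - i. Its prefix sums exceed those of \<nu> by the prefix sums of p(i) - i, which
  are nonnegative, and one is positive unless p is the identity. Sorting raises prefix sums
  further.\<close>

lemma schur_triangular:
  assumes \<nu>: "is_partition \<nu>"
  shows "schur \<nu> - h_part \<nu> \<in> sym.span (h_part ` strictly_above \<nu> :: 'a::field sym set)"
proof -
  let ?n = "length \<nu>"
  let ?A = "mat ?n ?n (\<lambda>(i, j). if i \<le> \<nu> ! i + j then complete_sym (\<nu> ! i + j - i) else 0) :: 'a sym mat"
  let ?T = "\<lambda>p. signof p * (\<Prod>i = 0..<?n. ?A $$ (i, p i)) :: 'a sym"
  let ?S = "sym.span (h_part ` strictly_above \<nu>) :: 'a sym set"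
  let ?P = "{p. p permutes {0..<?n}}"
  have entry: "?A $$ (i, p i) = (if i \<le> \<nu> ! i + p i then complete_sym (\<nu> ! i + p i - i) else 0)"
    if "p permutes {0..<?n}" "i \<in> {0..<?n}" for p i
    using that permutes_in_image[OF that(1), of i] by simp
  have fin: "finite ?P" by (rule finite_permutations) simp
  have id: "id \<in> ?P" by (simp add: permutes_id)
  have "schur \<nu> = (\<Sum>p\<in>?P. ?T p)" by (simp add: schur_def det_def)
  also have "\<dots> = ?T id + (\<Sum>p\<in>?P - {id}. ?T p)" using fin id by (rule sum.remove)
  also have "?T id = h_part \<nu>"
  proof -
    have "(\<Prod>i = 0..<?n. ?A $$ (i, id i)) = (\<Prod>i = 0..<?n. complete_sym (\<nu> ! i))"
      by (rule prod.cong) auto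
    then show ?thesis by (simp add: seq_part_def prod.list_conv_set_nth)
  qed
  finally have schur: "schur \<nu> = h_part \<nu> + (\<Sum>p\<in>?P - {id}. ?T p)" .
  have eq: "schur \<nu> - h_part \<nu> = (\<Sum>p\<in>?P - {id}. ?T p)"
    unfolding schur by (rule add_diff_cancel_left')
  have "?T p \<in> ?S" if p: "p permutes {0..<?n}" "p \<noteq> id" for p
  proof (cases "\<forall>i<?n. i \<le> \<nu> ! i + p i")
    case False
    then obtain i where i: "i < ?n" "\<not> i \<le> \<nu> ! i + p i" by blast
    then have "?A $$ (i, p i) = 0" using entry[OF p(1), of i] by simp
    then have "(\<Prod>i = 0..<?n. ?A $$ (i, p i)) = 0" using i(1) by (intro prod_zero) auto
    then show ?thesis by (simp add: sym.span_zero)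
  next
    case True
    \<comment> \<open>Every subtraction is exact in this case. \<open>l\<close> need not be sorted
      and may contain parts 0.\<close>
    define l where "l = map (\<lambda>i. \<nu> ! i + p i - i) [0..<?n]"
    let ?\<kappa> = "part_of (mset l)"
    have "(\<Prod>i = 0..<?n. ?A $$ (i, p i)) = (\<Prod>i = 0..<?n. complete_sym (\<nu> ! i + p i - i))"
      using True entry[OF p(1)] by (intro prod.cong) auto
    also have "\<dots> = h_part l"
      by (simp add: seq_part_def l_def prod.list_conv_set_nth)
    also have "\<dots> = h_part ?\<kappa>"
      by (rule seq_part_part_of[symmetric]) simp
    finally have prod: "(\<Prod>i = 0..<?n. ?A $$ (i, p i)) = h_part ?\<kappa>" .
    have take: "sum_list (take k l) + (\<Sum>i<k. i) = sum_list (take k \<nu>) + (\<Sum>i<k. p i)" if "k \<le> ?n" for k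
    proof -
      have "sum_list (take k l) = (\<Sum>i<k. \<nu> ! i + p i - i)"
        using that by (simp add: l_def sum_list_sum_nth atLeast0LessThan)
      then have "sum_list (take k l) + (\<Sum>i<k. i) = (\<Sum>i<k. (\<nu> ! i + p i - i) + i)"
        by (simp add: sum.distrib)
      also have "\<dots> = (\<Sum>i<k. \<nu> ! i + p i)" using True that by (intro sum.cong) auto
      also have "\<dots> = sum_list (take k \<nu>) + (\<Sum>i<k. p i)"
        using that by (simp add: sum.distrib sum_list_sum_nth atLeast0LessThan)
      finally show ?thesis .
    qed
    have "(\<Sum>i<?n. p i) = (\<Sum>i<?n. i)"
      using sum.permute[OF p(1), of "\<lambda>i. i"] by (simp add: atLeast0LessThan)
    then have sum_l: "sum_list l = sum_list \<nu>" using take[of ?n] by (simp add: l_def)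
    have dom: "dominates ?\<kappa> \<nu>"
      unfolding dominates_def
    proof (intro conjI allI)
      show sum: "sum_list ?\<kappa> = sum_list \<nu>"
        using sum_l by (simp add: sum_list_part_of sum_mset_sum_list)
      fix k
      show "sum_list (take k \<nu>) \<le> sum_list (take k ?\<kappa>)"
      proof (cases "k \<le> ?n")
        case True
        then show ?thesis
          using take[OF True] permutes_prefix_sum_ge[OF p(1), of k] sum_take_le_part_of[of k l] by simp
      next
        case False
        then have "sum_list (take k \<nu>) = sum_list (take k l)" using sum_l by (simp add: l_def)
        then show ?thesis using sum_take_le_part_of[of k l] by simp
      qed
    qed
    obtain k where k: "k \<le> ?n" "(\<Sum>i<k. i) < (\<Sum>i<k. p i)"
      using permutes_prefix_sum_greater[OF p] by blast
    have "?\<kappa> \<noteq> \<nu>"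
      using take[OF k(1)] k(2) sum_take_le_part_of[of k l] by auto
    then have "?\<kappa> \<in> strictly_above \<nu>"
      using dom by (simp add: strictly_above_def above_def is_partition_part_of)
    then have "h_part ?\<kappa> \<in> ?S" by (intro sym.span_base) auto
    moreover have "signof p = (1 :: 'a sym) \<or> signof p = (-1 :: 'a sym)"
      by (simp add: sign_def)
    ultimately show ?thesis
      unfolding prod by (elim disjE) (simp_all add: sym.span_neg)
  qed
  then show ?thesis unfolding eq by (intro sym.span_sum) auto
qed

lemma schur_basis:
  "indep_family partitions (schur :: _ \<Rightarrow> 'a::linordered_field sym)"
  "sym.span (schur ` partitions) = (UNIV :: 'a::linordered_field sym set)"
proof -
  have "schur \<mu> - scale_sym 1 (h_part \<mu>)
      \<in> sym.span (h_part ` strictly_above \<mu> :: 'a sym set)" if "is_partition \<mu>" for \<mu>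
    using schur_triangular[OF that, where 'a = 'a] by simp
  note * = triangular_family[OF indep_complete span_complete one_neq_zero this]
  show "indep_family partitions (schur :: _ \<Rightarrow> 'a sym)" by (rule *(1))
  show "sym.span (schur ` partitions) = (UNIV :: 'a sym set)" by (rule *(2))
qed

text \<open>Turns the conditions on Macdonald polynomials into conditions on products of h, where
  pairing is coefficient extraction.\<close>

lemma schur_span_above:
  assumes "x \<in> sym.span {schur \<nu> |\<nu>. is_partition \<nu> \<and> dominates \<nu> \<mu>}"
  shows "x \<in> sym.span (h_part ` above \<mu> :: 'a::field sym set)"
proof -
  let ?S = "sym.span (h_part ` above \<mu>) :: 'a sym set"
  have "schur \<nu> \<in> ?S" if "is_partition \<nu>" "dominates \<nu> \<mu>" for \<nu>
  proof -
    have \<nu>: "\<nu> \<in> above \<mu>" using that by (simp add: above_def)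
    have "strictly_above \<nu> \<subseteq> above \<mu>"
      using above_subset[OF \<nu>] by (auto simp: strictly_above_def)
    then have "schur \<nu> - h_part \<nu> \<in> ?S"
      using schur_triangular[OF that(1)] sym.span_mono[OF image_mono] by blast
    moreover have "h_part \<nu> \<in> ?S" using \<nu> by (intro sym.span_base) auto
    ultimately have "schur \<nu> - h_part \<nu> + h_part \<nu> \<in> ?S"
      by (rule sym.span_add)
    then show ?thesis by simp
  qed
  then have "{schur \<nu> |\<nu>. is_partition \<nu> \<and> dominates \<nu> \<mu>} \<subseteq> ?S" by blast
  then have "sym.span {schur \<nu> |\<nu>. is_partition \<nu> \<and> dominates \<nu> \<mu>} \<subseteq> ?S"
    by (rule sym.span_minimal) (rule sym.subspace_span)
  then show ?thesis using assms by blast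
qed

lemma linear_eq_on_basis:
  assumes "sym.span (v ` I) = (UNIV :: 'a::field sym set)"
    and "Vector_Spaces.linear scale_sym s2 \<phi>" "Vector_Spaces.linear scale_sym s2 \<psi>"
    and "\<And>i. i \<in> I \<Longrightarrow> \<phi> (v i) = \<psi> (v i)"
  shows "\<phi> x = \<psi> x"
proof -
  interpret vs2: vector_space s2
    by (rule assms(2)[unfolded Vector_Spaces.linear_iff, THEN conjunct2, THEN conjunct1])
  interpret vp: vector_space_pair "scale_sym :: 'a \<Rightarrow> 'a sym \<Rightarrow> 'a sym" s2 ..
  show ?thesis
  proof (rule vp.linear_eq_on[OF assms(2,3)])
    show "x \<in> sym.span (v ` I)" by (simp only: assms(1) UNIV_I)
    show "\<phi> b = \<psi> b" if "b \<in> v ` I" for b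
      using that assms(4) by blast
  qed
qed

lemma linear_functionalI:
  fixes \<phi> :: "'a::field sym \<Rightarrow> 'a"
  assumes "\<And>x y. \<phi> (x + y) = \<phi> x + \<phi> y" "\<And>c x. \<phi> (scale_sym c x) = c * \<phi> x"
  shows "functional_sym \<phi>"
  unfolding Vector_Spaces.linear_iff
  by (intro conjI allI sym.vector_space_axioms vector_space_self assms)

text \<open>\<open>hall\<close> is described as the only bilinear form with certain values, so even
  its linearity requires both the construction of such a form and its uniqueness.\<close>

lemma hall_linear_left:
  "functional_sym (\<lambda>f. hall f (g :: 'a::linordered_field sym))"
proof -
  let ?P = "\<lambda>\<beta> :: 'a sym \<Rightarrow> 'a sym \<Rightarrow> 'a.
     (\<forall>g. functional_sym (\<lambda>f. \<beta> f g)) \<and>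
     (\<forall>f. functional_sym (\<beta> f)) \<and>
     (\<forall>\<nu> \<mu>. is_partition \<nu> \<longrightarrow> is_partition \<mu> \<longrightarrow>
        \<beta> (schur \<nu>) (schur \<mu>) = (if \<nu> = \<mu> then 1 else 0))"
  note basis = schur_basis[where 'a = 'a]
  note ex1 = ex1_linear_on_basis[OF vector_space_self basis]
  define Q where "Q = (\<lambda>w (\<phi> :: 'a sym \<Rightarrow> 'a). functional_sym \<phi> \<and>
      (\<forall>\<mu>\<in>partitions. \<phi> (schur \<mu>) = w \<mu>))"
  define cext where "cext = (\<lambda>w. SOME \<phi>. Q w \<phi>)"
  have ex: "\<exists>\<phi>. Q w \<phi>" for w
    unfolding Q_def by (rule ex1_implies_ex[OF ex1])
  have Q: "Q w (cext w)" for w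
    unfolding cext_def by (rule someI_ex[OF ex])
  have cext: "functional_sym (cext w)" for w
    using Q[of w] unfolding Q_def by (rule conjunct1)
  have cext2: "cext w (schur \<mu>) = w \<mu>" if "is_partition \<mu>" for w \<mu>
  proof (rule bspec[OF conjunct2[OF Q[of w, unfolded Q_def]]])
    show "\<mu> \<in> partitions" using that by simp
  qed
  \<comment> \<open>\<open>\<phi> \<nu>\<close> is the coordinate of a function along
    \<open>schur \<nu>\<close>, and \<open>\<beta> g\<close> is the functional that takes the value
    \<open>\<phi> \<mu> g\<close> at \<open>schur \<mu>\<close>.\<close>
  define \<phi> where "\<phi> = (\<lambda>\<nu>. cext (\<lambda>\<mu>. if \<nu> = \<mu> then 1 else 0))"
  define \<beta> where "\<beta> = (\<lambda>g. cext (\<lambda>\<mu>. \<phi> \<mu> g))"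
  have \<phi>: "functional_sym (\<phi> \<nu>)" for \<nu>
    unfolding \<phi>_def by (rule cext)
  have \<phi>2: "\<phi> \<nu> (schur \<mu>) = (if \<nu> = \<mu> then 1 else 0)" if "is_partition \<mu>" for \<nu> \<mu>
    unfolding \<phi>_def by (rule cext2[OF that])
  have \<beta>: "functional_sym (\<beta> g)" for g
    unfolding \<beta>_def by (rule cext)
  have \<beta>2: "\<beta> g (schur \<mu>) = \<phi> \<mu> g" if "is_partition \<mu>" for g \<mu>
    unfolding \<beta>_def by (rule cext2[OF that])
  note lin = linear_sym_simps(2,3)[OF \<phi>] linear_sym_simps(2,3)[OF \<beta>]
  have \<beta>_add: "\<beta> (g + h) f = \<beta> g f + \<beta> h f" for g h f
  proof (rule linear_eq_on_basis[OF basis(2) \<beta>])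
    show "functional_sym (\<lambda>f. \<beta> g f + \<beta> h f)"
      by (rule linear_functionalI) (simp_all add: lin algebra_simps)
    show "\<beta> (g + h) (schur \<mu>) = \<beta> g (schur \<mu>) + \<beta> h (schur \<mu>)" if "\<mu> \<in> partitions" for \<mu>
      using that by (simp add: \<beta>2 lin)
  qed
  have \<beta>_scale: "\<beta> (scale_sym c g) f = c * \<beta> g f" for c g f
  proof (rule linear_eq_on_basis[OF basis(2) \<beta>])
    show "functional_sym (\<lambda>f. c * \<beta> g f)"
      by (rule linear_functionalI) (simp_all add: lin algebra_simps)
    show "\<beta> (scale_sym c g) (schur \<mu>) = c * \<beta> g (schur \<mu>)" if "\<mu> \<in> partitions" for \<mu>
      using that by (simp add: \<beta>2 lin)
  qed
  have "?P (\<lambda>f g. \<beta> g f)"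
  proof (intro conjI allI impI)
    show "functional_sym (\<lambda>f. \<beta> g f)" for g
      by (rule \<beta>)
    show "functional_sym (\<lambda>g. \<beta> g f)" for f
      by (rule linear_functionalI) (simp_all add: \<beta>_add \<beta>_scale)
    show "\<beta> (schur \<mu>) (schur \<nu>) = (if \<nu> = \<mu> then 1 else 0)" if "is_partition \<nu>" "is_partition \<mu>" for \<nu> \<mu>
      using that by (simp add: \<beta>2 \<phi>2)
  qed
  moreover have "\<gamma> = (\<lambda>f g. \<beta> g f)" if \<gamma>: "?P \<gamma>" for \<gamma>
  proof (intro ext)
    fix f g
    have \<gamma>1: "functional_sym (\<lambda>f. \<gamma> f g)" for g
      by (rule \<gamma>[THEN conjunct1, THEN spec])
    have \<gamma>2: "functional_sym (\<gamma> f)" for f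
      by (rule \<gamma>[THEN conjunct2, THEN conjunct1, THEN spec])
    have \<gamma>3: "\<gamma> (schur \<nu>) (schur \<mu>) = (if \<nu> = \<mu> then 1 else 0)" if "is_partition \<nu>" "is_partition \<mu>" for \<nu> \<mu>
      by (rule \<gamma>[THEN conjunct2, THEN conjunct2, rule_format, OF that])
    have 1: "\<gamma> f (schur \<mu>) = \<beta> (schur \<mu>) f" if "is_partition \<mu>" for \<mu> f
    proof (rule linear_eq_on_basis[OF basis(2) _ \<beta>])
      show "functional_sym (\<lambda>f. \<gamma> f (schur \<mu>))" by (rule \<gamma>1)
      fix \<nu> assume "\<nu> \<in> partitions"
      then show "\<gamma> (schur \<nu>) (schur \<mu>) = \<beta> (schur \<mu>) (schur \<nu>)"
        using that by (simp add: \<beta>2 \<phi>2 \<gamma>3)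
    qed
    have "functional_sym (\<lambda>g. \<beta> g f)"
      by (rule linear_functionalI) (simp_all add: \<beta>_add \<beta>_scale)
    from linear_eq_on_basis[OF basis(2) \<gamma>2[of f] this] 1
    show "\<gamma> f g = \<beta> g f" by simp
  qed
  ultimately have hall: "hall = (\<lambda>f g. \<beta> g f)"
    unfolding hall_def by (rule the_equality[of ?P])
  show ?thesis unfolding hall by (rule \<beta>)
qed

section \<open>Products of elementary symmetric functions\<close>

lemma sum_count_le_size: "finite S \<Longrightarrow> (\<Sum>i\<in>S. count M i) \<le> size M"
proof (induction M)
  case (add x M)
  have "(\<Sum>i\<in>S. count (add_mset x M) i) = (\<Sum>i\<in>S. count M i) + (\<Sum>i\<in>S. if i = x then 1 else 0)"
    by (simp only: sum.distrib[symmetric]) (rule sum.cong, auto)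
  also have "\<dots> \<le> size M + 1" using add by (intro add_mono) auto
  finally show ?case by simp
qed simp

text \<open>A factor e_r distributes r different variables, at most \<open>min r k\<close> of them
  among the first k.\<close>

lemma coeff_seq_part_elem:
  assumes "coeff_sym (e_part l :: 'a::comm_ring_1 sym) M \<noteq> 0"
  shows "size M = sum_list l" "(\<Sum>i<k. count M i) \<le> (\<Sum>r\<leftarrow>l. min r k)"
proof -
  have "size M = sum_list l \<and> (\<Sum>i<k. count M i) \<le> (\<Sum>r\<leftarrow>l. min r k)"
    using assms
  proof (induction l arbitrary: M)
    case Nil
    then show ?case by (auto simp: one_sym.rep_eq split: if_splits)
  next
    case (Cons r l)
    then have "(\<Sum>(A, B)\<in>splits M. coeff_sym (elem_sym r :: 'a sym) A * coeff_sym (e_part l) B) \<noteq> 0"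
      by (simp add: times_sym.rep_eq)
    then obtain A B where AB: "(A, B) \<in> splits M"
        "coeff_sym (elem_sym r :: 'a sym) A * coeff_sym (e_part l) B \<noteq> 0"
      by (auto elim!: sum.not_neutral_contains_not_neutral)
    have A: "size A = r" "\<And>i. count A i \<le> 1"
      using AB(2) by (auto simp: elem_sym.rep_eq split: if_splits)
    have "coeff_sym (e_part l :: 'a sym) B \<noteq> 0" using AB(2) by auto
    then have B: "size B = sum_list l" "(\<Sum>i<k. count B i) \<le> (\<Sum>r\<leftarrow>l. min r k)"
      using Cons.IH[of B] by simp_all
    have "(\<Sum>i<k. count A i) \<le> (\<Sum>i<k. 1)" using A(2) by (intro sum_mono) auto
    then have "(\<Sum>i<k. count A i) \<le> min r k"
      using sum_count_le_size[of "{..<k}" A] A(1) by simp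
    then have "(\<Sum>i<k. count A i) + (\<Sum>i<k. count B i) \<le> min r k + (\<Sum>r\<leftarrow>l. min r k)"
      using B(2) by (rule add_mono)
    moreover have "M = A + B" using AB(1) by (simp add: splits_def)
    ultimately show ?case using A(1) B(1) by (simp add: sum.distrib)
  qed
  then show "size M = sum_list l" "(\<Sum>i<k. count M i) \<le> (\<Sum>r\<leftarrow>l. min r k)" by simp_all
qed

section \<open>Conjugate partitions and the reversal of dominance\<close>

lemma sum_count_exponent: "(\<Sum>i<k. count (exponent l) i) = sum_list (take k l)"
proof -
  have "(\<Sum>i<k. count (exponent l) i) = (\<Sum>i<min (length l) k. l ! i)"
    by (rule sum.mono_neutral_cong_right) (auto simp: count_exponent)
  then show ?thesis by (simp add: sum_list_sum_nth atLeast0LessThan)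
qed

text \<open>Each of the first j entries is at most k plus its excess over k.\<close>

lemma sum_take_le_excess: "sum_list (take j xs) \<le> (\<Sum>r\<leftarrow>xs. r - k) + j * (k :: nat)"
proof (induction xs arbitrary: j)
  case (Cons x xs)
  show ?case
  proof (cases j)
    case (Suc i)
    then show ?thesis using Cons.IH[of i] by simp
  qed simp
qed simp

text \<open>The bound on prefix sums is attained when j is the number of entries larger than
  k.\<close>

lemma sum_take_eq_excess:
  assumes "sorted_wrt (\<ge>) xs"
  shows "\<exists>j. sum_list (take j xs) = (\<Sum>r\<leftarrow>xs. r - k) + j * (k :: nat)"
  using assms
proof (induction xs)
  case (Cons x xs)
  show ?case
  proof (cases "k < x")
    case True
    obtain j where "sum_list (take j xs) = (\<Sum>r\<leftarrow>xs. r - k) + j * k" using Cons by auto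
    then show ?thesis using True by (intro exI[of _ "Suc j"]) simp
  next
    case False
    then have "(\<Sum>r\<leftarrow>x # xs. r - k) = 0" using Cons.prems by force
    then show ?thesis by (intro exI[of _ 0]) simp
  qed
qed simp

lemma sum_min_excess: "(\<Sum>r\<leftarrow>xs. min r k) + (\<Sum>r\<leftarrow>xs. r - k) = sum_list (xs :: nat list)"
  by (induction xs) auto

text \<open>The sum of the \<open>min r k\<close> counts the cells in the first k columns, a prefix
  sum of the conjugate, so this is the reversal of dominance under conjugation. It follows by
  comparing prefix sums at the j where \<kappa> attains its excess bound.\<close>

lemma dominates_sum_min:
  assumes "dominates \<nu> \<kappa>" "sorted_wrt (\<ge>) \<kappa>"
  shows "(\<Sum>r\<leftarrow>\<nu>. min r k) \<le> (\<Sum>r\<leftarrow>\<kappa>. min r k)"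
proof -
  obtain j where j: "sum_list (take j \<kappa>) = (\<Sum>r\<leftarrow>\<kappa>. r - k) + j * k"
    using sum_take_eq_excess[OF assms(2)] by blast
  have "sum_list (take j \<kappa>) \<le> sum_list (take j \<nu>)" "sum_list \<nu> = sum_list \<kappa>"
    using assms(1) by (simp_all add: dominates_def)
  then show ?thesis
    using j sum_take_le_excess[of j \<nu> k] sum_min_excess[of k \<nu>] sum_min_excess[of k \<kappa>] by linarith
qed

lemma sum_length_filter: "(\<Sum>j<m. length (filter (\<lambda>r. j < r) xs)) = (\<Sum>r\<leftarrow>xs. min r (m :: nat))"
proof (induction xs)
  case (Cons x xs)
  have "(\<Sum>j<m. length (filter (\<lambda>r. j < r) (x # xs))) =
      (\<Sum>j<m. length (filter (\<lambda>r. j < r) xs)) + (\<Sum>j<m. if j < x then 1 else 0)"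
    by (simp only: sum.distrib[symmetric]) (rule sum.cong, auto)
  also have "(\<Sum>j<m. if j < x then 1 else 0) = card ({..<m} \<inter> {j. j < x})"
    by (simp add: sum.If_cases)
  also have "{..<m} \<inter> {j. j < x} = {..<min x m}" by auto
  finally show ?case using Cons by simp
qed simp

lemma length_filter_take:
  fixes xs :: "nat list"
  assumes "sorted_wrt (\<ge>) xs"
  shows "length (filter (\<lambda>r. j < r) (take k xs)) = min (length (filter (\<lambda>r. j < r) xs)) (k :: nat)"
  using assms
proof (induction xs arbitrary: k)
  case (Cons x xs)
  show ?case
  proof (cases "j < x")
    case True
    then show ?thesis using Cons by (cases k) auto
  next
    case False
    have "\<not> j < y" if "y \<in> set (x # xs)" for y
    proof -
      have "y \<le> x" using that Cons.prems by auto
      then show ?thesis using False by simp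
    qed
    then have "filter (\<lambda>r. j < r) xs' = []" if "set xs' \<subseteq> set (x # xs)" for xs'
      using that by (auto simp: filter_empty_conv)
    from this[of "x # xs"] this[of "take k (x # xs)"] show ?thesis
      using set_take_subset[of k "x # xs"] by simp
  qed
qed simp

lemma le_foldr_max: "x \<in> set \<mu> \<Longrightarrow> x \<le> foldr max \<mu> (0 :: nat)"
  by (induction \<mu>) auto

lemma sorted_conj_part: "sorted_wrt (\<ge>) (conj_part \<mu>)"
proof -
  have "length (filter (\<lambda>r. j < r) \<mu>) \<le> length (filter (\<lambda>r. i < r) \<mu>)" if "i < j" for i j
    using that by (induction \<mu>) auto
  then show ?thesis
    unfolding conj_part_def sorted_wrt_map
    by (intro sorted_wrt_mono_rel[OF _ sorted_wrt_upt]) auto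
qed

text \<open>Both sides count the cells in the first k rows of \<mu>, on the left by columns: a
  column meets these rows in the minimum of its height and k cells.\<close>

lemma sum_min_conj_part:
  assumes "is_partition \<mu>"
  shows "(\<Sum>r\<leftarrow>conj_part \<mu>. min r k) = sum_list (take k \<mu>)"
proof -
  let ?m = "foldr max \<mu> 0"
  have s: "sorted_wrt (\<ge>) \<mu>" using assms by (simp add: is_partition_def)
  have "(\<Sum>r\<leftarrow>conj_part \<mu>. min r k) = (\<Sum>j<?m. min (length (filter (\<lambda>r. j < r) \<mu>)) k)"
    by (simp add: conj_part_def interv_sum_list_conv_sum_set_nat atLeast0LessThan comp_def)
  also have "\<dots> = (\<Sum>j<?m. length (filter (\<lambda>r. j < r) (take k \<mu>)))"
    by (simp add: length_filter_take[OF s])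
  also have "\<dots> = (\<Sum>r\<leftarrow>take k \<mu>. min r ?m)" by (rule sum_length_filter)
  also have "\<dots> = (\<Sum>r\<leftarrow>take k \<mu>. r)"
    using le_foldr_max[of _ \<mu>] by (intro arg_cong[of _ _ sum_list] map_cong) (auto dest: in_set_takeD)
  finally show ?thesis by simp
qed

lemma sum_conj_part:
  assumes "is_partition \<mu>"
  shows "sum_list (conj_part \<mu>) = sum_list \<mu>"
proof -
  let ?k = "length \<mu>"
  have "min r ?k = r" if "r \<in> set (conj_part \<mu>)" for r
    using that by (auto simp: conj_part_def)
  then have "sum_list (conj_part \<mu>) = (\<Sum>r\<leftarrow>conj_part \<mu>. min r ?k)"
    by (simp cong: map_cong)
  then show ?thesis using sum_min_conj_part[OF assms, of ?k] by simp
qed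

text \<open>Three bounds combine: the degree of e_\<kappa> in the first k variables, the reversal of
  dominance, and the conjugation back to \<mu>.\<close>

lemma coeff_elem_dominates:
  assumes \<mu>: "is_partition \<mu>" and \<kappa>: "dominates \<kappa> (conj_part \<mu>)"
    and nz: "coeff_sym (e_part \<kappa> :: 'a::comm_ring_1 sym) (exponent \<nu>) \<noteq> 0"
  shows "dominates \<mu> \<nu>"
  unfolding dominates_def
proof (intro conjI allI)
  show "sum_list \<mu> = sum_list \<nu>"
    using coeff_seq_part_elem(1)[OF nz] \<kappa> sum_conj_part[OF \<mu>] by (simp add: dominates_def size_exponent)
  fix k
  have "sum_list (take k \<nu>) \<le> (\<Sum>r\<leftarrow>\<kappa>. min r k)"
    using coeff_seq_part_elem(2)[OF nz, of k] by (simp add: sum_count_exponent)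
  also have "\<dots> \<le> (\<Sum>r\<leftarrow>conj_part \<mu>. min r k)"
    by (rule dominates_sum_min[OF \<kappa> sorted_conj_part])
  also have "\<dots> = sum_list (take k \<mu>)" by (rule sum_min_conj_part[OF \<mu>])
  finally show "sum_list (take k \<nu>) \<le> sum_list (take k \<mu>)" .
qed

lemma complete_elem_intersection:
  fixes F :: "'a::linordered_field sym"
  assumes \<mu>: "is_partition \<mu>"
    and U: "F \<in> sym.span (h_part ` strictly_above \<mu>)"
    and W: "F \<in> sym.span (e_part ` above (conj_part \<mu>))"
  shows "F = 0"
proof -
  obtain A a where A: "finite A" "A \<subseteq> strictly_above \<mu>" "F = (\<Sum>\<nu>\<in>A. scale_sym (a \<nu>) (h_part \<nu>))"
    using U unfolding span_image_iff by blast
  obtain B b where B: "finite B" "B \<subseteq> above (conj_part \<mu>)" "F = (\<Sum>\<nu>\<in>B. scale_sym (b \<nu>) (e_part \<nu>))"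
    using W unfolding span_image_iff by blast
  have part: "is_partition \<nu>" "dominates \<nu> \<mu>" "\<nu> \<noteq> \<mu>" if "\<nu> \<in> A" for \<nu>
    using A(2) that by (auto simp: strictly_above_def above_def)
  have "coeff_sym F (exponent \<nu>) = 0" if "\<nu> \<in> A" for \<nu>
  proof -
    have "coeff_sym (e_part \<kappa> :: 'a sym) (exponent \<nu>) = 0" if "\<kappa> \<in> B" for \<kappa>
    proof (rule ccontr)
      assume "\<not> ?thesis"
      then have "dominates \<mu> \<nu>"
        using B(2) that by (intro coeff_elem_dominates[OF \<mu>]) (auto simp: above_def)
      \<comment> \<open>\<nu> lies strictly above \<mu>, so it cannot lie below \<mu> as
        well.\<close>
      then show False using dominates_antisym[OF \<mu>] part[OF \<open>\<nu> \<in> A\<close>] by blast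
    qed
    then show ?thesis by (simp add: B(3))
  qed
  then have "a \<nu> = 0" if "\<nu> \<in> A" for \<nu>
    using complete_orthogonal_imp_zero[OF A(1) _ A(3) _ that] part by blast
  then show ?thesis by (simp add: A(3))
qed

section \<open>Hooks\<close>

lemma span_mult_image:
  assumes "x \<in> sym.span B"
  shows "c * x \<in> sym.span ((*) c ` B)"
  using assms
proof (induction rule: sym.span_induct_alt)
  case base
  then show ?case by (simp add: sym.span_zero)
next
  case (step d y z)
  then show ?case by (simp add: distrib_left sym.span_add sym.span_scale sym.span_base)
qed

text \<open>The alternating relation, solved for a_n, expresses it through the products of b_r and
  a_(n-r) with r at least 1. The sequences are abstract because e and h both take the role of
  \<open>a\<close>.\<close>

lemma alternating_in_span:
  fixes a b :: "nat \<Rightarrow> 'a::field sym"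
  assumes "a 0 = 1"
    and alt: "\<And>n. n \<ge> 1 \<Longrightarrow> (\<Sum>r\<le>n. scale_sym ((-1) ^ r) (a (n - r) * b r)) = 0" and "b 0 = 1"
  shows "a n \<in> sym.span {seq_part b l |l. sum_list l = n}"
proof (induction n rule: less_induct)
  case (less n)
  let ?S = "sym.span {seq_part b l |l. sum_list l = n}"
  show ?case
  proof (cases "n = 0")
    case True
    have "seq_part b [] \<in> ?S" using True by (intro sym.span_base CollectI exI[of _ "[]"]) simp
    then show ?thesis using True assms(1) by simp
  next
    case False
    have "{..n} = insert 0 {1..n}" by auto
    then have a: "a n = - (\<Sum>r=1..n. scale_sym ((-1) ^ r) (b r * a (n - r)))"
      using alt[of n] False \<open>b 0 = 1\<close> by (simp add: mult.commute add_eq_0_iff)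
    have "b r * a (n - r) \<in> ?S" if "r \<in> {1..n}" for r
    proof -
      have "b r * a (n - r) \<in> sym.span ((*) (b r) ` {seq_part b l |l. sum_list l = n - r})"
        using that by (intro span_mult_image less) auto
      moreover have "(*) (b r) ` {seq_part b l |l. sum_list l = n - r} \<subseteq> {seq_part b l |l. sum_list l = n}"
      proof
        fix x assume "x \<in> (*) (b r) ` {seq_part b l |l. sum_list l = n - r}"
        then obtain l where "x = seq_part b (r # l)" "sum_list l = n - r" by auto
        then show "x \<in> {seq_part b l |l. sum_list l = n}"
          using that by (intro CollectI exI[of _ "r # l"]) simp
      qed
      ultimately show ?thesis using sym.span_mono by blast
    qed
    then show ?thesis unfolding a by (intro sym.span_neg sym.span_sum sym.span_scale)
  qed
qed

lemma elem_in_span_complete: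
  "(elem_sym n :: 'a::field_char_0 sym) \<in> sym.span {h_part l |l. sum_list l = n}"
  by (rule alternating_in_span) (simp_all add: elem_complete_alternating)

lemma complete_in_span_elem:
  "(complete_sym n :: 'a::field_char_0 sym) \<in> sym.span {e_part l |l. sum_list l = n}"
proof (rule alternating_in_span)
  fix n :: nat assume "n \<ge> 1"
  \<comment> \<open>Reversing the order of summation exchanges e and h up to the global sign
    (-1)^n.\<close>
  have "(\<Sum>r\<le>n. scale_sym ((-1) ^ r) (complete_sym (n - r) * elem_sym r)) =
      (\<Sum>r\<le>n. scale_sym ((-1) ^ (n - r)) (complete_sym r * elem_sym (n - r) :: 'a sym))"
    by (rule sum.reindex_bij_witness[of _ "\<lambda>r. n - r" "\<lambda>r. n - r"]) auto
  also have "\<dots> = (\<Sum>r\<le>n. scale_sym ((-1) ^ n * (-1) ^ r) (elem_sym (n - r) * complete_sym r))"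
  proof (rule sum.cong[OF refl])
    fix r assume "r \<in> {..n}"
    then have "(-1) ^ (n - r) = ((-1) ^ n * (-1) ^ r :: 'a)"
      by (simp flip: power_add) (simp add: uminus_power_if)
    then show "scale_sym ((-1) ^ (n - r)) (complete_sym r * elem_sym (n - r) :: 'a sym) =
        scale_sym ((-1) ^ n * (-1) ^ r) (elem_sym (n - r) * complete_sym r)"
      by (simp add: mult.commute)
  qed
  also have "\<dots> = scale_sym ((-1) ^ n) (\<Sum>r\<le>n. scale_sym ((-1) ^ r) (elem_sym (n - r) * complete_sym r))"
    by (simp only: scale_sym_sum scale_sym_scale_sym)
  finally show "(\<Sum>r\<le>n. scale_sym ((-1) ^ r) (complete_sym (n - r) * elem_sym r)) = (0 :: 'a sym)"
    using elem_complete_alternating[OF \<open>n \<ge> 1\<close>, where 'a = 'a] by simp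
qed simp_all

definition hook :: "nat \<Rightarrow> nat \<Rightarrow> nat list" where
  "hook n b = Suc b # replicate (n - Suc b) 1"

lemma is_partition_hook: "is_partition (hook n b)"
proof -
  have "sorted_wrt (\<ge>) (replicate k (1 :: nat))" for k by (induction k) auto
  then show ?thesis by (auto simp: is_partition_def hook_def)
qed

lemma conj_part_hook:
  assumes "b < n"
  shows "conj_part (hook n b) = hook n (n - Suc b)"
proof -
  have "foldr max (replicate k 1) 0 = (if k = 0 then 0 else 1 :: nat)" for k
    by (induction k) auto
  then have max: "foldr max (hook n b) 0 = Suc b"
    by (simp add: hook_def del: foldr_replicate One_nat_def)
  have "length (filter (\<lambda>r. Suc j < r) (hook n b)) = 1" if "j < b" for j
    using that by (simp add: hook_def)
  then have "map (\<lambda>j. length (filter (\<lambda>r. Suc j < r) (hook n b))) [0..<b] = map (\<lambda>_. 1) [0..<b]"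
    by (intro map_cong) auto
  moreover have "conj_part (hook n b) =
      map (\<lambda>j. length (filter (\<lambda>r. j < r) (hook n b))) (0 # map Suc [0..<b])"
    unfolding conj_part_def max map_Suc_upt by (simp only: upt_conv_Cons zero_less_Suc)
  ultimately have "conj_part (hook n b) = length (filter (\<lambda>r. 0 < r) (hook n b)) # replicate b 1"
    by (simp add: comp_def map_replicate_const)
  also have "\<dots> = hook n (n - Suc b)"
    using assms by (simp add: hook_def Suc_diff_Suc)
  finally show ?thesis .
qed

lemma min_sum_le_sum_take: "0 \<notin> set xs \<Longrightarrow> min (sum_list xs) i \<le> sum_list (take i xs :: nat list)"
proof (induction xs arbitrary: i)
  case (Cons x xs)
  show ?case
  proof (cases i)
    case (Suc j)
    then show ?thesis using Cons.prems Cons.IH[of j] by (simp add: min_def split: if_splits)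
  qed simp
qed simp

text \<open>The first part of \<kappa> exceeds b. After its own first part the hook's prefix sums
  grow by one per row, the slowest growth for positive parts until the total is reached.\<close>

lemma above_hook:
  assumes "is_partition \<kappa>" "sum_list \<kappa> = n" "r \<in> set \<kappa>" "b < r"
  shows "\<kappa> \<in> above (hook n b)"
proof -
  obtain x xs where \<kappa>: "\<kappa> = x # xs" using assms(3) by (cases \<kappa>) auto
  have x: "b < x" using assms(1,3,4) \<kappa> by (force simp: is_partition_def)
  have n: "n = x + sum_list xs" using assms(2) \<kappa> by simp
  have "dominates \<kappa> (hook n b)"
    unfolding dominates_def
  proof (intro conjI allI)
    show "sum_list \<kappa> = sum_list (hook n b)"
      using n x by (simp add: \<kappa> hook_def sum_list_replicate)
    fix i
    show "sum_list (take i (hook n b)) \<le> sum_list (take i \<kappa>)"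
    proof (cases i)
      case (Suc j)
      have "0 \<notin> set xs" using assms(1) \<kappa> by (simp add: is_partition_def)
      then show ?thesis
        using min_sum_le_sum_take[of xs j] n x Suc by (simp add: \<kappa> hook_def sum_list_replicate)
    qed simp
  qed
  then show ?thesis using assms(1) by (simp add: above_def)
qed

text \<open>The factor \<open>a r\<close> contributes a part larger than b to every product, which
  is enough to be above the hook.\<close>

lemma seq_part_mult_in_hook_span:
  fixes a :: "nat \<Rightarrow> 'a::field sym"
  assumes "a 0 = 1" and x: "x \<in> sym.span {seq_part a l |l. sum_list l = n - r}" and "b < r" "r \<le> n"
  shows "a r * x \<in> sym.span (seq_part a ` above (hook n b))"
proof -
  have "(*) (a r) ` {seq_part a l |l. sum_list l = n - r} \<subseteq> seq_part a ` above (hook n b)"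
  proof
    fix y assume "y \<in> (*) (a r) ` {seq_part a l |l. sum_list l = n - r}"
    then obtain l where l: "y = seq_part a (r # l)" "sum_list l = n - r" by auto
    have "part_of (mset (r # l)) \<in> above (hook n b)"
    proof (rule above_hook[OF is_partition_part_of _ _ \<open>b < r\<close>])
      show "sum_list (part_of (mset (r # l))) = n"
        using l(2) \<open>r \<le> n\<close> unfolding sum_list_part_of sum_mset_sum_list by simp
      show "r \<in> set (part_of (mset (r # l)))"
        using \<open>b < r\<close> by (simp add: set_part_of)
    qed
    then show "y \<in> seq_part a ` above (hook n b)"
      unfolding l(1) seq_part_part_of[of a, OF assms(1), of "r # l", symmetric] by (rule imageI)
  qed
  then show ?thesis using span_mult_image[OF x, of "a r"] sym.span_mono by blast
qed

text \<open>Up to sign, \<open>hook_sym n b\<close> is the Schur function of the hook $(b+1, 1^{n-b-1})$.\<close>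

definition hook_sym :: "nat \<Rightarrow> nat \<Rightarrow> 'a::comm_ring_1 sym" where
  "hook_sym n b = (\<Sum>r\<le>b. scale_sym ((-1) ^ r) (elem_sym (n - r) * complete_sym r))"

text \<open>The full alternating sum vanishes, so \<open>hook_sym n b\<close> is minus its tail, and
  every term of the tail has a factor h_r with r > b.\<close>

lemma hook_sym_complete:
  assumes "b < n"
  shows "hook_sym n b \<in> sym.span (h_part ` above (hook n b) :: 'a::field_char_0 sym set)"
proof -
  let ?t = "\<lambda>r. scale_sym ((-1) ^ r) (elem_sym (n - r) * complete_sym r) :: 'a sym"
  have "{..n} = {..b} \<union> {Suc b..n}" using assms by auto
  then have "(\<Sum>r\<le>n. ?t r) = hook_sym n b + (\<Sum>r=Suc b..n. ?t r)"
    by (simp only: hook_sym_def) (rule sum.union_disjoint, auto)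
  then have hook: "hook_sym n b = - (\<Sum>r=Suc b..n. ?t r)"
    using elem_complete_alternating[of n, where 'a = 'a] assms by (simp add: add_eq_0_iff2)
  have "elem_sym (n - r) * complete_sym r \<in> sym.span (h_part ` above (hook n b) :: 'a sym set)"
    if "r \<in> {Suc b..n}" for r
    using seq_part_mult_in_hook_span[of complete_sym "elem_sym (n - r)" n r b]
      elem_in_span_complete[of "n - r", where 'a = 'a] that by (simp add: mult.commute)
  then show ?thesis unfolding hook by (intro sym.span_neg sym.span_sum sym.span_scale)
qed

text \<open>Every term of the partial sum itself has a factor e_(n-r) with n - r \<ge> n - b, which
  exceeds the arm n - 1 - b of the conjugate hook.\<close>

lemma hook_sym_elem:
  assumes "b < n"
  shows "hook_sym n b \<in> sym.span (e_part ` above (conj_part (hook n b)) :: 'a::field_char_0 sym set)"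
proof -
  have "elem_sym (n - r) * complete_sym r \<in> sym.span (e_part ` above (hook n (n - Suc b)) :: 'a sym set)"
    if "r \<le> b" for r
  proof (rule seq_part_mult_in_hook_span)
    show "(complete_sym r :: 'a sym) \<in> sym.span {e_part l |l. sum_list l = n - (n - r)}"
      using complete_in_span_elem[of r, where 'a = 'a] that assms by simp
  qed (use that assms in auto)
  then show ?thesis
    unfolding hook_sym_def conj_part_hook[OF assms]
    by (intro sym.span_sum sym.span_scale) simp
qed

text \<open>\<open>super_elem u n\<close> is $e_n[X(1-u)]$.\<close>

definition super_elem :: "'a::comm_ring_1 \<Rightarrow> nat \<Rightarrow> 'a sym" where
  "super_elem u n = (\<Sum>r\<le>n. elem_sym (n - r) * scale_sym ((- u) ^ r) (complete_sym r))"

text \<open>The generating series is E(z) H(-uz). Its scalars are those of e multiplied by 1 - u^s,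
  as the alphabet X(1-u) demands.\<close>

lemma newton_super_elem: "newton_seq (\<lambda>s. (-1) ^ (s - 1) * (1 - u ^ s)) (super_elem u)"
proof -
  have "newton_seq (\<lambda>s. (-1) ^ (s - 1) + (- u) ^ s * 1) (super_elem u)"
    unfolding super_elem_def by (intro newton_seq_mult newton_elem newton_seq_twist newton_complete)
  then show ?thesis
  proof (rule newton_seq_cong)
    fix s :: nat assume "s \<ge> 1"
    then show "(-1) ^ (s - 1) + (- u) ^ s * 1 = (-1) ^ (s - 1) * (1 - u ^ s)"
      by (cases s) (simp_all add: power_minus[of u] algebra_simps)
  qed
qed

text \<open>Summation by parts with \<open>hook_sym\<close> as partial sums. The boundary term is
  u^n times the full alternating sum, which vanishes.\<close>

lemma super_elem_hooks:
  assumes "n \<ge> 1"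
  shows "super_elem u n = scale_sym (1 - u) (\<Sum>b<n. scale_sym (u ^ b) (hook_sym n b :: 'a::field_char_0 sym))"
proof -
  let ?x = "\<lambda>r. elem_sym (n - r) * complete_sym r :: 'a sym"
  have "(\<Sum>r\<le>m. scale_sym ((- u) ^ r) (?x r)) =
      scale_sym (1 - u) (\<Sum>b<m. scale_sym (u ^ b) (hook_sym n b)) + scale_sym (u ^ m) (hook_sym n m)" for m
  proof (induction m)
    case 0
    then show ?case by (simp add: hook_sym_def)
  next
    case (Suc m)
    have "hook_sym n (Suc m) = hook_sym n m + scale_sym ((-1) ^ Suc m) (?x (Suc m))"
      by (simp add: hook_sym_def)
    moreover have "(- u) ^ Suc m = u ^ Suc m * (-1) ^ Suc m"
      by (metis mult.commute power_minus)
    ultimately show ?case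
      using Suc by (simp add: scale_sym_add scale_sym_scale_sym scale_sym_diff algebra_simps del: power_Suc)
        (simp add: scale_sym_diff scale_sym_scale_sym scale_sym_add algebra_simps)
  qed
  moreover have "hook_sym n n = (0 :: 'a sym)"
    using elem_complete_alternating[OF assms, where 'a = 'a] by (simp add: hook_sym_def)
  ultimately show ?thesis by (simp add: super_elem_def)
qed

section \<open>The specialization\<close>

lemma eval_qt_hom: "comm_ring_hom (eval_qt a b)"
proof -
  interpret c: comm_ring_hom "\<lambda>c. to_fract [:[:c:]:] :: qt"
    by unfold_locales (simp_all flip: to_fract_add to_fract_mult one_pCons)
  interpret mc: map_poly_comm_ring_hom "\<lambda>c. to_fract [:[:c:]:] :: qt" ..
  interpret d: comm_ring_hom "\<lambda>p. poly (map_poly (\<lambda>c. to_fract [:[:c:]:]) p) a"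
    by unfold_locales (simp_all add: mc.hom_add mc.hom_mult)
  interpret md: map_poly_comm_ring_hom "\<lambda>p. poly (map_poly (\<lambda>c. to_fract [:[:c:]:]) p) a" ..
  show ?thesis
    by unfold_locales (simp_all add: eval_qt_def md.hom_add md.hom_mult)
qed

interpretation eval_qt: comm_ring_hom "eval_qt a b" for a b
  by (rule eval_qt_hom)

lemma eval_qt_gens [simp]: "eval_qt a b [:[:0, 1:]:] = a" "eval_qt a b [:0, 1:] = b"
  by (simp_all add: eval_qt_def map_poly_pCons flip: one_pCons)

text \<open>The reduced denominator, which \<open>subst_qt\<close> reads, divides that of any other
  representation. So every representation whose denominator survives may be used.\<close>

lemma subst_qt_fraction:
  assumes "eval_qt a b Q \<noteq> 0" "x = to_fract P / to_fract Q"
  shows "subst_qt_defined a b x" "subst_qt a b x = eval_qt a b P / eval_qt a b Q"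
proof -
  define N D where "N = fst (quot_of_fract x)" and "D = snd (quot_of_fract x)"
  have D0: "D \<noteq> 0" by (simp add: D_def)
  have Q0: "Q \<noteq> 0" using assms(1) by auto
  have x: "x = to_fract N / to_fract D"
    by (simp add: N_def D_def flip: Fract_conv_to_fract)
  have "to_fract (N * Q) = to_fract (P * D)"
    using assms(2) x D0 Q0 by (simp add: field_simps)
  then have eq: "N * Q = P * D" by (simp only: to_fract_eq_iff)
  have "coprime N D" by (simp add: N_def D_def coprime_quot_of_fract)
  moreover have "D dvd N * Q" by (simp add: eq)
  ultimately have "D dvd Q" by (simp add: coprime_dvd_mult_right_iff coprime_commute)
  then obtain E where E: "Q = D * E" by blast
  then have ev: "eval_qt a b D \<noteq> 0" using assms(1) by (auto simp: eval_qt.hom_mult)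
  then show "subst_qt_defined a b x" by (simp add: subst_qt_defined_def D_def)
  have "eval_qt a b N * eval_qt a b Q = eval_qt a b P * eval_qt a b D"
    using arg_cong[OF eq, of "eval_qt a b"] by (simp add: eval_qt.hom_mult)
  then have "eval_qt a b N / eval_qt a b D = eval_qt a b P / eval_qt a b Q"
    using ev assms(1) by (simp add: frac_eq_eq)
  then show "subst_qt a b x = eval_qt a b P / eval_qt a b Q"
    by (simp add: subst_qt_def N_def D_def)
qed

lemma subst_qt_definedE:
  assumes "subst_qt_defined a b x"
  obtains P Q where "eval_qt a b Q \<noteq> 0" "x = to_fract P / to_fract Q"
    "subst_qt a b x = eval_qt a b P / eval_qt a b Q"
proof (rule that)
  show "eval_qt a b (snd (quot_of_fract x)) \<noteq> 0" using assms by (simp add: subst_qt_defined_def)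
  show "x = to_fract (fst (quot_of_fract x)) / to_fract (snd (quot_of_fract x))"
    by (simp flip: Fract_conv_to_fract)
qed (simp add: subst_qt_def)

lemma subst_qt_to_fract: "subst_qt_defined a b (to_fract P)" "subst_qt a b (to_fract P) = eval_qt a b P"
  using subst_qt_fraction[of a b 1 "to_fract P" P] by simp_all

lemma subst_qt_gens [simp]:
  "subst_qt_defined a b q" "subst_qt a b q = a" "subst_qt_defined a b t" "subst_qt a b t = b"
  by (simp_all add: q_def t_def subst_qt_to_fract)

lemma subst_qt_01 [simp]: "subst_qt_defined a b 0" "subst_qt_defined a b 1" "subst_qt a b 1 = 1"
  using subst_qt_to_fract[of a b 0] subst_qt_to_fract[of a b 1] by simp_all

lemma subst_qt_add:
  assumes "subst_qt_defined a b x" "subst_qt_defined a b y"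
  shows "subst_qt_defined a b (x + y)" "subst_qt a b (x + y) = subst_qt a b x + subst_qt a b y"
proof -
  obtain P Q where x: "eval_qt a b Q \<noteq> 0" "x = to_fract P / to_fract Q" "subst_qt a b x = eval_qt a b P / eval_qt a b Q"
    using assms(1) by (rule subst_qt_definedE)
  obtain R S where y: "eval_qt a b S \<noteq> 0" "y = to_fract R / to_fract S" "subst_qt a b y = eval_qt a b R / eval_qt a b S"
    using assms(2) by (rule subst_qt_definedE)
  have "Q \<noteq> 0" "S \<noteq> 0" using x(1) y(1) by auto
  then have "x + y = to_fract (P * S + R * Q) / to_fract (Q * S)"
    by (simp add: x(2) y(2) field_simps)
  moreover have "eval_qt a b (Q * S) \<noteq> 0" using x(1) y(1) by (simp add: eval_qt.hom_mult)
  ultimately have *: "subst_qt_defined a b (x + y)"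
      "subst_qt a b (x + y) = eval_qt a b (P * S + R * Q) / eval_qt a b (Q * S)"
    using subst_qt_fraction by blast+
  show "subst_qt_defined a b (x + y)" by (rule *(1))
  show "subst_qt a b (x + y) = subst_qt a b x + subst_qt a b y"
    unfolding *(2) x(3) y(3) eval_qt.hom_mult eval_qt.hom_add
    by (simp add: add_frac_eq x(1) y(1))
qed

lemma subst_qt_mult:
  assumes "subst_qt_defined a b x" "subst_qt_defined a b y"
  shows "subst_qt_defined a b (x * y)" "subst_qt a b (x * y) = subst_qt a b x * subst_qt a b y"
proof -
  obtain P Q where x: "eval_qt a b Q \<noteq> 0" "x = to_fract P / to_fract Q" "subst_qt a b x = eval_qt a b P / eval_qt a b Q"
    using assms(1) by (rule subst_qt_definedE)
  obtain R S where y: "eval_qt a b S \<noteq> 0" "y = to_fract R / to_fract S" "subst_qt a b y = eval_qt a b R / eval_qt a b S"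
    using assms(2) by (rule subst_qt_definedE)
  have "x * y = to_fract (P * R) / to_fract (Q * S)"
    by (simp add: x(2) y(2))
  moreover have "eval_qt a b (Q * S) \<noteq> 0" using x(1) y(1) by (simp add: eval_qt.hom_mult)
  ultimately have *: "subst_qt_defined a b (x * y)"
      "subst_qt a b (x * y) = eval_qt a b (P * R) / eval_qt a b (Q * S)"
    using subst_qt_fraction by blast+
  show "subst_qt_defined a b (x * y)" by (rule *(1))
  show "subst_qt a b (x * y) = subst_qt a b x * subst_qt a b y"
    using x(3) y(3) *(2) by (simp add: eval_qt.hom_mult)
qed

lemma subst_qt_inverse:
  assumes "subst_qt_defined a b x" "subst_qt a b x \<noteq> 0"
  shows "subst_qt_defined a b (1 / x)" "subst_qt a b (1 / x) = 1 / subst_qt a b x"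
proof -
  obtain P Q where x: "eval_qt a b Q \<noteq> 0" "x = to_fract P / to_fract Q" "subst_qt a b x = eval_qt a b P / eval_qt a b Q"
    using assms(1) by (rule subst_qt_definedE)
  have "1 / x = to_fract Q / to_fract P" by (simp add: x(2))
  moreover have "eval_qt a b P \<noteq> 0" using assms(2) x(3) by auto
  ultimately show "subst_qt_defined a b (1 / x)" "subst_qt a b (1 / x) = 1 / subst_qt a b x"
    using subst_qt_fraction[of a b P "1 / x" Q] x(3) by simp_all
qed

lemma subst_qt_minus:
  assumes "subst_qt_defined a b x"
  shows "subst_qt_defined a b (- x)" "subst_qt a b (- x) = - subst_qt a b x"
proof -
  have m: "subst_qt_defined a b (- 1)" "subst_qt a b (- 1) = - 1"
    using subst_qt_to_fract[of a b "- 1"] by (simp_all add: eval_qt.hom_uminus)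
  show "subst_qt_defined a b (- x)" "subst_qt a b (- x) = - subst_qt a b x"
    using subst_qt_mult[OF m(1) assms] m(2) by simp_all
qed

lemma subst_qt_diff:
  assumes "subst_qt_defined a b x" "subst_qt_defined a b y"
  shows "subst_qt_defined a b (x - y)" "subst_qt a b (x - y) = subst_qt a b x - subst_qt a b y"
  using subst_qt_add[OF assms(1) subst_qt_minus(1)[OF assms(2)]] subst_qt_minus(2)[OF assms(2)] by simp_all

lemma subst_qt_sum:
  assumes "\<And>i. i \<in> A \<Longrightarrow> subst_qt_defined a b (f i)"
  shows "subst_qt_defined a b (\<Sum>i\<in>A. f i)" "subst_qt a b (\<Sum>i\<in>A. f i) = (\<Sum>i\<in>A. subst_qt a b (f i))"
proof -
  have "subst_qt_defined a b (\<Sum>i\<in>A. f i) \<and> subst_qt a b (\<Sum>i\<in>A. f i) = (\<Sum>i\<in>A. subst_qt a b (f i))"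
    using assms by (induction A rule: infinite_finite_induct) (simp_all add: subst_qt_add)
  then show "subst_qt_defined a b (\<Sum>i\<in>A. f i)" "subst_qt a b (\<Sum>i\<in>A. f i) = (\<Sum>i\<in>A. subst_qt a b (f i))"
    by simp_all
qed

lemma subst_qt_power:
  assumes "subst_qt_defined a b x"
  shows "subst_qt_defined a b (x ^ n)" "subst_qt a b (x ^ n) = subst_qt a b x ^ n"
proof -
  have "subst_qt_defined a b (x ^ n) \<and> subst_qt a b (x ^ n) = subst_qt a b x ^ n"
    using assms by (induction n) (simp_all add: subst_qt_mult)
  then show "subst_qt_defined a b (x ^ n)" "subst_qt a b (x ^ n) = subst_qt a b x ^ n" by simp_all
qed

section \<open>The specialization t = 1/q and its valuation ring\<close>

lemma q_nonzero [simp]: "q \<noteq> 0"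
  by (simp add: q_def)

lemma one_minus_q_power_nonzero: "r \<ge> 1 \<Longrightarrow> 1 - q ^ r \<noteq> 0"
proof
  assume r: "r \<ge> 1" and "1 - q ^ r = 0"
  then have "1 = q ^ r" by simp
  \<comment> \<open>Evaluation at q = t = 0 separates 1 from q^r.\<close>
  moreover have "subst_qt 0 0 1 = 1" "subst_qt 0 0 (q ^ r) = 0"
    using r by (simp_all add: subst_qt_power)
  ultimately show False by (metis zero_neq_one)
qed

text \<open>On polynomials in q alone the evaluation is the inclusion, hence injective.\<close>

lemma eval_qt_q_const: "eval_qt q b [:c:] = to_fract [:c:]"
proof (induction c)
  case (pCons a c)
  have "eval_qt q b [:[:a:]:] = to_fract [:[:a:]:]"
    by (cases "a = 0") (simp_all add: eval_qt_def map_poly_pCons)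
  moreover have "[:pCons a c:] = [:[:a:]:] + [:[:0, 1:]:] * [:c:]" by simp
  ultimately show ?case
    using pCons by (simp add: eval_qt.hom_add eval_qt.hom_mult q_def del: mult_pCons_left mult_pCons_right add_pCons)
qed simp

text \<open>The kernel of $t \mapsto 1/q$ is generated by $qt - 1$, so the fractions with a specialization
  form a valuation ring.\<close>

lemma eval_qt_kernel:
  assumes "eval_qt q (1 / q) P = 0"
  shows "[:- 1, [:0, 1:]:] dvd P"
proof -
  let ?D = "[:- 1, [:0, 1:]:] :: rat poly poly" and ?Q = "[:[:0, 1:]:] :: rat poly poly" and ?T = "[:0, 1:] :: rat poly poly"
  have QT: "?Q * ?T = ?D + 1" by (simp add: one_pCons)
  \<comment> \<open>Modulo qt - 1 a power of q removes t: q^m P is congruent to a polynomial c in q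
    alone.\<close>
  have "\<exists>m c. ?D dvd ?Q ^ m * P - [:c:]" for P
  proof (induction P)
    case 0
    show ?case by (intro exI[of _ 0]) simp
  next
    case (pCons a P)
    then obtain m c where mc: "?D dvd ?Q ^ m * P - [:c:]" by blast
    have P: "pCons a P = [:a:] + ?T * P" by simp
    have Qa: "?Q ^ k * [:a:] = [:[:0, 1:] ^ k * a:]" for k
      by (simp add: poly_const_pow)
    have "?Q ^ Suc m * pCons a P - [:[:0, 1:] ^ Suc m * a + c:] = (?Q ^ m * P - [:c:]) + ?D * (?Q ^ m * P)"
    proof -
      have "?Q ^ Suc m * pCons a P = ?Q ^ Suc m * [:a:] + (?Q * ?T) * (?Q ^ m * P)"
        unfolding P by (simp only: distrib_left power_Suc mult_ac)
      also have "\<dots> = [:[:0, 1:] ^ Suc m * a:] + (?D * (?Q ^ m * P) + ?Q ^ m * P)"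
        unfolding QT Qa by (simp only: distrib_right mult_1)
      finally show ?thesis by simp
    qed
    then have "?D dvd ?Q ^ Suc m * pCons a P - [:[:0, 1:] ^ Suc m * a + c:]"
      using mc by (simp only: dvd_add dvd_triv_left)
    then show ?case by blast
  qed
  then obtain m c where mc: "?D dvd ?Q ^ m * P - [:c:]" by blast
  have D0: "eval_qt q (1 / q) ?D = 0"
  proof -
    have "eval_qt q (1 / q) (?Q * ?T) = 1" by (simp only: eval_qt.hom_mult eval_qt_gens) simp
    then show ?thesis unfolding QT by (simp add: eval_qt.hom_add)
  qed
  from mc obtain E where "?Q ^ m * P - [:c:] = ?D * E" by blast
  then have "eval_qt q (1 / q) (?Q ^ m * P - [:c:]) = 0"
    by (simp only: eval_qt.hom_mult D0 mult_zero_left)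
  \<comment> \<open>The evaluation kills P and leaves c unchanged, so c = 0.\<close>
  then have "to_fract [:c:] = 0"
    using assms by (simp add: eval_qt.hom_minus eval_qt.hom_mult eval_qt_q_const)
  then have "?D dvd ?Q ^ m * P" using mc by simp
  \<comment> \<open>Since (qt)^m is congruent to 1, multiplication by t^m undoes the factor
    q^m.\<close>
  moreover have "(?Q * ?T) ^ m * P = ?T ^ m * (?Q ^ m * P)"
    by (simp only: power_mult_distrib mult_ac)
  ultimately have 1: "?D dvd (?Q * ?T) ^ m * P"
    by (simp only: dvd_mult)
  have "?D dvd (?Q * ?T) ^ m - 1"
    unfolding QT
  proof (induction m)
    case (Suc m)
    have "(D + 1) ^ Suc m - 1 = D * (D + 1) ^ m + ((D + 1) ^ m - 1)" for D :: "rat poly poly"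
      by (simp add: distrib_right)
    then show ?case using Suc by (simp only: dvd_add dvd_triv_left)
  qed simp
  then have "?D dvd ((?Q * ?T) ^ m - 1) * P" by (rule dvd_mult2)
  with 1 have "?D dvd (?Q * ?T) ^ m * P - ((?Q * ?T) ^ m - 1) * P" by (rule dvd_diff)
  then show ?thesis by (simp only: left_diff_distrib diff_diff_eq2) simp
qed

abbreviation "regular x \<equiv> subst_qt_defined q (1 / q) x"

abbreviation "special x \<equiv> subst_qt q (1 / q) x"

text \<open>In lowest terms the numerator and the denominator cannot both be divisible by the
  non-unit qt - 1.\<close>

lemma not_regular_imp:
  assumes "\<not> regular x"
  shows "regular (1 / x)" "special (1 / x) = 0"
proof -
  define N D where "N = fst (quot_of_fract x)" and "D = snd (quot_of_fract x)"
  have D: "eval_qt q (1 / q) D = 0" using assms by (simp add: subst_qt_defined_def D_def)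
  have x: "1 / x = to_fract D / to_fract N"
  proof -
    have "x = to_fract N / to_fract D" by (simp add: N_def D_def flip: Fract_conv_to_fract)
    then show ?thesis by simp
  qed
  have "eval_qt q (1 / q) N \<noteq> 0"
  proof
    assume "eval_qt q (1 / q) N = 0"
    then have "[:- 1, [:0, 1:]:] dvd N" "[:- 1, [:0, 1:]:] dvd D" using D by (auto intro: eval_qt_kernel)
    moreover have "coprime N D" by (simp add: N_def D_def coprime_quot_of_fract)
    ultimately have "is_unit [:- 1 :: rat poly, [:0, 1:]:]" by (rule coprime_common_divisor[rotated])
    then show False using dvd_imp_degree_le[of "[:- 1 :: rat poly, [:0, 1:]:]" 1] by simp
  qed
  from subst_qt_fraction[OF this x] D
  show "regular (1 / x)" "special (1 / x) = 0" by simp_all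
qed

text \<open>Of two nonzero elements one divides the other up to a regular quotient; by induction
  some member of a finite family divides all of them.\<close>

lemma exists_minimal_valuation:
  assumes "finite A" "\<exists>i\<in>A. x i \<noteq> 0"
  shows "\<exists>i\<in>A. x i \<noteq> 0 \<and> (\<forall>j\<in>A. regular (x j / x i))"
  using assms
proof (induction A rule: finite_induct)
  case (insert k A)
  show ?case
  proof (cases "\<exists>i\<in>A. x i \<noteq> 0")
    case False
    then show ?thesis using insert.prems by auto
  next
    case True
    then obtain i where i: "i \<in> A" "x i \<noteq> 0" "\<forall>j\<in>A. regular (x j / x i)" using insert.IH by blast
    show ?thesis
    proof (cases "regular (x k / x i)")
      case True
      then show ?thesis using i by blast
    next
      case False
      then have k: "x k \<noteq> 0" by auto
      have ik: "regular (x i / x k)" using not_regular_imp(1)[OF False] by simp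
      have "regular (x j / x k)" if "j \<in> A" for j
      proof -
        have eq: "x j / x k = (x j / x i) * (x i / x k)" using i(2) by simp
        show ?thesis unfolding eq using i(3) ik that by (intro subst_qt_mult(1)) auto
      qed
      then show ?thesis using k by auto
    qed
  qed
qed simp

section \<open>Specialization of symmetric functions\<close>

lemma coeff_spec: "coeff_sym (spec f) M = special (coeff_sym f M)"
  by (simp add: spec.rep_eq)

lemma spec_definedD: "spec_defined f \<Longrightarrow> regular (coeff_sym f M)"
  by (simp add: spec_defined_def)

lemma spec_add:
  assumes "spec_defined f" "spec_defined g"
  shows "spec_defined (f + g)" "spec (f + g) = spec f + spec g"
  using assms subst_qt_add[OF spec_definedD spec_definedD]
  by (auto simp: spec_defined_def coeff_spec intro!: sym_eqI)

lemma spec_scale: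
  assumes "regular c" "spec_defined f"
  shows "spec_defined (scale_sym c f)" "spec (scale_sym c f) = scale_sym (special c) (spec f)"
  using assms subst_qt_mult[OF _ spec_definedD]
  by (auto simp: spec_defined_def coeff_spec intro!: sym_eqI)

lemma spec_0 [simp]: "spec_defined 0" "spec 0 = 0"
  by (auto simp: spec_defined_def coeff_spec intro!: sym_eqI)

lemma spec_sum:
  assumes "\<And>i. i \<in> A \<Longrightarrow> spec_defined (f i)"
  shows "spec_defined (\<Sum>i\<in>A. f i)" "spec (\<Sum>i\<in>A. f i) = (\<Sum>i\<in>A. spec (f i))"
proof -
  have "spec_defined (\<Sum>i\<in>A. f i) \<and> spec (\<Sum>i\<in>A. f i) = (\<Sum>i\<in>A. spec (f i))"
    using assms by (induction A rule: infinite_finite_induct) (simp_all add: spec_add)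
  then show "spec_defined (\<Sum>i\<in>A. f i)" "spec (\<Sum>i\<in>A. f i) = (\<Sum>i\<in>A. spec (f i))" by simp_all
qed

lemma spec_mult:
  assumes "spec_defined f" "spec_defined g"
  shows "spec_defined (f * g)" "spec (f * g) = spec f * spec g"
proof -
  have r: "regular (case x of (A, B) \<Rightarrow> coeff_sym f A * coeff_sym g B)"
      "special (case x of (A, B) \<Rightarrow> coeff_sym f A * coeff_sym g B) =
        (case x of (A, B) \<Rightarrow> special (coeff_sym f A) * special (coeff_sym g B))" for x
    using subst_qt_mult[OF spec_definedD[OF assms(1)] spec_definedD[OF assms(2)]] by (simp_all split: prod.split)
  show "spec_defined (f * g)"
    unfolding spec_defined_def times_sym.rep_eq by (intro allI subst_qt_sum(1) r)
  show "spec (f * g) = spec f * spec g"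
    by (rule sym_eqI) (simp add: coeff_spec times_sym.rep_eq subst_qt_sum(2)[OF r(1)] r(2))
qed

lemma spec_indicator:
  assumes "\<And>M. coeff_sym f M = 0 \<or> coeff_sym f M = 1"
  shows "spec_defined f" "spec f = f"
proof -
  have "regular (coeff_sym f M)" "special (coeff_sym f M) = coeff_sym f M" for M
    using assms[of M] by auto
  then show "spec_defined f" "spec f = f"
    by (auto simp: spec_defined_def coeff_spec intro: sym_eqI)
qed

lemma spec_generators:
  "spec_defined (power_sum r)" "spec (power_sum r) = power_sum r"
  "spec_defined (complete_sym r)" "spec (complete_sym r) = complete_sym r"
  "spec_defined (elem_sym r)" "spec (elem_sym r) = elem_sym r"
  "spec_defined 1" "spec 1 = 1"
  by (rule spec_indicator, simp add: power_sum.rep_eq complete_sym.rep_eq elem_sym.rep_eq one_sym.rep_eq)+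

lemma spec_seq_part:
  assumes "\<And>r. spec_defined (a r)" "\<And>r. spec (a r) = a r"
  shows "spec_defined (seq_part a l)" "spec (seq_part a l) = seq_part a l"
proof -
  have "spec_defined (seq_part a l) \<and> spec (seq_part a l) = seq_part a l"
    by (induction l) (auto simp: spec_generators spec_mult assms)
  then show "spec_defined (seq_part a l)" "spec (seq_part a l) = seq_part a l" by simp_all
qed

lemmas spec_complete = spec_seq_part[of complete_sym, OF spec_generators(3,4)]
lemmas spec_power_sum_part = spec_seq_part[of power_sum, OF spec_generators(1,2), unfolded seq_part_power_sum]

text \<open>If some coordinate had a pole, dividing by the worst one, c_i, would give a vector that
  specializes to 0 although its i-th coordinate is 1, against the independence after
  specialization.\<close>

lemma regular_coordinates:
  assumes "finite A" and b: "\<And>i. i \<in> A \<Longrightarrow> spec_defined (b i)"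
    and ind: "indep_family A (\<lambda>i. spec (b i))"
    and f: "spec_defined (\<Sum>i\<in>A. scale_sym (c i) (b i))"
    and "k \<in> A"
  shows "regular (c k)"
proof (cases "\<exists>i\<in>A. c i \<noteq> 0")
  case True
  then obtain i where i: "i \<in> A" "c i \<noteq> 0" "\<forall>j\<in>A. regular (c j / c i)"
    using exists_minimal_valuation[OF \<open>finite A\<close>] by blast
  show ?thesis
  proof (cases "regular (c i)")
    case True
    have "regular (c k / c i * c i)"
      by (rule subst_qt_mult(1)) (use i(3) \<open>k \<in> A\<close> True in auto)
    then show ?thesis using i(2) by simp
  next
    case False
    note ci = not_regular_imp[OF False]
    have *: "spec_defined (scale_sym (c j / c i) (b j)) \<and>
        spec (scale_sym (c j / c i) (b j)) = scale_sym (special (c j / c i)) (spec (b j))" if "j \<in> A" for j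
      using spec_scale[of "c j / c i" "b j"] i(3) b that by blast
    have "(\<Sum>j\<in>A. scale_sym (special (c j / c i)) (spec (b j))) = (\<Sum>j\<in>A. spec (scale_sym (c j / c i) (b j)))"
      using * by (intro sum.cong) auto
    also have "\<dots> = spec (\<Sum>j\<in>A. scale_sym (c j / c i) (b j))"
      using * by (intro spec_sum(2)[symmetric]) auto
    also have "(\<Sum>j\<in>A. scale_sym (c j / c i) (b j)) = scale_sym (1 / c i) (\<Sum>j\<in>A. scale_sym (c j) (b j))"
      by (simp add: scale_sym_sum scale_sym_scale_sym)
    also have "spec \<dots> = 0"
      using spec_scale(2)[OF ci(1) f] ci(2) by simp
    finally have "special (c i / c i) = 0"
      using indep_familyD[OF ind \<open>finite A\<close> order_refl, of "\<lambda>j. special (c j / c i)" i] i(1) by simp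
    then show ?thesis using i(2) by simp
  qed
qed (use \<open>k \<in> A\<close> in auto)

lemma spec_linear_combination:
  assumes "\<And>i. i \<in> A \<Longrightarrow> regular (c i)" "\<And>i. i \<in> A \<Longrightarrow> spec_defined (b i)"
  shows "spec_defined (\<Sum>i\<in>A. scale_sym (c i) (b i))"
    "spec (\<Sum>i\<in>A. scale_sym (c i) (b i)) = (\<Sum>i\<in>A. scale_sym (special (c i)) (spec (b i)))"
proof -
  have *: "spec_defined (scale_sym (c i) (b i))"
      "spec (scale_sym (c i) (b i)) = scale_sym (special (c i)) (spec (b i))" if "i \<in> A" for i
    using spec_scale[OF assms(1)[OF that] assms(2)[OF that]] by simp_all
  show "spec_defined (\<Sum>i\<in>A. scale_sym (c i) (b i))"
    using *(1) by (rule spec_sum(1))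
  show "spec (\<Sum>i\<in>A. scale_sym (c i) (b i)) = (\<Sum>i\<in>A. scale_sym (special (c i)) (spec (b i)))"
    using * by (subst spec_sum(2)) (auto intro!: sum.cong)
qed

text \<open>Dividing by the power sum coordinate of smallest valuation makes all coordinates regular
  and one of them 1; the p_\<rho> are fixed by the specialization and independent.\<close>

lemma exists_primitive_multiple:
  assumes "f \<noteq> 0"
  shows "\<exists>s. s \<noteq> 0 \<and> spec_defined (scale_sym s f) \<and> spec (scale_sym s f) \<noteq> 0"
proof -
  obtain A c where A: "finite A" "A \<subseteq> partitions" "f = (\<Sum>\<rho>\<in>A. scale_sym (c \<rho>) (power_sum_part \<rho>))"
    by (rule power_sum_expansionE[of "f"])
  have "\<exists>\<rho>\<in>A. c \<rho> \<noteq> 0"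
  proof (rule ccontr)
    assume "\<not> ?thesis"
    then have "f = 0" unfolding A(3) by (intro sum.neutral) simp
    then show False using assms by simp
  qed
  then obtain \<rho> where \<rho>: "\<rho> \<in> A" "c \<rho> \<noteq> 0" "\<forall>\<kappa>\<in>A. regular (c \<kappa> / c \<rho>)"
    using exists_minimal_valuation[OF A(1)] by blast
  have eq: "scale_sym (1 / c \<rho>) f = (\<Sum>\<kappa>\<in>A. scale_sym (c \<kappa> / c \<rho>) (power_sum_part \<kappa>))"
    by (simp add: A(3) scale_sym_sum scale_sym_scale_sym)
  have *: "spec_defined (scale_sym (1 / c \<rho>) f)"
      "spec (scale_sym (1 / c \<rho>) f) = (\<Sum>\<kappa>\<in>A. scale_sym (special (c \<kappa> / c \<rho>)) (power_sum_part \<kappa>))"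
    unfolding eq using spec_linear_combination[of A "\<lambda>\<kappa>. c \<kappa> / c \<rho>" power_sum_part] \<rho>(3)
    by (simp_all add: spec_power_sum_part)
  have "spec (scale_sym (1 / c \<rho>) f) \<noteq> 0"
  proof
    assume "spec (scale_sym (1 / c \<rho>) f) = 0"
    then have "special (c \<rho> / c \<rho>) = 0"
      using indep_familyD[OF indep_power_sum_part A(1,2), of "\<lambda>\<kappa>. special (c \<kappa> / c \<rho>)" \<rho>] *(2) \<rho>(1) by simp
    then show False using \<rho>(2) by simp
  qed
  then show ?thesis using *(1) \<rho>(2) by (intro exI[of _ "1 / c \<rho>"]) simp
qed

section \<open>Plethysm\<close>

lemma pleth_props:
  "linear_sym (\<lambda>f. pleth f E)"
  "is_partition \<nu> \<Longrightarrow> pleth (power_sum_part \<nu>) E = seq_part (\<lambda>r. power_sum_pleth r E) \<nu>"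
proof -
  define P where "P = (\<lambda>\<phi>. linear_sym \<phi> \<and>
     (\<forall>\<nu>. is_partition \<nu> \<longrightarrow> \<phi> (power_sum_part \<nu>) = (\<Prod>r\<leftarrow>\<nu>. power_sum_pleth r E)))"
  have "\<exists>!\<phi>. P \<phi>"
    using ex1_linear_on_basis[OF sym.vector_space_axioms indep_power_sum_part span_power_sum_part,
        of "\<lambda>\<nu>. \<Prod>r\<leftarrow>\<nu>. power_sum_pleth r E"]
    by (simp add: P_def)
  then have "P (THE \<phi>. P \<phi>)" by (rule theI')
  moreover have "(\<lambda>f. pleth f E) = (THE \<phi>. P \<phi>)" by (simp add: pleth_def P_def)
  ultimately have P: "P (\<lambda>f. pleth f E)" by simp
  show "linear_sym (\<lambda>f. pleth f E)"
    using P unfolding P_def by (rule conjunct1)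
  show "is_partition \<nu> \<Longrightarrow> pleth (power_sum_part \<nu>) E = seq_part (\<lambda>r. power_sum_pleth r E) \<nu>"
    using P by (simp add: P_def seq_part_def)
qed

lemmas pleth_linear = linear_sym_simps[OF pleth_props(1)]

lemma pleth_power_sum_part:
  assumes "0 \<notin> set \<nu>"
  shows "pleth (power_sum_part \<nu>) E = seq_part (\<lambda>r. power_sum_pleth r E) \<nu>"
proof -
  have ms: "mset (part_of (mset \<nu>)) = mset \<nu>"
    using assms unfolding mset_part_of by (auto simp: filter_mset_eq_conv intro: gr0I)
  have "seq_part a \<nu> = seq_part a (part_of (mset \<nu>))" for a :: "nat \<Rightarrow> qt sym"
    by (simp only: seq_part_mset ms)
  then show ?thesis
    using pleth_props(2)[OF is_partition_part_of] by (metis seq_part_power_sum)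
qed

lemma pleth_1 [simp]: "pleth 1 E = 1"
  using pleth_power_sum_part[of "[]" E] by simp

lemma pleth_power_sum: "r \<ge> 1 \<Longrightarrow> pleth (power_sum r) E = power_sum_pleth r E"
  using pleth_power_sum_part[of "[r]" E] by simp

lemma linear_symI:
  fixes \<phi> :: "'a::field sym \<Rightarrow> 'a sym"
  assumes "\<And>x y. \<phi> (x + y) = \<phi> x + \<phi> y" "\<And>c x. \<phi> (scale_sym c x) = scale_sym c (\<phi> x)"
  shows "linear_sym \<phi>"
  unfolding Vector_Spaces.linear_iff
  by (intro conjI allI sym.vector_space_axioms assms)

lemma linear_eq_on_power_sums:
  fixes \<phi> \<psi> :: "'a::linordered_field sym \<Rightarrow> 'a sym"
  assumes "\<And>x y. \<phi> (x + y) = \<phi> x + \<phi> y" "\<And>c x. \<phi> (scale_sym c x) = scale_sym c (\<phi> x)"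
    and "\<And>x y. \<psi> (x + y) = \<psi> x + \<psi> y" "\<And>c x. \<psi> (scale_sym c x) = scale_sym c (\<psi> x)"
    and "\<And>\<rho>. 0 \<notin> set \<rho> \<Longrightarrow> \<phi> (power_sum_part \<rho>) = \<psi> (power_sum_part \<rho>)"
  shows "\<phi> x = \<psi> x"
  using linear_eq_on_basis[OF span_power_sum_part linear_symI[of \<phi>, OF assms(1,2)] linear_symI[of \<psi>, OF assms(3,4)], of x]
    assms(5) by (simp add: is_partition_def)

text \<open>Both sides are bilinear, so it suffices to take products of power sums, where plethysm
  is multiplicative by definition.\<close>

lemma pleth_mult: "pleth (f * g) E = pleth f E * pleth g E"
proof (rule linear_eq_on_power_sums[where \<phi> = "\<lambda>f. pleth (f * g) E" and \<psi> = "\<lambda>f. pleth f E * pleth g E"])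
  fix \<nu> :: "nat list" assume \<nu>: "0 \<notin> set \<nu>"
  show "pleth (power_sum_part \<nu> * g) E = pleth (power_sum_part \<nu>) E * pleth g E"
  proof (rule linear_eq_on_power_sums[where \<phi> = "\<lambda>g. pleth (power_sum_part \<nu> * g) E"
        and \<psi> = "\<lambda>g. pleth (power_sum_part \<nu>) E * pleth g E"])
    fix \<kappa> :: "nat list" assume "0 \<notin> set \<kappa>"
    moreover have "power_sum_part \<nu> * power_sum_part \<kappa> = (power_sum_part (\<nu> @ \<kappa>) :: qt sym)"
      by (simp flip: seq_part_power_sum)
    ultimately show "pleth (power_sum_part \<nu> * power_sum_part \<kappa>) E = pleth (power_sum_part \<nu>) E * pleth (power_sum_part \<kappa>) E"
      using \<nu> by (simp add: pleth_power_sum_part)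
  qed (simp_all add: distrib_left pleth_linear)
qed (simp_all add: distrib_right pleth_linear)

lemma pleth_seq_part: "pleth (seq_part a l) E = seq_part (\<lambda>r. pleth (a r) E) l"
  by (induction l) (simp_all add: pleth_mult)

lemma repeat_mset_inject: "r \<ge> 1 \<Longrightarrow> repeat_mset r M = repeat_mset r N \<longleftrightarrow> M = N"
  by (auto simp: multiset_eq_iff)

lemma power_sum_pleth_const:
  assumes "r \<ge> 1"
  shows "power_sum_pleth r (const_sym c) = const_sym (subst_qt (q ^ r) (t ^ r) c)"
proof (rule sym_eqI)
  fix M :: "nat multiset"
  show "coeff_sym (power_sum_pleth r (const_sym c)) M = coeff_sym (const_sym (subst_qt (q ^ r) (t ^ r) c)) M"
  proof (cases "M = {#}")
    case True
    have "{N. repeat_mset r N = {#}} = {{#} :: nat multiset}"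
      using assms repeat_mset_inject[of r _ "{#}"] by auto
    then show ?thesis using True by (simp add: power_sum_pleth.rep_eq const_sym.rep_eq)
  next
    case False
    then have "N \<noteq> {#}" if "repeat_mset r N = M" for N using that by auto
    then show ?thesis using False
      by (auto simp: power_sum_pleth.rep_eq const_sym.rep_eq intro!: sum.neutral)
  qed
qed

definition scaled_X :: "qt \<Rightarrow> qt sym" where
  "scaled_X c = X_sym * const_sym c"

lemma power_sum_pleth_X:
  assumes "r \<ge> 1"
  shows "power_sum_pleth r (scaled_X c) = scale_sym (subst_qt (q ^ r) (t ^ r) c) (power_sum r)"
proof (rule sym_eqI)
  fix M :: "nat multiset"
  have E: "scaled_X c = scale_sym c X_sym" by (simp add: scaled_X_def const_sym_eq)
  have rep: "repeat_mset r {#i#} = replicate_mset r i" for i :: nat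
    by (rule multiset_eqI) simp
  show "coeff_sym (power_sum_pleth r (scaled_X c)) M =
      coeff_sym (scale_sym (subst_qt (q ^ r) (t ^ r) c) (power_sum r)) M"
  proof (cases "\<exists>i. M = replicate_mset r i")
    case True
    then obtain i where i: "M = replicate_mset r i" by blast
    have "{N. repeat_mset r N = M} = {{#i#}}"
      using assms repeat_mset_inject[of r _ "{#i#}"] rep by (auto simp: i)
    moreover have "coeff_sym (X_sym :: qt sym) {#i#} = 1" by (auto simp: power_sum.rep_eq)
    ultimately show ?thesis using True
      by (simp add: E power_sum_pleth.rep_eq) (simp add: power_sum.rep_eq)
  next
    case False
    have "coeff_sym (X_sym :: qt sym) N = 0" if "repeat_mset r N = M" for N
      using False that rep by (auto simp: power_sum.rep_eq)
    then show ?thesis using False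
      by (auto simp: E power_sum_pleth.rep_eq power_sum.rep_eq intro!: sum.neutral)
  qed
qed

text \<open>Substituting Xc multiplies p_s by the value of c at (q^s, t^s), so the recursion keeps
  its form and only the scalars \<open>d s\<close> change.\<close>

lemma newton_seq_pleth:
  assumes "newton_seq d a"
  shows "newton_seq (\<lambda>s. subst_qt (q ^ s) (t ^ s) c * d s) (\<lambda>n. pleth (a n) (scaled_X c))"
  unfolding newton_seq_def
proof (intro conjI allI)
  show "pleth (a 0) (scaled_X c) = 1" using assms by (simp add: newton_seq_def)
  fix n
  have "scale_sym (of_nat n) (pleth (a n) (scaled_X c)) =
      pleth (\<Sum>s=1..n. scale_sym (d s) (power_sum s * a (n - s))) (scaled_X c)"
    using assms by (simp only: newton_seq_def flip: pleth_linear(3))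
  also have "\<dots> = (\<Sum>s=1..n. scale_sym (subst_qt (q ^ s) (t ^ s) c * d s)
      (power_sum s * pleth (a (n - s)) (scaled_X c)))"
    unfolding pleth_linear(4)
    by (rule sum.cong)
      (auto simp: pleth_linear(3) pleth_mult pleth_power_sum power_sum_pleth_X scale_sym_scale_sym mult.commute)
  finally show "scale_sym (of_nat n) (pleth (a n) (scaled_X c)) =
    (\<Sum>s=1..n. scale_sym (subst_qt (q ^ s) (t ^ s) c * d s)
      (power_sum s * pleth (a (n - s)) (scaled_X c)))" .
qed

text \<open>Alphabets multiply: e stands for cd. The hypothesis speaks of values because
  multiplicativity of \<open>subst_qt\<close> is tied to the absence of poles.\<close>

lemma pleth_comp:
  assumes "\<And>r. r \<ge> 1 \<Longrightarrow> subst_qt (q ^ r) (t ^ r) c * subst_qt (q ^ r) (t ^ r) d = subst_qt (q ^ r) (t ^ r) e"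
  shows "pleth (pleth f (scaled_X c)) (scaled_X d) = pleth f (scaled_X e)"
proof (rule linear_eq_on_power_sums[where
      \<phi> = "\<lambda>f. pleth (pleth f (scaled_X c)) (scaled_X d)" and \<psi> = "\<lambda>f. pleth f (scaled_X e)"])
  fix \<kappa> :: "nat list" assume "0 \<notin> set \<kappa>"
  then show "pleth (pleth (power_sum_part \<kappa>) (scaled_X c)) (scaled_X d) =
      pleth (power_sum_part \<kappa>) (scaled_X e)"
  proof (induction \<kappa>)
    case (Cons r \<kappa>)
    then have "r \<ge> 1" by simp
    then have "pleth (pleth (power_sum r) (scaled_X c)) (scaled_X d) = pleth (power_sum r) (scaled_X e)"
      by (simp only: pleth_power_sum power_sum_pleth_X pleth_linear(3) scale_sym_scale_sym assms)
    then show ?case using Cons by (simp add: pleth_mult)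
  qed simp
qed (simp_all add: pleth_linear)

text \<open>Plethysm with Xc is diagonal in the basis of the p_\<rho>, with eigenvalues that are
  nonzero by hypothesis.\<close>

lemma pleth_inj:
  assumes c: "\<And>r. r \<ge> 1 \<Longrightarrow> subst_qt (q ^ r) (t ^ r) c \<noteq> 0"
    and eq: "pleth f (scaled_X c) = pleth g (scaled_X c)"
  shows "f = g"
proof -
  let ?k = "\<lambda>\<rho>. \<Prod>r\<leftarrow>\<rho>. subst_qt (q ^ r) (t ^ r) c"
  have p: "pleth (power_sum_part \<rho>) (scaled_X c) = scale_sym (?k \<rho>) (power_sum_part \<rho>)" "?k \<rho> \<noteq> 0"
    if "0 \<notin> set \<rho>" for \<rho>
    using that
    by (induction \<rho>) (auto simp: pleth_mult pleth_power_sum power_sum_pleth_X scale_sym_scale_sym c mult.commute)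
  obtain A a where A: "finite A" "A \<subseteq> partitions" "f - g = (\<Sum>\<rho>\<in>A. scale_sym (a \<rho>) (power_sum_part \<rho>))"
    by (rule power_sum_expansionE[of "f - g"])
  have pos: "0 \<notin> set \<rho>" if "\<rho> \<in> A" for \<rho> using that A(2) by (auto simp: is_partition_def)
  have "0 = pleth (f - g) (scaled_X c)"
    using eq pleth_linear(2)[of "f - g" g "scaled_X c"] by simp
  also have "\<dots> = (\<Sum>\<rho>\<in>A. scale_sym (a \<rho> * ?k \<rho>) (power_sum_part \<rho>))"
    unfolding A(3) pleth_linear(4)
    by (rule sum.cong) (simp_all add: pleth_linear(3) p(1)[OF pos] scale_sym_scale_sym)
  finally have "a \<rho> * ?k \<rho> = 0" if "\<rho> \<in> A" for \<rho>
    using indep_familyD[OF indep_power_sum_part A(1,2), of "\<lambda>\<rho>. a \<rho> * ?k \<rho>"] that by simp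
  then have "a \<rho> = 0" if "\<rho> \<in> A" for \<rho> using p(2)[OF pos] that by simp
  then have "f - g = 0" unfolding A(3) by simp
  then show ?thesis by simp
qed

text \<open>The p_\<rho> are fixed by the specialization, so the coordinates of a specializable
  \<open>f\<close> are regular and the claim reduces to single power sums.\<close>

lemma spec_pleth:
  assumes f: "spec_defined f"
    and E: "\<And>r. r \<ge> 1 \<Longrightarrow> spec_defined (power_sum_pleth r E)"
      "\<And>r. r \<ge> 1 \<Longrightarrow> spec (power_sum_pleth r E) = power_sum_pleth r E'"
  shows "spec_defined (pleth f E)" "spec (pleth f E) = pleth (spec f) E'"
proof -
  have p: "spec_defined (pleth (power_sum_part \<rho>) E) \<and>
      spec (pleth (power_sum_part \<rho>) E) = pleth (power_sum_part \<rho>) E'" if "0 \<notin> set \<rho>" for \<rho>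
    using that
    by (induction \<rho>) (auto simp: pleth_mult pleth_power_sum Suc_le_eq spec_mult spec_generators E)
  obtain A a where A: "finite A" "A \<subseteq> partitions" "f = (\<Sum>\<rho>\<in>A. scale_sym (a \<rho>) (power_sum_part \<rho>))"
    by (rule power_sum_expansionE[of "f"])
  have pos: "0 \<notin> set \<rho>" if "\<rho> \<in> A" for \<rho> using that A(2) by (auto simp: is_partition_def)
  have reg: "regular (a \<rho>)" if "\<rho> \<in> A" for \<rho>
    using that f indep_family_subset[OF indep_power_sum_part A(2)] unfolding A(3)
    by (intro regular_coordinates[OF A(1), of power_sum_part]) (simp_all add: spec_power_sum_part)
  have 1: "pleth f E = (\<Sum>\<rho>\<in>A. scale_sym (a \<rho>) (pleth (power_sum_part \<rho>) E))"
    by (simp add: A(3) pleth_linear)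
  have 2: "spec f = (\<Sum>\<rho>\<in>A. scale_sym (special (a \<rho>)) (power_sum_part \<rho>))"
    unfolding A(3) using spec_linear_combination(2)[of A a power_sum_part] reg by (simp add: spec_power_sum_part)
  note 3 = spec_linear_combination[of A a "\<lambda>\<rho>. pleth (power_sum_part \<rho>) E", OF reg]
  show "spec_defined (pleth f E)" unfolding 1 by (rule 3(1)) (use p pos in auto)
  have "spec (pleth f E) = (\<Sum>\<rho>\<in>A. scale_sym (special (a \<rho>)) (spec (pleth (power_sum_part \<rho>) E)))"
    unfolding 1 by (rule 3(2)) (use p pos in auto)
  also have "\<dots> = pleth (spec f) E'"
    unfolding 2 pleth_linear using p pos by (intro sum.cong) auto
  finally show "spec (pleth f E) = pleth (spec f) E'" .
qed

text \<open>\<open>u\<close> acts as a monomial factor of the alphabet: it contributes u^r to p_r,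
  hence u^k to every product of total degree k.\<close>

lemma pleth_const_homogeneous:
  assumes f: "homogeneous_sym k f"
    and c: "\<And>r. r \<ge> 1 \<Longrightarrow> subst_qt (q ^ r) (t ^ r) c = u ^ r * subst_qt (q ^ r) (t ^ r) d"
  shows "pleth f (const_sym c) = scale_sym (u ^ k) (pleth f (const_sym d))"
proof -
  have p: "pleth (power_sum_part \<rho>) (const_sym c) = scale_sym (u ^ sum_list \<rho>) (pleth (power_sum_part \<rho>) (const_sym d))"
    if "0 \<notin> set \<rho>" for \<rho>
    using that
  proof (induction \<rho>)
    case (Cons r \<rho>)
    have "pleth (power_sum r) (const_sym c) = scale_sym (u ^ r) (pleth (power_sum r) (const_sym d))"
      using Cons.prems c[of r]
      by (simp add: pleth_power_sum power_sum_pleth_const Suc_le_eq)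
        (simp add: const_sym_eq scale_sym_scale_sym)
    then show ?case using Cons
      by (simp add: pleth_mult scale_sym_scale_sym power_add mult.commute)
  qed simp
  obtain A a where A: "finite A" "A \<subseteq> partitions" "f = (\<Sum>\<rho>\<in>A. scale_sym (a \<rho>) (power_sum_part \<rho>))"
    by (rule power_sum_expansionE[of "f"])
  let ?A = "{\<rho>\<in>A. sum_list \<rho> = k}"
  have pos: "0 \<notin> set \<rho>" if "\<rho> \<in> A" for \<rho> using that A(2) by (auto simp: is_partition_def)
  \<comment> \<open>Comparing coefficients degree by degree leaves only the \<rho> of size
    k.\<close>
  have eq: "f = (\<Sum>\<rho>\<in>?A. scale_sym (a \<rho>) (power_sum_part \<rho>))"
  proof (rule sym_eqI)
    fix M
    have z: "coeff_sym (power_sum_part \<rho> :: qt sym) M = 0" if "\<rho> \<in> A" "sum_list \<rho> \<noteq> size M" for \<rho>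
      using coeff_power_sum_part_size[OF pos[OF that(1)]] that(2) by metis
    show "coeff_sym f M = coeff_sym (\<Sum>\<rho>\<in>?A. scale_sym (a \<rho>) (power_sum_part \<rho>)) M"
    proof (cases "size M = k")
      case True
      have "coeff_sym f M = (\<Sum>\<rho>\<in>A. a \<rho> * coeff_sym (power_sum_part \<rho>) M)" by (simp add: A(3))
      also have "\<dots> = (\<Sum>\<rho>\<in>?A. a \<rho> * coeff_sym (power_sum_part \<rho>) M)"
        using A(1) z True by (intro sum.mono_neutral_right) auto
      finally show ?thesis by simp
    next
      case False
      then have "coeff_sym f M = 0" using f by (auto simp: homogeneous_sym_def)
      moreover have "(\<Sum>\<rho>\<in>?A. a \<rho> * coeff_sym (power_sum_part \<rho>) M) = 0"
        using z False by (intro sum.neutral) auto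
      ultimately show ?thesis by simp
    qed
  qed
  have "pleth f (const_sym c) = (\<Sum>\<rho>\<in>?A. scale_sym (a \<rho>) (pleth (power_sum_part \<rho>) (const_sym c)))"
    by (subst eq) (simp add: pleth_linear)
  also have "\<dots> = (\<Sum>\<rho>\<in>?A. scale_sym (u ^ k) (scale_sym (a \<rho>) (pleth (power_sum_part \<rho>) (const_sym d))))"
    using pos by (intro sum.cong) (auto simp: p scale_sym_scale_sym mult.commute)
  also have "\<dots> = scale_sym (u ^ k) (pleth f (const_sym d))"
    by (subst eq) (simp add: pleth_linear scale_sym_sum)
  finally show ?thesis .
qed

text \<open>Makes the eigenvalue f[B_\<mu>], formally a symmetric function, a scalar.\<close>

lemma pleth_const_is_const: "\<exists>d. pleth f (const_sym c) = const_sym d"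
proof -
  have p: "\<exists>d. pleth (power_sum_part \<rho>) (const_sym c) = scale_sym d 1" if "0 \<notin> set \<rho>" for \<rho>
    using that
  proof (induction \<rho>)
    case (Cons r \<rho>)
    then obtain d where "pleth (power_sum_part \<rho>) (const_sym c) = scale_sym d 1" by auto
    moreover have "pleth (power_sum r) (const_sym c) = scale_sym (subst_qt (q ^ r) (t ^ r) c) 1"
      using Cons.prems by (simp add: pleth_power_sum power_sum_pleth_const Suc_le_eq) (simp add: const_sym_eq)
    ultimately show ?case by (auto simp: pleth_mult scale_sym_scale_sym)
  qed (auto intro: exI[of _ 1])
  have "f \<in> sym.span (power_sum_part ` partitions)"
    by (simp add: span_power_sum_part)
  then have "\<exists>d. pleth f (const_sym c) = scale_sym d 1"
  proof (induction rule: sym.span_induct_alt)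
    case base
    show ?case by (intro exI[of _ 0]) (simp add: pleth_linear)
  next
    case (step a x y)
    then obtain \<rho> d e where "x = power_sum_part \<rho>" "is_partition \<rho>"
        "pleth y (const_sym c) = scale_sym e 1" by blast
    moreover from this obtain d where "pleth x (const_sym c) = scale_sym d 1"
      using p is_partitionD by blast
    ultimately show ?case
      by (intro exI[of _ "a * d + e"]) (simp add: pleth_linear scale_sym_scale_sym scale_sym_add)
  qed
  then show ?thesis by (simp add: const_sym_eq)
qed

section \<open>Modified Macdonald polynomials at $t = 1/q$\<close>

lemma span_finite_imageE:
  assumes "x \<in> sym.span (v ` I)" "finite I"
  obtains a where "x = (\<Sum>i\<in>I. scale_sym (a i) (v i))"
proof -
  obtain A a where A: "finite A" "A \<subseteq> I" "x = (\<Sum>i\<in>A. scale_sym (a i) (v i))"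
    using assms(1) unfolding span_image_iff by blast
  have "x = (\<Sum>i\<in>I. scale_sym (if i \<in> A then a i else 0) (v i))"
    unfolding A(3) using A(2) assms(2) by (intro sum.mono_neutral_cong_left) auto
  then show ?thesis by (rule that)
qed

text \<open>The products of h are fixed by the specialization and independent, so the coefficients
  of \<open>f\<close> are regular. This is how a triangularity condition survives at t =
  1/q.\<close>

lemma spec_complete_span:
  assumes f: "spec_defined f" "f \<in> sym.span (h_part ` I)"
    and I: "finite I" "I \<subseteq> partitions"
  obtains a where "f = (\<Sum>\<mu>\<in>I. scale_sym (a \<mu>) (h_part \<mu>))"
    "spec f = (\<Sum>\<mu>\<in>I. scale_sym (special (a \<mu>)) (h_part \<mu>))"
proof -
  obtain a where a: "f = (\<Sum>\<mu>\<in>I. scale_sym (a \<mu>) (h_part \<mu>))"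
    using span_finite_imageE[OF f(2) I(1)] .
  have "regular (a \<mu>)" if "\<mu> \<in> I" for \<mu>
    using that f(1) indep_family_subset[OF indep_complete I(2)] unfolding a
    by (intro regular_coordinates[OF I(1), of "h_part"]) (simp_all add: spec_complete)
  then have "spec f = (\<Sum>\<mu>\<in>I. scale_sym (special (a \<mu>)) (h_part \<mu>))"
    unfolding a using spec_linear_combination(2)[of I a "h_part"] by (simp add: spec_complete)
  with a show ?thesis by (rule that)
qed

lemma subst_power_simps:
  "subst_qt (q ^ r) (t ^ r) (1 - q) = 1 - q ^ r"
  "subst_qt (q ^ r) (t ^ r) (1 - t) = 1 - t ^ r"
  "subst_qt (q ^ r) (t ^ r) (1 - 1 / q) = 1 - (1 / q) ^ r"
  "subst_qt (q ^ r) (t ^ r) (- q) = - (q ^ r)"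
  "subst_qt (q ^ r) (t ^ r) (1 - q ^ k) = 1 - (q ^ k) ^ r"
  "subst_qt (q ^ r) (t ^ r) (q_int k) = (\<Sum>i<k. (q ^ r) ^ i)"
  by (simp_all add: subst_qt_diff subst_qt_minus subst_qt_inverse subst_qt_power subst_qt_sum q_int_def
      power_one_over mult.commute flip: power_mult)

lemma spec_pleth_X:
  assumes "spec_defined f" and c: "\<And>r. r \<ge> 1 \<Longrightarrow> regular (subst_qt (q ^ r) (t ^ r) c)"
    "\<And>r. r \<ge> 1 \<Longrightarrow> special (subst_qt (q ^ r) (t ^ r) c) = subst_qt (q ^ r) (t ^ r) d"
  shows "spec_defined (pleth f (scaled_X c))" "spec (pleth f (scaled_X c)) = pleth (spec f) (scaled_X d)"
proof -
  have E: "spec_defined (power_sum_pleth r (scaled_X c))"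
      "spec (power_sum_pleth r (scaled_X c)) = power_sum_pleth r (scaled_X d)" if "r \<ge> 1" for r
    using that by (simp_all add: power_sum_pleth_X spec_scale spec_generators c)
  show "spec_defined (pleth f (scaled_X c))" "spec (pleth f (scaled_X c)) = pleth (spec f) (scaled_X d)"
    using spec_pleth[OF assms(1) E] by simp_all
qed

text \<open>The minus sign of an alphabet is not raised to a power: p_s[-qX] = -q^s p_s. These are
  the Newton scalars of e twisted by -q, hence h_n[-qX] = (-q)^n e_n.\<close>

lemma pleth_minus_q_complete:
  "pleth (h_part l) (scaled_X (- q)) = scale_sym ((- q) ^ sum_list l) (e_part l)"
proof -
  have "newton_seq (\<lambda>s. (- q) ^ s * (- 1) ^ (s - 1)) (\<lambda>n. pleth (complete_sym n) (scaled_X (- q)))"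
  proof (rule newton_seq_cong[OF newton_seq_pleth[OF newton_complete]])
    fix s :: nat assume "s \<ge> 1"
    then obtain m where s: "s = Suc m" by (cases s) auto
    have "(- q) ^ m * (- 1) ^ m = q ^ m" by (simp flip: power_mult_distrib)
    then show "subst_qt (q ^ s) (t ^ s) (- q) * 1 = (- q) ^ s * (- 1) ^ (s - 1)"
      unfolding subst_power_simps s by (simp add: mult.assoc)
  qed
  from newton_seq_unique[OF this newton_seq_twist[OF newton_elem]]
  have 1: "pleth (complete_sym n) (scaled_X (- q)) = scale_sym ((- q) ^ n) (elem_sym n)" for n .
  show ?thesis
    unfolding pleth_seq_part 1 by (induction l) (simp_all add: scale_sym_scale_sym power_add mult.commute)
qed

text \<open>Triangularity is demanded twice: before specialization it makes the multiples of the
  Macdonald polynomials a basis, after specialization it keeps them independent.\<close>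

definition normalizes :: "nat list \<Rightarrow> qt sym \<Rightarrow> qt \<Rightarrow> bool" where
  "normalizes \<mu> H s \<longleftrightarrow> s \<noteq> 0 \<and> spec_defined (scale_sym s H) \<and>
    pleth (spec (scale_sym s H)) (scaled_X (1 - q)) \<in> sym.span (e_part ` above (conj_part \<mu>)) \<and>
    (\<exists>c. c \<noteq> 0 \<and> pleth (scale_sym s H) (scaled_X (1 - q)) - scale_sym c (h_part \<mu>)
      \<in> sym.span (h_part ` strictly_above \<mu>)) \<and>
    (\<exists>c. c \<noteq> 0 \<and> pleth (spec (scale_sym s H)) (scaled_X (1 - q)) - scale_sym c (h_part \<mu>)
      \<in> sym.span (h_part ` strictly_above \<mu>))"

lemma exists_normalizes:
  assumes \<mu>: "is_partition \<mu>" and H: "is_modified_macdonald \<mu> H"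
  shows "\<exists>s. normalizes \<mu> H s"
proof -
  \<comment> \<open>The scalar product of \<open>H\<close> with a Schur function is 1, and
    \<open>hall\<close> is linear.\<close>
  have "H \<noteq> 0"
  proof
    assume "H = 0"
    then show False using H linear_sym_simps(1)[OF hall_linear_left[where 'a = qt]] by (simp add: is_modified_macdonald_def)
  qed
  then obtain s where s: "s \<noteq> 0" "spec_defined (scale_sym s H)" "spec (scale_sym s H) \<noteq> 0"
    using exists_primitive_multiple by blast
  let ?G = "scale_sym s H"
  let ?g = "spec ?G"
  let ?F = "pleth ?g (scaled_X (1 - q))"
  have span: "pleth ?G (scaled_X (1 - q)) \<in> sym.span (h_part ` above \<mu>)"
      "pleth ?G (scaled_X (1 - t)) \<in> sym.span (h_part ` above (conj_part \<mu>))"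
    using H unfolding pleth_linear(3) scaled_X_def is_modified_macdonald_def
    by (auto intro!: sym.span_scale schur_span_above)
  have "special (1 - q ^ r) = 1 - q ^ r" "regular (1 - q ^ r)" for r
    by (simp_all add: subst_qt_diff subst_qt_power)
  then have 1: "spec_defined (pleth ?G (scaled_X (1 - q)))" "spec (pleth ?G (scaled_X (1 - q))) = ?F"
    using spec_pleth_X[OF s(2), of "1 - q" "1 - q"] unfolding subst_power_simps by blast+
  have "special (1 - t ^ r) = 1 - (1 / q) ^ r" "regular (1 - t ^ r)" for r
    by (simp_all add: subst_qt_diff subst_qt_power)
  then have 2: "spec_defined (pleth ?G (scaled_X (1 - t)))"
      "spec (pleth ?G (scaled_X (1 - t))) = pleth ?g (scaled_X (1 - 1 / q))"
    using spec_pleth_X[OF s(2), of "1 - t" "1 - 1 / q"] unfolding subst_power_simps by blast+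
  have above: "finite (above \<nu>)" "above \<nu> \<subseteq> partitions" for \<nu>
    by (rule finite_above) (auto simp: above_def)
  obtain a where a: "pleth ?G (scaled_X (1 - q)) = (\<Sum>\<nu>\<in>above \<mu>. scale_sym (a \<nu>) (h_part \<nu>))"
      "?F = (\<Sum>\<nu>\<in>above \<mu>. scale_sym (special (a \<nu>)) (h_part \<nu>))"
    using spec_complete_span[OF 1(1) span(1) above] unfolding 1(2) .
  obtain b where b:
      "pleth ?g (scaled_X (1 - 1 / q)) = (\<Sum>\<nu>\<in>above (conj_part \<mu>). scale_sym (special (b \<nu>)) (h_part \<nu>))"
    using spec_complete_span[OF 2(1) span(2) above] unfolding 2(2) .
  \<comment> \<open>(1 - 1/q)(-q) = 1 - q: the second triangularity condition becomes one on
    \<open>?F\<close>, with e in place of h.\<close>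
  have "?F = pleth (pleth ?g (scaled_X (1 - 1 / q))) (scaled_X (- q))"
  proof (rule pleth_comp[symmetric])
    fix r :: nat
    show "subst_qt (q ^ r) (t ^ r) (1 - 1 / q) * subst_qt (q ^ r) (t ^ r) (- q) = subst_qt (q ^ r) (t ^ r) (1 - q)"
      unfolding subst_power_simps by (simp add: algebra_simps power_one_over)
  qed
  also have "\<dots> \<in> sym.span (e_part ` above (conj_part \<mu>))"
    unfolding b pleth_linear pleth_minus_q_complete
    by (intro sym.span_sum sym.span_scale sym.span_base imageI)
  finally have W: "?F \<in> sym.span (e_part ` above (conj_part \<mu>))" .
  have tri: "(\<Sum>\<nu>\<in>above \<mu>. scale_sym (c \<nu>) (h_part \<nu>)) - scale_sym (c \<mu>) (h_part \<mu>)
      \<in> sym.span (h_part ` strictly_above \<mu> :: qt sym set)" for c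
  proof -
    have "(\<Sum>\<nu>\<in>above \<mu>. scale_sym (c \<nu>) (h_part \<nu>)) =
        scale_sym (c \<mu>) (h_part \<mu>) + (\<Sum>\<nu>\<in>strictly_above \<mu>. scale_sym (c \<nu>) (h_part \<nu> :: qt sym))"
      unfolding strictly_above_def using above_eq[OF \<mu>] by (intro sum.remove finite_above) auto
    then show ?thesis
      by (simp only: add_diff_cancel_left') (intro sym.span_sum sym.span_scale sym.span_base imageI)
  qed
  \<comment> \<open>Without an h_\<mu> component \<open>?F\<close> would lie in both spans and
    vanish, but a primitive multiple does not specialize to 0.\<close>
  have nz: "special (a \<mu>) \<noteq> 0"
  proof
    assume "special (a \<mu>) = 0"
    then have "?F \<in> sym.span (h_part ` strictly_above \<mu>)"
      using tri[of "\<lambda>\<nu>. special (a \<nu>)"] unfolding a(2) by simp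
    then have "?F = 0" using W by (rule complete_elem_intersection[OF \<mu>])
    then have "?F = pleth 0 (scaled_X (1 - q))" by (simp add: pleth_linear)
    then have "?g = 0"
      by (rule pleth_inj[rotated]) (simp only: subst_power_simps one_minus_q_power_nonzero not_False_eq_True)
    then show False using s(3) by simp
  qed
  then have "a \<mu> \<noteq> 0" by auto
  moreover have "pleth ?G (scaled_X (1 - q)) - scale_sym (a \<mu>) (h_part \<mu>)
      \<in> sym.span (h_part ` strictly_above \<mu>)"
    unfolding a(1) by (rule tri)
  moreover have "?F - scale_sym (special (a \<mu>)) (h_part \<mu>)
      \<in> sym.span (h_part ` strictly_above \<mu>)"
    unfolding a(2) by (rule tri)
  ultimately show ?thesis
    unfolding normalizes_def by (intro exI[of _ s] conjI exI[of _ "a \<mu>"] exI[of _ "special (a \<mu>)"] s(1,2) W nz)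
qed

section \<open>The sums B_\<mu>, in particular on hooks\<close>

lemma coarm_eq:
  assumes "(i, j) \<in> cells \<mu>"
  shows "coarm \<mu> (i, j) = j"
proof -
  have "{d \<in> cells \<mu>. fst d = i \<and> snd d < j} = Pair i ` {..<j}"
    using assms by (auto simp: cells_def)
  then show ?thesis by (simp add: coarm_def card_image inj_on_def)
qed

lemma coleg_eq:
  assumes "is_partition \<mu>" "(i, j) \<in> cells \<mu>"
  shows "coleg \<mu> (i, j) = i"
proof -
  have "\<mu> ! i \<le> \<mu> ! i'" if "i' < i" for i'
    using assms that by (auto simp: is_partition_def cells_def sorted_wrt_iff_nth_less)
  then have "{d \<in> cells \<mu>. snd d = j \<and> fst d < i} = (\<lambda>i. (i, j)) ` {..<i}"
    using assms(2) by (auto simp: cells_def intro: less_le_trans)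
  then show ?thesis by (simp add: coleg_def card_image inj_on_def)
qed

lemma B_part_eq:
  assumes "is_partition \<mu>"
  shows "B_part \<mu> = (\<Sum>(i, j)\<in>cells \<mu>. q ^ j * t ^ i)"
  unfolding B_part_def using assms
  by (intro sum.cong) (auto simp: coarm_eq coleg_eq)

text \<open>The arm contributes 1, q, ..., q^b and the leg q^(-1), ..., q^(-m) with m = n - 1 - b:
  together n consecutive powers of q, starting at q^(-m).\<close>

lemma special_B_hook:
  assumes "b < n"
  shows "(\<Sum>(i, j)\<in>cells (hook n b). q ^ j * (1 / q) ^ i) = (1 / q) ^ (n - Suc b) * q_int n"
proof -
  define m where "m = n - Suc b"
  have n: "n = m + Suc b" using assms by (simp add: m_def)
  have cells: "cells (hook n b) = Pair 0 ` {..b} \<union> (\<lambda>i. (Suc i, 0)) ` {..<m}"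
  proof (rule Set.set_eqI)
    fix x :: "nat \<times> nat"
    obtain i j where x: "x = (i, j)" by fastforce
    show "x \<in> cells (hook n b) \<longleftrightarrow> x \<in> Pair 0 ` {..b} \<union> (\<lambda>i. (Suc i, 0)) ` {..<m}"
      by (cases i) (auto simp: x n cells_def hook_def)
  qed
  have pow: "(1 / q) ^ m * q ^ (m + j) = q ^ j" for j
    by (simp add: power_add power_one_over)
  have "(\<Sum>(i, j)\<in>cells (hook n b). q ^ j * (1 / q) ^ i) = (\<Sum>j\<le>b. q ^ j) + (\<Sum>i<m. (1 / q) ^ Suc i)"
    unfolding cells by (subst sum.union_disjoint) (auto simp: sum.reindex inj_on_def)
  also have "(\<Sum>j\<le>b. q ^ j) = (\<Sum>l=m..<n. (1 / q) ^ m * q ^ l)"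
  proof (rule sum.reindex_bij_witness[of _ "\<lambda>l. l - m" "\<lambda>j. m + j"])
    show "(1 / q) ^ m * q ^ (m + j) = q ^ j" for j by (rule pow)
  qed (auto simp: n)
  also have "(\<Sum>i<m. (1 / q) ^ Suc i) = (\<Sum>l<m. (1 / q) ^ m * q ^ l)"
  proof (rule sum.reindex_bij_witness[of _ "\<lambda>l. m - Suc l" "\<lambda>i. m - Suc i"])
    fix i assume "i \<in> {..<m}"
    then have "m = Suc i + (m - Suc i)" by simp
    then have "(1 / q) ^ m = (1 / q) ^ Suc i * (1 / q) ^ (m - Suc i)" by (simp only: flip: power_add)
    then show "(1 / q) ^ m * q ^ (m - Suc i) = (1 / q) ^ Suc i"
      by (simp add: power_one_over)
  qed auto
  also have "(\<Sum>l=m..<n. (1 / q) ^ m * q ^ l) + (\<Sum>l<m. (1 / q) ^ m * q ^ l) = (\<Sum>l<n. (1 / q) ^ m * q ^ l)"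
    using sum.atLeastLessThan_concat[of 0 m n "\<lambda>l. (1 / q) ^ m * q ^ l"] n
    by (simp add: atLeast0LessThan add.commute)
  finally show ?thesis by (simp add: q_int_def sum_distrib_left m_def)
qed

section \<open>Pulling bases back along X -> X(1-q)\<close>

lemma indep_family_linear_image:
  assumes "linear_sym \<phi>" "indep_family I (\<lambda>i. \<phi> (v i))"
  shows "indep_family I v"
  unfolding indep_family_def
proof (intro allI impI ballI)
  fix A a i
  assume A: "finite A" "A \<subseteq> I" "(\<Sum>i\<in>A. scale_sym (a i) (v i)) = 0" "i \<in> A"
  note lin = linear_sym_simps[OF assms(1)]
  have "(\<Sum>i\<in>A. scale_sym (a i) (\<phi> (v i))) = \<phi> (\<Sum>i\<in>A. scale_sym (a i) (v i))"
    by (simp add: lin)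
  also have "\<dots> = 0" by (simp add: A(3) lin)
  finally show "a i = 0" using indep_familyD[OF assms(2) A(1,2) _ A(4)] by blast
qed

lemma span_linear_image:
  assumes "linear_sym \<phi>" "inj \<phi>"
    and "sym.span ((\<lambda>i. \<phi> (v i)) ` I) = UNIV"
  shows "sym.span (v ` I) = UNIV"
proof -
  note lin = linear_sym_simps[OF assms(1)]
  have "x \<in> sym.span (v ` I)" for x
  proof -
    have "\<phi> x \<in> sym.span ((\<lambda>i. \<phi> (v i)) ` I)" by (simp add: assms(3))
    then obtain A a where A: "finite A" "A \<subseteq> I" "\<phi> x = (\<Sum>i\<in>A. scale_sym (a i) (\<phi> (v i)))"
      unfolding span_image_iff by blast
    then have "\<phi> x = \<phi> (\<Sum>i\<in>A. scale_sym (a i) (v i))" by (simp add: lin)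
    then have x: "x = (\<Sum>i\<in>A. scale_sym (a i) (v i))" using assms(2) by (simp add: inj_eq)
    show ?thesis
      unfolding x using A(2) by (intro sym.span_sum sym.span_scale sym.span_base) auto
  qed
  then show ?thesis by blast
qed

lemma inj_pleth_one_minus_q: "inj (\<lambda>f. pleth f (scaled_X (1 - q)))"
proof (rule injI)
  fix f g assume "pleth f (scaled_X (1 - q)) = pleth g (scaled_X (1 - q))"
  then show "f = g"
    by (rule pleth_inj[rotated]) (simp only: subst_power_simps one_minus_q_power_nonzero not_False_eq_True)
qed

lemma const_sym_mult: "const_sym c * f = scale_sym c f"
  by (simp add: const_sym_eq)

lemma q_int_mult: "q_int k * (1 - q) = 1 - q ^ k"
  by (simp add: q_int_def one_diff_power_eq mult.commute)

lemma q_int_nonzero: "k \<ge> 1 \<Longrightarrow> q_int k \<noteq> 0"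
  using q_int_mult[of k] one_minus_q_power_nonzero[of k] by auto

text \<open>Identifies \<open>super_elem\<close> as a plethysm by the uniqueness of Newton
  sequences.\<close>

lemma pleth_elem_one_minus_q: "pleth (elem_sym n) (scaled_X (1 - q ^ k)) = super_elem (q ^ k) n"
proof (rule newton_seq_unique[OF newton_seq_pleth[OF newton_elem]])
  show "newton_seq (\<lambda>s. subst_qt (q ^ s) (t ^ s) (1 - q ^ k) * (- 1) ^ (s - 1)) (super_elem (q ^ k))"
    by (rule newton_seq_cong[OF newton_super_elem]) (simp only: subst_power_simps mult.commute)
qed

section \<open>Delta operators at $t = 1/q$\<close>

locale macdonald_family =
  fixes Ht :: "nat list \<Rightarrow> qt sym"
  assumes macdonald: "is_partition \<mu> \<Longrightarrow> is_modified_macdonald \<mu> (Ht \<mu>)"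
begin

definition "factor \<mu> = (SOME s. normalizes \<mu> (Ht \<mu>) s)"

text \<open>For a partition \<mu> an eigenvector with the same eigenvalue as
  \<open>Ht \<mu>\<close>, but with a nonzero specialization.\<close>

definition "prim \<mu> = scale_sym (factor \<mu>) (Ht \<mu>)"

text \<open>The \<open>F\<^sub>\<mu>\<close> of the overview.\<close>

definition "prim_pleth \<mu> = pleth (spec (prim \<mu>)) (scaled_X (1 - q))"

lemma prim_props:
  assumes "is_partition \<mu>"
  shows "factor \<mu> \<noteq> 0" "spec_defined (prim \<mu>)"
    "prim_pleth \<mu> \<in> sym.span (e_part ` above (conj_part \<mu>))"
    "\<exists>c. c \<noteq> 0 \<and> pleth (prim \<mu>) (scaled_X (1 - q)) - scale_sym c (h_part \<mu>)
      \<in> sym.span (h_part ` strictly_above \<mu>)"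
    "\<exists>c. c \<noteq> 0 \<and> prim_pleth \<mu> - scale_sym c (h_part \<mu>)
      \<in> sym.span (h_part ` strictly_above \<mu>)"
proof -
  have "normalizes \<mu> (Ht \<mu>) (factor \<mu>)"
    unfolding factor_def by (rule someI_ex[OF exists_normalizes[OF assms macdonald[OF assms]]])
  note * = this[unfolded normalizes_def, folded prim_def, folded prim_pleth_def]
  show "factor \<mu> \<noteq> 0" "spec_defined (prim \<mu>)"
    "prim_pleth \<mu> \<in> sym.span (e_part ` above (conj_part \<mu>))"
    "\<exists>c. c \<noteq> 0 \<and> pleth (prim \<mu>) (scaled_X (1 - q)) - scale_sym c (h_part \<mu>)
      \<in> sym.span (h_part ` strictly_above \<mu>)"
    "\<exists>c. c \<noteq> 0 \<and> prim_pleth \<mu> - scale_sym c (h_part \<mu>)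
      \<in> sym.span (h_part ` strictly_above \<mu>)"
    using * by - (elim conjE, assumption)+
qed

text \<open>Triangularity holds after X -> X(1-q), which is linear and injective, so the basis
  property can be pulled back.\<close>

lemma prim_basis:
  "indep_family partitions prim" "sym.span (prim ` partitions) = UNIV"
proof -
  obtain c where c: "\<And>\<mu>. is_partition \<mu> \<Longrightarrow> c \<mu> \<noteq> 0"
      "\<And>\<mu>. is_partition \<mu> \<Longrightarrow> pleth (prim \<mu>) (scaled_X (1 - q)) - scale_sym (c \<mu>) (h_part \<mu>)
      \<in> sym.span (h_part ` strictly_above \<mu>)"
    using prim_props(4) by metis
  note * = triangular_family[OF indep_complete span_complete c]
  show "indep_family partitions prim"
    by (rule indep_family_linear_image[OF pleth_props(1) *(1)])
  show "sym.span (prim ` partitions) = UNIV"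
    by (rule span_linear_image[OF pleth_props(1) inj_pleth_one_minus_q *(2)])
qed

lemma indep_prim_pleth: "indep_family partitions prim_pleth"
proof -
  obtain c where c: "\<And>\<mu>. is_partition \<mu> \<Longrightarrow> c \<mu> \<noteq> 0"
      "\<And>\<mu>. is_partition \<mu> \<Longrightarrow> prim_pleth \<mu> - scale_sym (c \<mu>) (h_part \<mu>)
      \<in> sym.span (h_part ` strictly_above \<mu>)"
    using prim_props(5) by metis
  show ?thesis by (rule triangular_family(1)[OF indep_complete span_complete c])
qed

lemma indep_spec_prim: "indep_family partitions (\<lambda>\<mu>. spec (prim \<mu>))"
  using indep_family_linear_image[OF pleth_props(1) indep_prim_pleth[unfolded prim_pleth_def]] .

text \<open>Once the component along the h of the hook is cancelled, the difference lies in both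
  spans of the intersection argument and vanishes.\<close>

lemma hook_sym_multiple:
  assumes "b < n"
  shows "\<exists>c. hook_sym n b = scale_sym c (prim_pleth (hook n b))"
proof -
  let ?\<mu> = "hook n b"
  let ?U = "sym.span (h_part ` strictly_above ?\<mu>) :: qt sym set"
  let ?h = "h_part ?\<mu> :: qt sym"
  note p = is_partition_hook[of n b]
  obtain d where d: "d \<noteq> 0" "prim_pleth ?\<mu> - scale_sym d ?h \<in> ?U" using prim_props(5)[OF p] by blast
  have "(hook_sym n b :: qt sym) \<in> sym.span (h_part ` insert ?\<mu> (strictly_above ?\<mu>))"
    using hook_sym_complete[OF assms, where 'a = qt] above_eq[OF p] by simp
  then obtain e where e: "hook_sym n b - scale_sym e ?h \<in> ?U"
    unfolding image_insert sym.span_breakdown_eq by blast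
  \<comment> \<open>d and e are the components along \<open>?h\<close>, so the factor e / d cancels
    them.\<close>
  have "hook_sym n b - scale_sym e ?h - scale_sym (e / d) (prim_pleth ?\<mu> - scale_sym d ?h) \<in> ?U"
    using d(2) e by (intro sym.span_diff[OF e] sym.span_scale)
  then have "hook_sym n b - scale_sym (e / d) (prim_pleth ?\<mu>) \<in> ?U"
    using d(1) by (simp add: scale_sym_diff scale_sym_scale_sym)
  moreover have "hook_sym n b - scale_sym (e / d) (prim_pleth ?\<mu>) \<in> sym.span (e_part ` above (conj_part ?\<mu>))"
    by (rule sym.span_diff[OF hook_sym_elem[OF assms] sym.span_scale[OF prim_props(3)[OF p]]])
  ultimately have "hook_sym n b - scale_sym (e / d) (prim_pleth ?\<mu>) = 0"
    by (rule complete_elem_intersection[OF p])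
  then show ?thesis by (intro exI[of _ "e / d"]) simp
qed

text \<open>Scaling eigenvectors does not change the eigenvector condition, so the description in
  \<open>Delta\<close> is equivalent to the one for the basis \<open>prim\<close>.\<close>

lemma Delta_props:
  "linear_sym (Delta Ht f)"
  "is_partition \<mu> \<Longrightarrow> Delta Ht f (prim \<mu>) = pleth f (const_sym (B_part \<mu>)) * prim \<mu>"
proof -
  define P where "P = (\<lambda>D. linear_sym D \<and>
     (\<forall>\<mu>. is_partition \<mu> \<longrightarrow> D (Ht \<mu>) = pleth f (const_sym (B_part \<mu>)) * Ht \<mu>))"
  define P' where "P' = (\<lambda>D. linear_sym D \<and>
     (\<forall>\<mu>\<in>partitions. D (prim \<mu>) = pleth f (const_sym (B_part \<mu>)) * prim \<mu>))"
  have "P = P'"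
  proof
    fix D
    have "D (Ht \<mu>) = pleth f (const_sym (B_part \<mu>)) * Ht \<mu> \<longleftrightarrow> D (prim \<mu>) = pleth f (const_sym (B_part \<mu>)) * prim \<mu>"
      if "is_partition \<mu>" "linear_sym D" for \<mu>
      using scale_sym_cancel[OF prim_props(1)[OF that(1)], of "D (Ht \<mu>)" "pleth f (const_sym (B_part \<mu>)) * Ht \<mu>"]
      by (auto simp: prim_def linear_sym_simps(3)[OF that(2)])
    then show "P D = P' D" by (auto simp: P_def P'_def)
  qed
  have "\<exists>!D. P' D"
    unfolding P'_def by (rule ex1_linear_on_basis[OF sym.vector_space_axioms prim_basis])
  then have "P' (THE D. P' D)" by (rule theI')
  then have P': "P' (Delta Ht f)" by (simp add: Delta_def P_def[symmetric] \<open>P = P'\<close>)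
  show "linear_sym (Delta Ht f)"
    using P' unfolding P'_def by (rule conjunct1)
  show "is_partition \<mu> \<Longrightarrow> Delta Ht f (prim \<mu>) = pleth f (const_sym (B_part \<mu>)) * prim \<mu>"
    using P' by (simp add: P'_def)
qed

lemma B_part_powers:
  assumes "is_partition \<mu>"
  shows "subst_qt (q ^ r) (t ^ r) (B_part \<mu>) = (\<Sum>(i, j)\<in>cells \<mu>. (q ^ r) ^ j * (t ^ r) ^ i)"
    "subst_qt (q ^ r) (t ^ r) (\<Sum>(i, j)\<in>cells \<mu>. q ^ j * (1 / q) ^ i) = (\<Sum>(i, j)\<in>cells \<mu>. (q ^ r) ^ j * (1 / q ^ r) ^ i)"
  unfolding B_part_eq[OF assms]
  by (subst subst_qt_sum(2); auto simp: subst_qt_mult subst_qt_power subst_qt_inverse intro!: sum.cong)+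

text \<open>p_r sends t to t^r, which specializes to q^(-r); the same results from specializing
  B_\<mu> first and replacing q by q^r afterwards.\<close>

lemma spec_pleth_B_part:
  assumes "is_partition \<mu>" "spec_defined f"
  shows "spec_defined (pleth f (const_sym (B_part \<mu>)))"
    "spec (pleth f (const_sym (B_part \<mu>))) = pleth (spec f) (const_sym (\<Sum>(i, j)\<in>cells \<mu>. q ^ j * (1 / q) ^ i))"
proof -
  let ?B = "\<Sum>(i, j)\<in>cells \<mu>. q ^ j * (1 / q) ^ i"
  have "regular (\<Sum>(i, j)\<in>cells \<mu>. (q ^ r) ^ j * (t ^ r) ^ i)"
      "special (\<Sum>(i, j)\<in>cells \<mu>. (q ^ r) ^ j * (t ^ r) ^ i) = (\<Sum>(i, j)\<in>cells \<mu>. (q ^ r) ^ j * (1 / q ^ r) ^ i)" for r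
    by (subst subst_qt_sum; auto simp: subst_qt_mult subst_qt_power power_one_over intro!: sum.cong)+
  then have E: "spec_defined (power_sum_pleth r (const_sym (B_part \<mu>)))"
      "spec (power_sum_pleth r (const_sym (B_part \<mu>))) = power_sum_pleth r (const_sym ?B)" if "r \<ge> 1" for r
    unfolding power_sum_pleth_const[OF that] B_part_powers[OF assms(1)]
    by (simp_all add: const_sym_eq spec_scale spec_generators)
  show "spec_defined (pleth f (const_sym (B_part \<mu>)))"
    "spec (pleth f (const_sym (B_part \<mu>))) = pleth (spec f) (const_sym ?B)"
    by (rule spec_pleth[OF assms(2) E]; assumption)+
qed

text \<open>On a hook the specialized B_\<mu> is a power of q times [n]_q, and homogeneity of degree
  k raises that power to the k-th.\<close>

lemma spec_pleth_B_hook: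
  assumes "b < n" "spec_defined f" "homogeneous_sym k f"
  shows "spec (pleth f (const_sym (B_part (hook n b)))) =
    scale_sym ((1 / q) ^ ((n - Suc b) * k)) (pleth (spec f) (const_sym (q_int n)))"
proof -
  have "homogeneous_sym k (spec f)"
    using assms(3) unfolding homogeneous_sym_def coeff_spec by (metis subst_qt_0)
  then have "pleth (spec f) (const_sym ((1 / q) ^ (n - Suc b) * q_int n)) =
      scale_sym (((1 / q) ^ (n - Suc b)) ^ k) (pleth (spec f) (const_sym (q_int n)))"
  proof (rule pleth_const_homogeneous)
    fix r :: nat
    have 1: "subst_qt_defined (q ^ r) (t ^ r) (1 / q)" "subst_qt (q ^ r) (t ^ r) (1 / q) = 1 / q ^ r"
      by (simp_all add: subst_qt_inverse)
    have 2: "subst_qt_defined (q ^ r) (t ^ r) (q_int n)"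
      unfolding q_int_def by (intro subst_qt_sum(1) subst_qt_power(1)) simp
    show "subst_qt (q ^ r) (t ^ r) ((1 / q) ^ (n - Suc b) * q_int n) =
        ((1 / q) ^ (n - Suc b)) ^ r * subst_qt (q ^ r) (t ^ r) (q_int n)"
      by (simp only: subst_qt_mult(2)[OF subst_qt_power(1)[OF 1(1)] 2] subst_qt_power(2)[OF 1(1)] 1(2))
        (simp add: power_one_over mult.commute flip: power_mult)
  qed
  then show ?thesis
    using spec_pleth_B_part(2)[OF is_partition_hook assms(2), of n b] special_B_hook[OF assms(1)]
    by (simp add: power_mult)
qed

text \<open>The specialized coefficients of e_n in the basis \<open>prim\<close> are read off from
  the hook expansion of e_n[X(1-q)]; each is then multiplied by its specialized eigenvalue.\<close>

lemma Delta_elem: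
  assumes n: "n \<ge> 1" and f: "homogeneous_sym k f" "spec_defined f"
  shows "spec_defined (Delta Ht f (elem_sym n))"
    "pleth (spec (Delta Ht f (elem_sym n))) (scaled_X (1 - q)) =
      (\<Sum>b<n. scale_sym ((1 - q) * q ^ b * (1 / q) ^ ((n - Suc b) * k))
        (pleth (spec f) (const_sym (q_int n)) * hook_sym n b))"
proof -
  let ?\<Phi> = "\<lambda>f. pleth f (scaled_X (1 - q))"
  have "(elem_sym n :: qt sym) \<in> sym.span (prim ` partitions)" by (simp add: prim_basis(2))
  then obtain A0 c0 where A0: "finite A0" "A0 \<subseteq> partitions" "elem_sym n = (\<Sum>\<mu>\<in>A0. scale_sym (c0 \<mu>) (prim \<mu>))"
    unfolding span_image_iff by blast
  \<comment> \<open>All hooks of size n are adjoined, with coefficient 0 where the expansion lacks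
    them, so that both expansions share an index set.\<close>
  define A where "A = A0 \<union> hook n ` {..<n}"
  define c where "c = (\<lambda>\<mu>. if \<mu> \<in> A0 then c0 \<mu> else 0)"
  have A: "finite A" "A \<subseteq> partitions"
    using A0 by (auto simp: A_def is_partition_hook)
  have part: "is_partition \<mu>" if "\<mu> \<in> A" for \<mu> using A(2) that by blast
  have hookA: "hook n b \<in> A" if "b < n" for b using that by (simp add: A_def)
  have e: "elem_sym n = (\<Sum>\<mu>\<in>A. scale_sym (c \<mu>) (prim \<mu>))"
    unfolding A0(3) using A(1) by (intro sum.mono_neutral_cong_left) (auto simp: A_def c_def)
  have reg: "regular (c \<mu>)" if "\<mu> \<in> A" for \<mu>
  proof (rule regular_coordinates[OF A(1) _ _ _ that])
    show "spec_defined (prim \<mu>)" if "\<mu> \<in> A" for \<mu> by (rule prim_props(2)[OF part[OF that]])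
    show "indep_family A (\<lambda>\<mu>. spec (prim \<mu>))" by (rule indep_family_subset[OF indep_spec_prim A(2)])
    show "spec_defined (\<Sum>\<mu>\<in>A. scale_sym (c \<mu>) (prim \<mu>))" unfolding e[symmetric] by (rule spec_generators)
  qed
  define \<kappa> where "\<kappa> = (\<lambda>b. SOME c. hook_sym n b = scale_sym c (prim_pleth (hook n b)))"
  have \<kappa>: "hook_sym n b = scale_sym (\<kappa> b) (prim_pleth (hook n b))" if "b < n" for b
    unfolding \<kappa>_def by (rule someI_ex[OF hook_sym_multiple[OF that]])
  \<comment> \<open>Regroups a sum over b, along the fibres of \<open>hook n\<close>, as a sum over
    partitions.\<close>
  have collect: "(\<Sum>\<mu>\<in>A. scale_sym (\<Sum>b | b < n \<and> hook n b = \<mu>. x b) (prim_pleth \<mu>)) =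
      (\<Sum>b<n. scale_sym (x b) (prim_pleth (hook n b)))" for x
  proof -
    have "(\<Sum>\<mu>\<in>A. scale_sym (\<Sum>b | b < n \<and> hook n b = \<mu>. x b) (prim_pleth \<mu>)) =
        (\<Sum>\<mu>\<in>A. \<Sum>b | b \<in> {..<n} \<and> hook n b = \<mu>. scale_sym (x b) (prim_pleth (hook n b)))"
      by (auto simp: scale_sum_sym intro!: sum.cong)
    also have "\<dots> = (\<Sum>b<n. scale_sym (x b) (prim_pleth (hook n b)))"
      using A(1) hookA by (intro sum.group) auto
    finally show ?thesis .
  qed
  \<comment> \<open>The coefficient that the hook expansion predicts; it is 0 unless \<mu> is one of
    the hooks.\<close>
  define w where "w = (\<lambda>\<mu>. \<Sum>b | b < n \<and> hook n b = \<mu>. (1 - q) * q ^ b * \<kappa> b)"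
  have special_c: "special (c \<mu>) = w \<mu>" if "\<mu> \<in> A" for \<mu>
  proof -
    have "(\<Sum>\<mu>\<in>A. scale_sym (special (c \<mu>)) (prim_pleth \<mu>)) = ?\<Phi> (spec (elem_sym n))"
      unfolding e using prim_props(2) part reg
      by (subst spec_linear_combination(2)) (auto simp: prim_pleth_def pleth_linear)
    also have "\<dots> = super_elem q n"
      using pleth_elem_one_minus_q[of n 1] by (simp add: spec_generators)
    also have "\<dots> = (\<Sum>b<n. scale_sym ((1 - q) * q ^ b * \<kappa> b) (prim_pleth (hook n b)))"
      unfolding super_elem_hooks[OF n] scale_sym_sum
      by (rule sum.cong) (simp_all add: \<kappa> scale_sym_scale_sym mult.assoc)
    also have "\<dots> = (\<Sum>\<mu>\<in>A. scale_sym (w \<mu>) (prim_pleth \<mu>))"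
      unfolding w_def by (rule collect[symmetric])
    finally have "(\<Sum>\<mu>\<in>A. scale_sym (special (c \<mu>) - w \<mu>) (prim_pleth \<mu>)) = 0"
      by (simp add: scale_sym_diff sum_subtractf)
    then have "special (c \<mu>) - w \<mu> = 0"
      using indep_familyD[OF indep_prim_pleth A(1,2), of "\<lambda>\<mu>. special (c \<mu>) - w \<mu>"] that by blast
    then show ?thesis by simp
  qed
  define d where "d = (\<lambda>\<mu>. SOME d. pleth f (const_sym (B_part \<mu>)) = const_sym d)"
  have d: "pleth f (const_sym (B_part \<mu>)) = const_sym (d \<mu>)" for \<mu>
    unfolding d_def by (rule someI_ex[OF pleth_const_is_const])
  have D: "Delta Ht f (elem_sym n) = (\<Sum>\<mu>\<in>A. scale_sym (c \<mu> * d \<mu>) (prim \<mu>))"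
    unfolding e linear_sym_simps[OF Delta_props(1)]
    by (rule sum.cong) (simp_all add: Delta_props(2) part d const_sym_mult scale_sym_scale_sym)
  have reg_d: "regular (d \<mu>)" if "\<mu> \<in> A" for \<mu>
    using spec_definedD[OF spec_pleth_B_part(1)[OF part[OF that] f(2)], of "{#}"]
    by (simp add: d const_sym.rep_eq)
  have reg': "regular (c \<mu> * d \<mu>)" "special (c \<mu> * d \<mu>) = w \<mu> * special (d \<mu>)" if "\<mu> \<in> A" for \<mu>
    using subst_qt_mult[OF reg[OF that] reg_d[OF that]] special_c[OF that] by simp_all
  note comb = spec_linear_combination[of A "\<lambda>\<mu>. c \<mu> * d \<mu>" prim, OF reg'(1) prim_props(2)[OF part]]
  show "spec_defined (Delta Ht f (elem_sym n))" unfolding D using comb(1) by simp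
  have "?\<Phi> (spec (Delta Ht f (elem_sym n))) = (\<Sum>\<mu>\<in>A. scale_sym (special (c \<mu> * d \<mu>)) (prim_pleth \<mu>))"
    unfolding D using comb(2) by (simp add: pleth_linear prim_pleth_def)
  also have "\<dots> = (\<Sum>\<mu>\<in>A. scale_sym (\<Sum>b | b < n \<and> hook n b = \<mu>. (1 - q) * q ^ b * \<kappa> b * special (d (hook n b))) (prim_pleth \<mu>))"
    by (rule sum.cong) (auto simp: reg'(2) w_def sum_distrib_right intro!: sum.cong arg_cong2[of _ _ _ _ scale_sym])
  also have "\<dots> = (\<Sum>b<n. scale_sym ((1 - q) * q ^ b * \<kappa> b * special (d (hook n b))) (prim_pleth (hook n b)))"
    by (rule collect)
  also have "\<dots> = (\<Sum>b<n. scale_sym ((1 - q) * q ^ b * (1 / q) ^ ((n - Suc b) * k))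
        (pleth (spec f) (const_sym (q_int n)) * hook_sym n b))"
  proof (rule sum.cong[OF refl])
    fix b assume "b \<in> {..<n}"
    then have b: "b < n" by simp
    obtain E where E: "pleth (spec f) (const_sym (q_int n)) = const_sym E"
      using pleth_const_is_const by blast
    \<comment> \<open>The eigenvalue is recovered as a constant term, where
      \<open>spec_pleth_B_hook\<close> applies.\<close>
    have "special (d (hook n b)) = coeff_sym (spec (const_sym (d (hook n b)))) {#}"
      by (simp add: coeff_spec const_sym.rep_eq)
    also have "\<dots> = (1 / q) ^ ((n - Suc b) * k) * E"
      unfolding d[symmetric] spec_pleth_B_hook[OF b f(2,1)] E by (simp add: const_sym.rep_eq)
    finally show "scale_sym ((1 - q) * q ^ b * \<kappa> b * special (d (hook n b))) (prim_pleth (hook n b)) =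
        scale_sym ((1 - q) * q ^ b * (1 / q) ^ ((n - Suc b) * k)) (pleth (spec f) (const_sym (q_int n)) * hook_sym n b)"
      unfolding E \<kappa>[OF b] const_sym_mult by (simp add: scale_sym_scale_sym mult_ac)
  qed
  finally show "?\<Phi> (spec (Delta Ht f (elem_sym n))) =
      (\<Sum>b<n. scale_sym ((1 - q) * q ^ b * (1 / q) ^ ((n - Suc b) * k))
        (pleth (spec f) (const_sym (q_int n)) * hook_sym n b))" .
qed

end

theorem theorem5p1:
  fixes n k :: nat and f :: "qt sym" and Ht :: "nat list \<Rightarrow> qt sym"
  assumes "n \<ge> 1"
    and "\<And>\<mu>. is_partition \<mu> \<Longrightarrow> is_modified_macdonald \<mu> (Ht \<mu>)"
    and "homogeneous_sym k f"
    and "spec_defined f"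
  shows "spec_defined (Delta Ht f (elem_sym n)) \<and>
    spec (Delta Ht f (elem_sym n)) =
      scale_sym (1 / (q ^ (k * (n - 1)) * q_int (k + 1)))
        (pleth (spec f) (const_sym (q_int n)) *
         pleth (elem_sym n) (X_sym * const_sym (q_int (k + 1))))"
proof -
  interpret macdonald_family Ht by unfold_locales (rule assms(2))
  \<comment> \<open>Both sides are compared after X -> X(1-q), which is injective.\<close>
  let ?\<Phi> = "\<lambda>f. pleth f (scaled_X (1 - q))"
  let ?f = "pleth (spec f) (const_sym (q_int n))"
  let ?s = "1 / (q ^ (k * (n - 1)) * q_int (k + 1))"
  obtain E where E: "?f = const_sym E" using pleth_const_is_const by blast
  \<comment> \<open>[k+1]_q (1 - q) = 1 - q^(k+1), so the right-hand side turns into the hook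
    expansion at u = q^(k+1).\<close>
  have e: "?\<Phi> (pleth (elem_sym n) (scaled_X (q_int (k + 1)))) = super_elem (q ^ (k + 1)) n"
    unfolding pleth_elem_one_minus_q[symmetric]
  proof (rule pleth_comp)
    fix r :: nat
    have "(\<Sum>i<k + 1. (q ^ r) ^ i) * (1 - q ^ r) = 1 - (q ^ r) ^ (k + 1)"
      by (simp only: one_diff_power_eq mult.commute)
    moreover have "(q ^ (k + 1)) ^ r = (q ^ r) ^ (k + 1)"
      by (simp only: mult.commute flip: power_mult)
    ultimately show "subst_qt (q ^ r) (t ^ r) (q_int (k + 1)) * subst_qt (q ^ r) (t ^ r) (1 - q) =
        subst_qt (q ^ r) (t ^ r) (1 - q ^ (k + 1))"
      unfolding subst_power_simps by (simp only:)
  qed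
  have "?\<Phi> (scale_sym ?s (?f * pleth (elem_sym n) (scaled_X (q_int (k + 1))))) =
      scale_sym (?s * E) (super_elem (q ^ (k + 1)) n)"
    unfolding E const_sym_mult pleth_linear e scale_sym_scale_sym ..
  also have "\<dots> = (\<Sum>b<n. scale_sym (?s * E * (1 - q ^ (k + 1)) * (q ^ (k + 1)) ^ b) (hook_sym n b))"
    unfolding super_elem_hooks[OF assms(1)] by (simp only: scale_sym_sum scale_sym_scale_sym mult.assoc)
  also have "\<dots> = (\<Sum>b<n. scale_sym ((1 - q) * q ^ b * (1 / q) ^ ((n - Suc b) * k)) (?f * hook_sym n b))"
  proof (rule sum.cong[OF refl])
    fix b assume "b \<in> {..<n}"
    \<comment> \<open>n - 1 is leg plus arm. The leg accounts for the eigenvalue factor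
      q^(-k(n-1-b)), and the arm for the q^(kb) in u^b = q^b q^(kb).\<close>
    then have "n - 1 = (n - Suc b) + b" by simp
    then have "q ^ (k * (n - 1)) = q ^ ((n - Suc b) * k) * q ^ (k * b)"
      by (simp only: distrib_left power_add mult.commute)
    moreover have "(q ^ (k + 1)) ^ b = q ^ b * q ^ (k * b)"
      by (simp add: power_mult_distrib mult.commute flip: power_mult)
    \<comment> \<open>Here the factor 1/[k+1]_q trades the prefactor 1 - u of the hook expansion for
      1 - q.\<close>
    moreover have "?s * (1 - q ^ (k + 1)) = (1 - q) / q ^ (k * (n - 1))"
      unfolding q_int_mult[symmetric] using q_int_nonzero[of "k + 1"] by simp
    ultimately have "?s * (1 - q ^ (k + 1)) * (q ^ (k + 1)) ^ b = (1 - q) * q ^ b * (1 / q) ^ ((n - Suc b) * k)"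
      by (simp add: power_one_over)
    then show "scale_sym (?s * E * (1 - q ^ (k + 1)) * (q ^ (k + 1)) ^ b) (hook_sym n b) =
        scale_sym ((1 - q) * q ^ b * (1 / q) ^ ((n - Suc b) * k)) (?f * hook_sym n b)"
      unfolding E const_sym_mult scale_sym_scale_sym by (simp only: mult_ac)
  qed
  also have "\<dots> = ?\<Phi> (spec (Delta Ht f (elem_sym n)))"
    by (rule Delta_elem(2)[OF assms(1,3,4), symmetric])
  finally have "spec (Delta Ht f (elem_sym n)) = scale_sym ?s (?f * pleth (elem_sym n) (scaled_X (q_int (k + 1))))"
    using injD[OF inj_pleth_one_minus_q] by metis
  then show ?thesis
    using Delta_elem(1)[OF assms(1,3,4)] unfolding scaled_X_def by blast
qed

end
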